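(* Let $\Delta$ be a simplicial forest on the vertex set $\{x_1,\dots,x_n\}$. For any leaf $F$ of $\Delta$, the complexes $\Delta'=\Delta\setminus F$, $\Omega=\Delta\setminus\mathrm{conn}_\Delta(F)$ and $\overline{\mathrm{conn}}_\Delta(F)$ are also simplicial forests. Furthermore, the numbers $\beta_{i,j}(\mathcal{I}(\Delta))$ for all $i\ge1$ and $j\ge0$ can be computed recursively using the formula \[\beta_{i,j}(\mathcal{I}(\Delta))=\beta_{i,j}(\mathcal{I}(\Delta'))+\sum_{l_1=0}^{i}\sum_{l_2=0}^{j-|F|}\beta_{l_1-1,\,l_2}\big(\mathcal{I}(\overline{\mathrm{conn}}_\Delta(F))\big)\,\beta_{i-l_1-1,\,j-|F|-l_2}(\mathcal{I}(\Omega)).\]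
   Context: Let $R=k[x_1,\dots,x_n]$, $k$ an arbitrary field. A simplicial complex $\Delta$ on $\{x_1,\dots,x_n\}$ is a collection of subsets closed under taking subsets and containing all $\{x_i\}$; facets are its maximal faces, and $\mathcal{F}(\Delta)$ is the set of facets. A face $F$ also denotes the monomial $\prod_{x\in F}x$. The facet ideal is $\mathcal{I}(\Delta)=(\{F\mid F\in\mathcal{F}(\Delta)\})$; a complex with no facets has facet ideal $(0)$ (and is trivially a forest). All facet ideals are viewed in $R$. A subcomplex of $\Delta$ means a simplicial complex whose facet set is a subset of $\mathcal{F}(\Delta)$ (on the vertices occurring in its facets). $\Delta\setminus F$ has facet set $\mathcal{F}(\Delta)\setminus\{F\}$, and for a subcomplex $\Gamma$, $\Delta\setminus\Gamma$ has facet set $\mathcal{F}(\Delta)\setminus\mathcal{F}(\Gamma)$. Two facets $F,G$ are connected if there is a chain of facets $F=F_0,\dots,F_m=G$ with $F_i\cap F_{i+1}\neq\emptyset$ for all $i$; a complex is connected if any two of its facets are connected. A facet $F$ of $\Delta$ is a leaf if either $F$ is the only facet, or there is a facet $G\ne F$ with $F\cap F'\subseteq F\cap G$ for every facet $F'\ne F$. $\Delta$ is a tree if it is connected and every nonempty connected subcomplex of $\Delta$ (including $\Delta$) has a leaf; $\Delta$ is a forest if every connected component is a tree. $\mathrm{conn}_\Delta(F)$ is the connected component of $\Delta$ containing $F$. If $G_1,\dots,G_p$ are the facets of $\mathrm{conn}_\Delta(F)\setminus F$, then $\overline{\mathrm{conn}}_\Delta(F)$ is the simplicial complex whose facets are the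 inclusion-minimal sets among $G_1\setminus F,\dots,G_p\setminus F$ (each occurring once). $\beta_{i,j}(I)=\dim_k\mathrm{Tor}_i^R(I,k)_j$ for $i\ge0$; by convention, for every ideal $I$ (including $(0)$), $\beta_{-1,0}(I)=1$ and $\beta_{-1,j}(I)=0$ for $j\ne0$. *)

theory Defs
  imports Complex_Main "HOL-Library.Poly_Mapping"
begin

section \<open>Simplicial complexes, trees and forests\<close>

text \<open>
  A complex is the set of all its faces.  The complex without any face, \<^term>\<open>{}\<close>, is allowed;
  it is the complex with no facets.  Complexes obtained from one another by removing facets
  have their own, possibly smaller, vertex set, namely the union of their facets.
\<close>

definition simplicial_complex :: "'v set \<Rightarrow> 'v set set \<Rightarrow> bool" where
  "simplicial_complex V \<Delta> \<longleftrightarrow>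
     \<Delta> \<subseteq> Pow V \<and> (\<forall>F\<in>\<Delta>. \<forall>G. G \<subseteq> F \<longrightarrow> G \<in> \<Delta>) \<and> (\<forall>x\<in>V. {x} \<in> \<Delta>)"

definition facets :: "'v set set \<Rightarrow> 'v set set" where
  "facets \<Delta> = {F \<in> \<Delta>. \<forall>G\<in>\<Delta>. F \<subseteq> G \<longrightarrow> G = F}"

text \<open>
  The complex generated by a collection of sets.  Its facets are the members of the collection
  if these are pairwise incomparable, as they are wherever this is used below.
\<close>

definition generated_complex :: "'v set set \<Rightarrow> 'v set set" where
  "generated_complex S = {G. \<exists>F\<in>S. G \<subseteq> F}"

definition subcomplex :: "'v set set \<Rightarrow> 'v set set \<Rightarrow> bool" where
  "subcomplex \<Gamma> \<Delta> \<longleftrightarrow> simplicial_complex (\<Union>\<Gamma>) \<Gamma> \<and> facets \<Gamma> \<subseteq> facets \<Delta>"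

definition remove_facet :: "'v set set \<Rightarrow> 'v set \<Rightarrow> 'v set set" where
  "remove_facet \<Delta> F = generated_complex (facets \<Delta> - {F})"

definition remove_subcomplex :: "'v set set \<Rightarrow> 'v set set \<Rightarrow> 'v set set" where
  "remove_subcomplex \<Delta> \<Gamma> = generated_complex (facets \<Delta> - facets \<Gamma>)"

definition connected_facets :: "'v set set \<Rightarrow> 'v set \<Rightarrow> 'v set \<Rightarrow> bool" where
  "connected_facets \<Delta> F G \<longleftrightarrow> F \<in> facets \<Delta> \<and> G \<in> facets \<Delta> \<and>
     (\<lambda>A B. A \<in> facets \<Delta> \<and> B \<in> facets \<Delta> \<and> A \<inter> B \<noteq> {})\<^sup>*\<^sup>* F G"

definition connected_complex :: "'v set set \<Rightarrow> bool" where
  "connected_complex \<Delta> \<longleftrightarrow> (\<forall>F\<in>facets \<Delta>. \<forall>G\<in>facets \<Delta>. connected_facets \<Delta> F G)"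

definition leaf :: "'v set set \<Rightarrow> 'v set \<Rightarrow> bool" where
  "leaf \<Delta> F \<longleftrightarrow> F \<in> facets \<Delta> \<and>
     (facets \<Delta> = {F} \<or>
      (\<exists>G\<in>facets \<Delta>. G \<noteq> F \<and> (\<forall>F'\<in>facets \<Delta>. F' \<noteq> F \<longrightarrow> F \<inter> F' \<subseteq> F \<inter> G)))"

definition tree :: "'v set set \<Rightarrow> bool" where
  "tree \<Delta> \<longleftrightarrow> connected_complex \<Delta> \<and>
     (\<forall>\<Gamma>. subcomplex \<Gamma> \<Delta> \<and> \<Gamma> \<noteq> {} \<and> connected_complex \<Gamma> \<longrightarrow> (\<exists>F. leaf \<Gamma> F))"

definition conn :: "'v set set \<Rightarrow> 'v set \<Rightarrow> 'v set set" where
  "conn \<Delta> F = generated_complex {G. connected_facets \<Delta> F G}"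

definition simplicial_forest :: "'v set \<Rightarrow> 'v set set \<Rightarrow> bool" where
  "simplicial_forest V \<Delta> \<longleftrightarrow> simplicial_complex V \<Delta> \<and> (\<forall>F\<in>facets \<Delta>. tree (conn \<Delta> F))"

definition minimal_sets :: "'v set set \<Rightarrow> 'v set set" where
  "minimal_sets S = {A \<in> S. \<forall>B\<in>S. B \<subseteq> A \<longrightarrow> B = A}"

definition conn_bar :: "'v set set \<Rightarrow> 'v set \<Rightarrow> 'v set set" where
  "conn_bar \<Delta> F =
     generated_complex (minimal_sets ((\<lambda>G. G - F) ` facets (remove_facet (conn \<Delta> F) F)))"

section \<open>The polynomial ring and facet ideals\<close>

text \<open>
  Polynomials in the variables \<open>'v\<close> over \<open>'k\<close>, as finitely supported functions from exponent
  vectors to coefficients; the library makes this type a commutative ring.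
\<close>

type_synonym ('v, 'k) polynomial = "('v \<Rightarrow>\<^sub>0 nat) \<Rightarrow>\<^sub>0 'k"

definition variable :: "'v \<Rightarrow> ('v, 'k::comm_ring_1) polynomial" where
  "variable x = Poly_Mapping.single (Poly_Mapping.single x 1) 1"

definition const_poly :: "'k \<Rightarrow> ('v, 'k::comm_ring_1) polynomial" where
  "const_poly a = Poly_Mapping.single 0 a"

text \<open>The quotient map onto the residue field \<open>k = R / (x\<^sub>1, \<dots>, x\<^sub>n)\<close>.\<close>

definition constant_coeff :: "('v, 'k::comm_ring_1) polynomial \<Rightarrow> 'k" where
  "constant_coeff p = Poly_Mapping.lookup p 0"

definition homogeneous :: "int \<Rightarrow> ('v, 'k::comm_ring_1) polynomial \<Rightarrow> bool" where
  "homogeneous d p \<longleftrightarrow>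
     (\<forall>m\<in>Poly_Mapping.keys p. int (\<Sum>x\<in>Poly_Mapping.keys m. Poly_Mapping.lookup m x) = d)"

definition face_monomial :: "'v set \<Rightarrow> ('v, 'k::comm_ring_1) polynomial" where
  "face_monomial F = (\<Prod>x\<in>F. variable x)"

definition facet_ideal :: "'v set set \<Rightarrow> ('v, 'k::comm_ring_1) polynomial set" where
  "facet_ideal \<Delta> = module.span (*) (face_monomial ` facets \<Delta>)"

section \<open>Graded free resolutions and graded Betti numbers\<close>

text \<open>
  The free module on a basis \<open>B\<close> of natural numbers consists of the finitely supported
  coordinate functions vanishing outside \<open>B\<close>.
\<close>

definition free_module :: "nat set \<Rightarrow> (nat \<Rightarrow>\<^sub>0 'a::zero) set" where
  "free_module B = {f. Poly_Mapping.keys f \<subseteq> B}"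

definition scale :: "'a::comm_ring_1 \<Rightarrow> (nat \<Rightarrow>\<^sub>0 'a) \<Rightarrow> (nat \<Rightarrow>\<^sub>0 'a)" where
  "scale r f = Poly_Mapping.map ((*) r) f"

text \<open>The element \<open>f\<close> of \<open>\<Oplus>\<^sub>c R(-e c)\<close> is homogeneous of degree \<open>j\<close>.\<close>

definition homogeneous_vec ::
  "(nat \<Rightarrow> int) \<Rightarrow> int \<Rightarrow> (nat \<Rightarrow>\<^sub>0 ('v, 'k::comm_ring_1) polynomial) \<Rightarrow> bool" where
  "homogeneous_vec e j f \<longleftrightarrow>
     (\<forall>c\<in>Poly_Mapping.keys f. homogeneous (j - e c) (Poly_Mapping.lookup f c))"

text \<open>
  A graded free resolution \<open>\<dots> \<rightarrow> F\<^sub>2 \<rightarrow> F\<^sub>1 \<rightarrow> F\<^sub>0 \<rightarrow> I \<rightarrow> 0\<close> by finitely generated modules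
  (they suffice, the polynomial ring being Noetherian), not necessarily minimal.
  \<open>F\<^sub>i\<close> has the finite basis \<open>B i\<close>, the basis element \<open>c\<close> having degree \<open>e i c\<close>;
  \<open>d i\<close> is the differential from \<open>F\<^sub>i\<close> to the module before it, for \<open>i \<ge> 1\<close> (\<open>d 0\<close> plays no
  role); \<open>aug\<close> is the augmentation.  Maps are of degree \<open>0\<close>.  They are total functions, of which
  only the restrictions to the modules \<open>F\<^sub>i\<close> matter.
\<close>

definition graded_free_resolution ::
  "('v, 'k::comm_ring_1) polynomial set \<Rightarrow> (nat \<Rightarrow> nat set) \<Rightarrow> (nat \<Rightarrow> nat \<Rightarrow> int) \<Rightarrow>
   (nat \<Rightarrow> (nat \<Rightarrow>\<^sub>0 ('v, 'k) polynomial) \<Rightarrow> (nat \<Rightarrow>\<^sub>0 ('v, 'k) polynomial)) \<Rightarrow>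
   ((nat \<Rightarrow>\<^sub>0 ('v, 'k) polynomial) \<Rightarrow> ('v, 'k) polynomial) \<Rightarrow> bool" where
  "graded_free_resolution I B e d aug \<longleftrightarrow>
     (\<forall>i. finite (B i)) \<and>
     (\<forall>i. module_hom scale scale (d (Suc i))) \<and>
     (\<forall>i. \<forall>c\<in>B (Suc i). homogeneous_vec (e i) (e (Suc i) c) (d (Suc i) (Poly_Mapping.single c 1))) \<and>
     module_hom scale (*) aug \<and>
     (\<forall>c\<in>B 0. homogeneous (e 0 c) (aug (Poly_Mapping.single c 1))) \<and>
     aug ` free_module (B 0) = I \<and>
     d 1 ` free_module (B 1) = {f \<in> free_module (B 0). aug f = 0} \<and>
     (\<forall>i. d (Suc (Suc i)) ` free_module (B (Suc (Suc i))) =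
          {f \<in> free_module (B (Suc i)). d (Suc i) f = 0})"

text \<open>
  If \<open>F\<close> is free over \<open>R\<close> with basis \<open>B\<close>, then \<open>F \<otimes> k\<close> is the \<open>k\<close>-vector space with basis \<open>B\<close>,
  and a map \<open>\<phi>\<close> of free modules induces \<open>\<phi> \<otimes> k\<close> by reducing its matrix entries modulo
  \<open>(x\<^sub>1, \<dots>, x\<^sub>n)\<close>.
\<close>

definition tensor_residue ::
  "((nat \<Rightarrow>\<^sub>0 ('v, 'k::comm_ring_1) polynomial) \<Rightarrow> (nat \<Rightarrow>\<^sub>0 ('v, 'k) polynomial)) \<Rightarrow>
   (nat \<Rightarrow>\<^sub>0 'k) \<Rightarrow> (nat \<Rightarrow>\<^sub>0 'k)" where
  "tensor_residue \<phi> v = Poly_Mapping.map constant_coeff (\<phi> (Poly_Mapping.map const_poly v))"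

text \<open>Cycles and boundaries of the complex \<open>F \<otimes> k\<close> in homological degree \<open>i\<close>, internal degree \<open>j\<close>.\<close>

definition tor_cycles ::
  "(nat \<Rightarrow> nat set) \<Rightarrow> (nat \<Rightarrow> nat \<Rightarrow> int) \<Rightarrow>
   (nat \<Rightarrow> (nat \<Rightarrow>\<^sub>0 ('v, 'k::comm_ring_1) polynomial) \<Rightarrow> (nat \<Rightarrow>\<^sub>0 ('v, 'k) polynomial)) \<Rightarrow>
   nat \<Rightarrow> int \<Rightarrow> (nat \<Rightarrow>\<^sub>0 'k) set" where
  "tor_cycles B e d i j =
     {v \<in> free_module {c \<in> B i. e i c = j}. i = 0 \<or> tensor_residue (d i) v = 0}"

definition tor_boundaries ::
  "(nat \<Rightarrow> nat set) \<Rightarrow> (nat \<Rightarrow> nat \<Rightarrow> int) \<Rightarrow>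
   (nat \<Rightarrow> (nat \<Rightarrow>\<^sub>0 ('v, 'k::comm_ring_1) polynomial) \<Rightarrow> (nat \<Rightarrow>\<^sub>0 ('v, 'k) polynomial)) \<Rightarrow>
   nat \<Rightarrow> int \<Rightarrow> (nat \<Rightarrow>\<^sub>0 'k) set" where
  "tor_boundaries B e d i j =
     tensor_residue (d (Suc i)) ` free_module {c \<in> B (Suc i). e (Suc i) c = j}"

text \<open>
  \<open>dim\<^sub>k Tor\<^sub>i(I, k)\<^sub>j\<close>: the dimension of cycles modulo boundaries, for any graded free resolution
  of \<open>I\<close>; the number does not depend on the resolution.
\<close>

definition tor_dim :: "('v, 'k::field) polynomial set \<Rightarrow> nat \<Rightarrow> int \<Rightarrow> nat" where
  "tor_dim I i j = (THE b. \<exists>B e d aug. graded_free_resolution I B e d aug \<and>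
     b = vector_space.dim scale (tor_cycles B e d i j)
         - vector_space.dim scale (tor_boundaries B e d i j))"

text \<open>
  Both indices are integers, so that the convention for \<open>i = -1\<close> can be expressed and no index
  difference is truncated.
\<close>

definition betti :: "('v, 'k::field) polynomial set \<Rightarrow> int \<Rightarrow> int \<Rightarrow> nat" where
  "betti I i j =
     (if i \<ge> 0 then tor_dim I (nat i) j
      else if i = -1 \<and> j = 0 then 1 else 0)"

end

theory Submission
  imports Defs
begin

text \<open>
  Let \<open>m = x m'\<close> be the monomial of a leaf \<open>F\<close> with free vertex \<open>x\<close>, and \<open>I'\<close> the ideal of the
  remaining facets.  The mapping cone of a lift of \<open>m : R/(I' : m) \<rightarrow> R/I'\<close> to free resolutions
  resolves \<open>R/(I' + (m))\<close>.  As no generator of \<open>I'\<close> involves \<open>x\<close>, the ideal \<open>(I' : m)\<close> equals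
  \<open>(I' : m')\<close>, so the lift can be chosen as \<open>x\<close> times a lift of \<open>m'\<close>.  It vanishes modulo the
  variables, whence \<open>\<beta>\<^sub>i\<^sub>,\<^sub>j(I' + (m)) = \<beta>\<^sub>i\<^sub>,\<^sub>j(I') + \<beta>\<^sub>i\<^sub>-\<^sub>1\<^sub>,\<^sub>j\<^sub>-\<^sub>|\<^sub>F\<^sub>|(I' : m)\<close>, for all integers \<open>i\<close>
  with the convention for \<open>i = -1\<close>.

  Here \<open>(I' : m)\<close> is the sum of the ideals of \<open>conn_bar \<Delta> F\<close> and of \<open>\<Omega>\<close>, which have no common
  vertices.  No tensor product of resolutions is needed for the product formula: \<open>\<Omega>\<close> is a forest,
  and both sides obey the recursion above when a leaf of \<open>\<Omega>\<close> is removed.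
\<close>

section \<open>Free modules\<close>

text \<open>\<open>tor_dim\<close> is a definite description over all resolutions, so two debts
  precede any computation: all resolutions must give the same number, and one must exist. The first
  is settled by the comparison theorem in graded form; the second is not drawn from a general syzygy
  theorem but supplied by the cones themselves, starting from the zero ideal. Resolving
  \<open>R/I\<close> rather than \<open>I\<close> turns the convention for homological index -1 into
  an honest Betti number of \<open>R/I\<close> in degree 0, so that one cone formula serves every
  index. The inductions rest on a hereditary form of the forest property: every nonempty subfamily
  of the facets has a leaf. It passes to subfamilies and to the sets \<open>G - L\<close>, so
  deleting a leaf and forming the colon ideal both lead to smaller families of the same kind. In the
  product formula the facets of \<open>conn_bar\<close> are a parameter known only as nonempty sets,
  disjoint from the varying family, whose ideal has a resolution and no Betti numbers in negative
  internal degrees. The induction ends at the zero ideal, whose Betti numbers are the unit of the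
  convolution.\<close>

lemma lookup_scale [simp]:
  "Poly_Mapping.lookup (scale r f) c = r * Poly_Mapping.lookup f c"
  by (simp add: scale_def map.rep_eq when_def)

interpretation free: module "scale :: 'a::comm_ring_1 \<Rightarrow> (nat \<Rightarrow>\<^sub>0 'a) \<Rightarrow> _"
  by unfold_locales
    (auto intro!: poly_mapping_eqI simp: lookup_add algebra_simps)

lemma module_mult: "module ((*) :: 'a::comm_ring_1 \<Rightarrow> 'a \<Rightarrow> 'a)"
  by unfold_locales (auto simp: algebra_simps)

interpretation kvec: vector_space "scale :: 'k::field \<Rightarrow> (nat \<Rightarrow>\<^sub>0 'k) \<Rightarrow> _"
  by unfold_locales (auto simp: free.scale_right_distrib free.scale_left_distrib)

abbreviation free_hom :: "((nat \<Rightarrow>\<^sub>0 'a::comm_ring_1) \<Rightarrow> (nat \<Rightarrow>\<^sub>0 'a)) \<Rightarrow> bool" where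
  "free_hom \<equiv> module_hom scale scale"

abbreviation unit_vec :: "nat \<Rightarrow> (nat \<Rightarrow>\<^sub>0 'a::comm_ring_1)" where
  "unit_vec c \<equiv> Poly_Mapping.single c 1"

lemma scale_unit_vec [simp]: "scale r (unit_vec c) = Poly_Mapping.single c r"
  by (auto intro!: poly_mapping_eqI simp: lookup_single when_def)

lemma subspace_free_module: "free.subspace (free_module B)"
proof (rule free.subspaceI)
  show "0 \<in> free_module B" by (simp add: free_module_def)
next
  fix f g :: "nat \<Rightarrow>\<^sub>0 'a" assume "f \<in> free_module B" "g \<in> free_module B"
  then show "f + g \<in> free_module B" using keys_add[of f g] by (auto simp: free_module_def)
next
  fix r and f :: "nat \<Rightarrow>\<^sub>0 'a" assume "f \<in> free_module B"
  then show "scale r f \<in> free_module B" by (auto simp: free_module_def in_keys_iff subset_eq)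
qed

lemma single_in_free_module [simp]: "c \<in> B \<Longrightarrow> Poly_Mapping.single c r \<in> free_module B"
  by (auto simp: free_module_def)

lemma vec_expand:
  assumes "finite S" "Poly_Mapping.keys f \<subseteq> S"
  shows "f = (\<Sum>c\<in>S. scale (Poly_Mapping.lookup f c) (unit_vec c))"
proof (rule poly_mapping_eqI)
  fix d
  have "(\<Sum>c\<in>S. Poly_Mapping.lookup (scale (Poly_Mapping.lookup f c) (unit_vec c)) d) =
    (\<Sum>c\<in>S. if c = d then Poly_Mapping.lookup f c else 0)"
    by (intro sum.cong) (auto simp: lookup_single)
  also have "\<dots> = Poly_Mapping.lookup f d"
    using assms by (auto simp: sum.delta in_keys_iff)
  finally show "Poly_Mapping.lookup f d =
      Poly_Mapping.lookup (\<Sum>c\<in>S. scale (Poly_Mapping.lookup f c) (unit_vec c)) d"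
    by (simp add: lookup_sum)
qed

lemma hom_expand:
  assumes "module_hom scale s \<phi>"
  shows "\<phi> f = (\<Sum>c\<in>Poly_Mapping.keys f. s (Poly_Mapping.lookup f c) (\<phi> (unit_vec c)))"
proof -
  interpret \<phi>: module_hom scale s \<phi> by fact
  have "\<phi> f = \<phi> (\<Sum>c\<in>Poly_Mapping.keys f. scale (Poly_Mapping.lookup f c) (unit_vec c))"
    by (rule arg_cong[where f = \<phi>], rule vec_expand) auto
  also have "\<dots> = (\<Sum>c\<in>Poly_Mapping.keys f. \<phi> (scale (Poly_Mapping.lookup f c) (unit_vec c)))"
    by (rule \<phi>.sum)
  finally show ?thesis by (simp only: \<phi>.scale)
qed

lemma hom_eq_on_free_module:
  assumes "module_hom scale s \<phi>" "module_hom scale s \<psi>"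
    and "\<And>c. c \<in> B \<Longrightarrow> \<phi> (unit_vec c) = \<psi> (unit_vec c)" "f \<in> free_module B"
  shows "\<phi> f = \<psi> f"
  using assms(3,4)
  by (subst hom_expand[OF assms(1)], subst hom_expand[OF assms(2)])
    (auto intro!: sum.cong simp: free_module_def subset_eq)

text \<open>The linear map with prescribed values on the basis. Freeness of the modules enters the
  lifting arguments through it.\<close>

definition hom_extend :: "(nat \<Rightarrow> (nat \<Rightarrow>\<^sub>0 'a::comm_ring_1)) \<Rightarrow> (nat \<Rightarrow>\<^sub>0 'a) \<Rightarrow> (nat \<Rightarrow>\<^sub>0 'a)" where
  "hom_extend u f = (\<Sum>c\<in>Poly_Mapping.keys f. scale (Poly_Mapping.lookup f c) (u c))"

lemma hom_extend_superset:
  assumes "finite S" "Poly_Mapping.keys f \<subseteq> S"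
  shows "hom_extend u f = (\<Sum>c\<in>S. scale (Poly_Mapping.lookup f c) (u c))"
  unfolding hom_extend_def using assms
  by (intro sum.mono_neutral_left) (auto simp: in_keys_iff)

lemma free_hom_hom_extend: "free_hom (hom_extend u)"
proof unfold_locales
  fix f g :: "nat \<Rightarrow>\<^sub>0 'a" and r
  let ?S = "Poly_Mapping.keys f \<union> Poly_Mapping.keys g"
  have "Poly_Mapping.keys (f + g) \<subseteq> ?S" by (rule keys_add)
  then show "hom_extend u (f + g) = hom_extend u f + hom_extend u g"
    by (simp add: hom_extend_superset[of ?S] lookup_add free.scale_left_distrib sum.distrib)
  have "Poly_Mapping.keys (scale r f) \<subseteq> Poly_Mapping.keys f" by (auto simp: in_keys_iff)
  then show "hom_extend u (scale r f) = scale r (hom_extend u f)"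
    by (simp add: hom_extend_superset[of "Poly_Mapping.keys f"] free.scale_sum_right)
qed

lemma hom_extend_unit_vec [simp]: "hom_extend u (unit_vec c) = u c"
  by (simp add: hom_extend_def)

lemma hom_maps_free_module:
  assumes "free_hom \<phi>" "\<And>c. c \<in> B \<Longrightarrow> \<phi> (unit_vec c) \<in> free_module B'" "f \<in> free_module B"
  shows "\<phi> f \<in> free_module B'"
  using assms(2,3)
  by (subst hom_expand[OF assms(1)], intro free.subspace_sum free.subspace_scale subspace_free_module)
    (auto simp: free_module_def subset_eq)

section \<open>Gradings\<close>

definition exp_degree :: "('v \<Rightarrow>\<^sub>0 nat) \<Rightarrow> int" where
  "exp_degree m = int (\<Sum>x\<in>Poly_Mapping.keys m. Poly_Mapping.lookup m x)"

lemma exp_degree_add: "exp_degree (m + m') = exp_degree m + exp_degree m'"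
proof -
  have "(\<Sum>x\<in>Poly_Mapping.keys m. Poly_Mapping.lookup m x) =
      (\<Sum>x\<in>Poly_Mapping.keys m \<union> Poly_Mapping.keys m'. Poly_Mapping.lookup m x)" for m m' :: "'v \<Rightarrow>\<^sub>0 nat"
    by (intro sum.mono_neutral_left) (auto simp: in_keys_iff)
  note sub = this
  have "Poly_Mapping.keys (m + m') = Poly_Mapping.keys m \<union> Poly_Mapping.keys m'"
    by (auto simp: in_keys_iff lookup_add)
  then show ?thesis
    using sub[of m m'] sub[of m' m] by (simp add: exp_degree_def lookup_add sum.distrib Un_commute)
qed

definition poly_degrees_in :: "int set \<Rightarrow> ('v, 'k::comm_ring_1) polynomial \<Rightarrow> bool" where
  "poly_degrees_in S p \<longleftrightarrow> (\<forall>m\<in>Poly_Mapping.keys p. exp_degree m \<in> S)"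

text \<open>A set of admissible degrees instead of a single one: the complement \<open>- {j}\<close>
  describes what is left of a vector once its part of degree \<open>j\<close> is removed.\<close>

definition vec_degrees_in ::
  "(nat \<Rightarrow> int) \<Rightarrow> int set \<Rightarrow> (nat \<Rightarrow>\<^sub>0 ('v, 'k::comm_ring_1) polynomial) \<Rightarrow> bool" where
  "vec_degrees_in e S f \<longleftrightarrow>
     (\<forall>c. \<forall>m\<in>Poly_Mapping.keys (Poly_Mapping.lookup f c). exp_degree m + e c \<in> S)"

lemma homogeneous_iff: "homogeneous d p \<longleftrightarrow> poly_degrees_in {d} p"
  by (simp add: homogeneous_def poly_degrees_in_def exp_degree_def)

lemma homogeneous_0: "homogeneous d 0"
  by (simp add: homogeneous_def)

lemma homogeneous_vec_iff: "homogeneous_vec e j f \<longleftrightarrow> vec_degrees_in e {j} f"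
proof -
  have "homogeneous_vec e j f \<longleftrightarrow>
      (\<forall>c. Poly_Mapping.lookup f c \<noteq> 0 \<longrightarrow> homogeneous (j - e c) (Poly_Mapping.lookup f c))"
    unfolding homogeneous_vec_def Ball_def in_keys_iff ..
  also have "\<dots> \<longleftrightarrow> (\<forall>c. homogeneous (j - e c) (Poly_Mapping.lookup f c))"
    using homogeneous_0 by metis
  finally show ?thesis
    by (simp add: homogeneous_iff vec_degrees_in_def poly_degrees_in_def eq_diff_eq)
qed

lemma vec_degrees_in_add: "vec_degrees_in e S f \<Longrightarrow> vec_degrees_in e S g \<Longrightarrow> vec_degrees_in e S (f + g)"
  unfolding vec_degrees_in_def lookup_add by (blast dest: subsetD[OF keys_add])

lemma vec_degrees_in_0 [simp]: "vec_degrees_in e S 0"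
  by (simp add: vec_degrees_in_def)

lemma vec_degrees_in_uminus: "vec_degrees_in e S f \<Longrightarrow> vec_degrees_in e S (- f)"
  by (simp add: vec_degrees_in_def)

lemma vec_degrees_in_diff: "vec_degrees_in e S f \<Longrightarrow> vec_degrees_in e S g \<Longrightarrow> vec_degrees_in e S (f - g)"
  using vec_degrees_in_add[of e S f "- g"] vec_degrees_in_uminus[of e S g] by simp

lemma vec_degrees_in_sum:
  "(\<And>c. c \<in> C \<Longrightarrow> vec_degrees_in e S (g c)) \<Longrightarrow> vec_degrees_in e S (sum g C)"
  by (induction C rule: infinite_finite_induct) (auto intro: vec_degrees_in_add)

lemma vec_degrees_in_scale:
  assumes "homogeneous_vec e a f" "\<And>m. m \<in> Poly_Mapping.keys p \<Longrightarrow> exp_degree m + a \<in> S"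
  shows "vec_degrees_in e S (scale p f)"
  unfolding vec_degrees_in_def
proof (intro allI ballI)
  fix c m assume "m \<in> Poly_Mapping.keys (Poly_Mapping.lookup (scale p f) c)"
  then obtain m1 m2 where m: "m = m1 + m2" "m1 \<in> Poly_Mapping.keys p"
      "m2 \<in> Poly_Mapping.keys (Poly_Mapping.lookup f c)"
    using keys_mult by fastforce
  with assms(1) have "exp_degree m2 + e c = a"
    by (auto simp: homogeneous_vec_iff vec_degrees_in_def)
  with assms(2)[OF m(2)] show "exp_degree m + e c \<in> S"
    by (simp add: m(1) exp_degree_add add.assoc)
qed

text \<open>The shift \<open>D\<close> accommodates multiplication by a monomial; differentials have
  \<open>D = 0\<close>. Conditions on the basis vectors in \<open>B\<close> suffice by
  linearity.\<close>

definition graded_hom where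
  "graded_hom D B e B' e' \<phi> \<longleftrightarrow> free_hom \<phi> \<and>
     (\<forall>c\<in>B. \<phi> (unit_vec c) \<in> free_module B' \<and> homogeneous_vec e' (e c + D) (\<phi> (unit_vec c)))"

lemma graded_hom_in_free_module:
  "graded_hom D B e B' e' \<phi> \<Longrightarrow> f \<in> free_module B \<Longrightarrow> \<phi> f \<in> free_module B'"
  unfolding graded_hom_def by (blast intro: hom_maps_free_module)

lemma graded_hom_vec_degrees_in:
  assumes "graded_hom D B e B' e' \<phi>" "f \<in> free_module B" "vec_degrees_in e S f"
  shows "vec_degrees_in e' ((+) D ` S) (\<phi> f)"
proof -
  have hom: "free_hom \<phi>" using assms(1) by (simp add: graded_hom_def)
  show ?thesis
  proof (subst hom_expand[OF hom], rule vec_degrees_in_sum)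
    fix c assume c: "c \<in> Poly_Mapping.keys f"
    with assms(1,2) have *: "homogeneous_vec e' (e c + D) (\<phi> (unit_vec c))"
      by (auto simp: graded_hom_def free_module_def)
    have "exp_degree m + (e c + D) \<in> (+) D ` S"
      if "m \<in> Poly_Mapping.keys (Poly_Mapping.lookup f c)" for m
      using that assms(3) by (auto simp: vec_degrees_in_def image_iff algebra_simps)
    then show "vec_degrees_in e' ((+) D ` S) (scale (Poly_Mapping.lookup f c) (\<phi> (unit_vec c)))"
      by (intro vec_degrees_in_scale[OF *])
  qed
qed

section \<open>Homogeneous components of vectors\<close>

definition vec_component ::
  "(nat \<Rightarrow> int) \<Rightarrow> int \<Rightarrow> (nat \<Rightarrow>\<^sub>0 ('v, 'k::comm_ring_1) polynomial) \<Rightarrow> (nat \<Rightarrow>\<^sub>0 ('v, 'k) polynomial)" where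
  "vec_component e j f =
     Poly_Mapping.mapp (\<lambda>c. Poly_Mapping.mapp (\<lambda>m a. a when exp_degree m + e c = j)) f"

lemma lookup_vec_component:
  "Poly_Mapping.lookup (Poly_Mapping.lookup (vec_component e j f) c) m =
     (Poly_Mapping.lookup (Poly_Mapping.lookup f c) m when exp_degree m + e c = j)"
  by (auto simp: vec_component_def lookup_mapp when_def in_keys_iff)

lemma homogeneous_vec_component: "homogeneous_vec e j (vec_component e j f)"
  unfolding homogeneous_vec_iff vec_degrees_in_def
proof (intro allI ballI)
  fix c m
  assume "m \<in> Poly_Mapping.keys (Poly_Mapping.lookup (vec_component e j f) c)"
  then have "Poly_Mapping.lookup (Poly_Mapping.lookup (vec_component e j f) c) m \<noteq> 0"
    by (rule in_keys_iff[THEN iffD1])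
  then have "exp_degree m + e c = j" unfolding lookup_vec_component by (rule contrapos_np) simp
  then show "exp_degree m + e c \<in> {j}" by (simp only: singleton_iff)
qed

lemma vec_component_in_free_module:
  "f \<in> free_module B \<Longrightarrow> vec_component e j f \<in> free_module B"
  by (auto simp: free_module_def vec_component_def dest: subsetD[OF keys_mapp_subset])

lemma vec_degrees_in_diff_component: "vec_degrees_in e (- {j}) (f - vec_component e j f)"
  unfolding vec_degrees_in_def
proof (intro allI ballI)
  fix c m
  assume "m \<in> Poly_Mapping.keys (Poly_Mapping.lookup (f - vec_component e j f) c)"
  then have "Poly_Mapping.lookup (Poly_Mapping.lookup (f - vec_component e j f) c) m \<noteq> 0"
    by (rule in_keys_iff[THEN iffD1])
  then have "exp_degree m + e c \<noteq> j" unfolding lookup_minus lookup_vec_component by (rule contrapos_nn) simp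
  then show "exp_degree m + e c \<in> - {j}" by (simp only: singleton_iff Compl_iff not_False_eq_True)
qed

lemma vec_degrees_in_disjoint:
  assumes "vec_degrees_in e S f" "vec_degrees_in e T f" "S \<inter> T = {}"
  shows "f = 0"
proof (rule poly_mapping_eqI)
  fix c
  have "Poly_Mapping.keys (Poly_Mapping.lookup f c) = {}"
    using assms unfolding vec_degrees_in_def by blast
  then show "Poly_Mapping.lookup f c = Poly_Mapping.lookup 0 c" by simp
qed

text \<open>The component of degree \<open>j\<close> of any preimage already works: the image of the
  remainder has no part of degree \<open>j\<close>, yet it is a difference of two vectors of degree
  \<open>j\<close>, hence 0.\<close>

lemma homogeneous_preimage:
  fixes \<phi> :: "(nat \<Rightarrow>\<^sub>0 ('v, 'k::comm_ring_1) polynomial) \<Rightarrow> (nat \<Rightarrow>\<^sub>0 ('v, 'k) polynomial)"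
  assumes "graded_hom 0 B e B' e' \<phi>" "f \<in> free_module B" "homogeneous_vec e' j (\<phi> f)"
  shows "\<exists>g \<in> free_module B. homogeneous_vec e j g \<and> \<phi> g = \<phi> f"
proof -
  interpret \<phi>: module_hom scale scale \<phi> using assms(1) by (simp add: graded_hom_def)
  let ?g = "vec_component e j f"
  have g: "?g \<in> free_module B" by (rule vec_component_in_free_module) fact
  have "f - ?g \<in> free_module B"
    by (rule free.subspace_diff[OF subspace_free_module assms(2) g])
  from graded_hom_vec_degrees_in[OF assms(1) this vec_degrees_in_diff_component]
  have 1: "vec_degrees_in e' (- {j}) (\<phi> f - \<phi> ?g)" by (simp add: \<phi>.diff)
  have "vec_degrees_in e' {j} (\<phi> ?g)"
    using graded_hom_vec_degrees_in[OF assms(1) g, of "{j}"] homogeneous_vec_component[of e j f]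
    by (simp add: homogeneous_vec_iff)
  with assms(3) have "vec_degrees_in e' {j} (\<phi> f - \<phi> ?g)"
    by (intro vec_degrees_in_diff) (auto simp: homogeneous_vec_iff)
  from vec_degrees_in_disjoint[OF this 1] have "\<phi> ?g = \<phi> f" by simp
  then show ?thesis using g homogeneous_vec_component by blast
qed

section \<open>Reduction modulo the variables\<close>

lemma constant_coeff_simps [simp]:
  "constant_coeff 0 = 0" "constant_coeff (p + q) = constant_coeff p + constant_coeff q"
  "constant_coeff (p - q) = constant_coeff p - constant_coeff q"
  "constant_coeff (- p) = - constant_coeff p" "constant_coeff (const_poly a) = a"
  by (simp_all add: constant_coeff_def const_poly_def lookup_add lookup_minus)

lemma constant_coeff_1 [simp]: "constant_coeff 1 = 1"
  by (simp add: constant_coeff_def)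

lemma exp_add_eq_0_iff: "m + m' = (0 :: 'v \<Rightarrow>\<^sub>0 nat) \<longleftrightarrow> m = 0 \<and> m' = 0"
  by (auto simp: poly_mapping_eq_iff fun_eq_iff lookup_add)

text \<open>Exponents are natural numbers, so two exponent vectors add up to 0 only if both are 0,
  and a single pair of terms contributes.\<close>

lemma constant_coeff_mult [simp]:
  fixes p q :: "('v, 'k::comm_ring_1) polynomial"
  shows "constant_coeff (p * q) = constant_coeff p * constant_coeff q"
proof -
  have *: "(\<Sum>m'. Poly_Mapping.lookup q m' when 0 = m + m') = (constant_coeff q when m = 0)" for m :: "'v \<Rightarrow>\<^sub>0 nat"
  proof -
    have "(0 = m + m') = (m = 0 \<and> m' = 0)" for m'
      using exp_add_eq_0_iff[of m m'] by (simp only: eq_commute[of 0])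
    then have "(\<lambda>m'. Poly_Mapping.lookup q m' when 0 = m + m') =
        (\<lambda>m'. (Poly_Mapping.lookup q m' when m = 0) when m' = 0)"
      by (simp add: when_def fun_eq_iff)
    then show ?thesis by (simp only: Sum_any_when_equal constant_coeff_def)
  qed
  have "constant_coeff (p * q) = (\<Sum>m. Poly_Mapping.lookup p m * (constant_coeff q when m = 0))"
    by (simp only: constant_coeff_def[of "p * q"] lookup_mult *)
  also have "\<dots> = (\<Sum>m. (Poly_Mapping.lookup p m * constant_coeff q) when m = 0)"
    by (simp only: mult_when)
  finally show ?thesis by (simp add: constant_coeff_def)
qed

definition reduce :: "(nat \<Rightarrow>\<^sub>0 ('v, 'k::comm_ring_1) polynomial) \<Rightarrow> (nat \<Rightarrow>\<^sub>0 'k)" where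
  "reduce f = Poly_Mapping.map constant_coeff f"

definition const_vec :: "(nat \<Rightarrow>\<^sub>0 'k::comm_ring_1) \<Rightarrow> (nat \<Rightarrow>\<^sub>0 ('v, 'k) polynomial)" where
  "const_vec v = Poly_Mapping.map const_poly v"

lemma tensor_residue_eq: "tensor_residue \<phi> v = reduce (\<phi> (const_vec v))"
  by (simp add: tensor_residue_def reduce_def const_vec_def)

lemma lookup_reduce [simp]: "Poly_Mapping.lookup (reduce f) c = constant_coeff (Poly_Mapping.lookup f c)"
  by (simp add: reduce_def map.rep_eq when_def)

lemma lookup_const_vec [simp]: "Poly_Mapping.lookup (const_vec v) c = const_poly (Poly_Mapping.lookup v c)"
  by (simp add: const_vec_def map.rep_eq when_def const_poly_def)

lemma reduce_simps [simp]:
  "reduce 0 = 0" "reduce (f + g) = reduce f + reduce g" "reduce (f - g) = reduce f - reduce g"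
  "reduce (- f) = - reduce f" "reduce (scale p f) = scale (constant_coeff p) (reduce f)"
  "reduce (const_vec v) = v"
  by (auto intro!: poly_mapping_eqI simp: lookup_add lookup_minus)

lemma reduce_sum: "reduce (sum g S) = (\<Sum>x\<in>S. reduce (g x))"
  by (induction S rule: infinite_finite_induct) auto

lemma const_vec_simps:
  "const_vec (v + w) = const_vec v + const_vec w"
  "const_vec (scale a v) = scale (const_poly a) (const_vec v)"
  by (auto intro!: poly_mapping_eqI simp: lookup_add const_poly_def single_add mult_single)

lemma const_vec_in_free_module: "v \<in> free_module B \<Longrightarrow> const_vec v \<in> free_module B"
  by (auto simp: free_module_def in_keys_iff const_poly_def subset_eq)

text \<open>Modulo the variables, the image of a vector depends only on its coordinates modulo the
  variables, and \<open>f\<close> agrees there with \<open>const_vec (reduce f)\<close>.\<close>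

lemma reduce_hom:
  fixes \<phi> :: "(nat \<Rightarrow>\<^sub>0 ('v, 'k::comm_ring_1) polynomial) \<Rightarrow> (nat \<Rightarrow>\<^sub>0 ('v, 'k) polynomial)"
  assumes "free_hom \<phi>"
  shows "reduce (\<phi> f) = tensor_residue \<phi> (reduce f)"
proof -
  have *: "reduce (\<phi> f) = (\<Sum>c\<in>S. scale (Poly_Mapping.lookup (reduce f) c) (reduce (\<phi> (unit_vec c))))"
    if "finite S" "Poly_Mapping.keys f \<subseteq> S" for f S
  proof -
    have "reduce (\<phi> f) =
        reduce (\<Sum>c\<in>S. scale (Poly_Mapping.lookup f c) (\<phi> (unit_vec c)))"
      using that by (subst hom_expand[OF assms], intro arg_cong[where f = reduce] sum.mono_neutral_left)
        (auto simp: in_keys_iff)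
    then show ?thesis by (simp add: reduce_sum)
  qed
  \<comment> \<open>Coordinates of \<open>f\<close> without constant term disappear from
    \<open>const_vec (reduce f)\<close>, so the two expansions need a common index set.\<close>
  let ?S = "Poly_Mapping.keys f \<union> Poly_Mapping.keys (const_vec (reduce f) :: nat \<Rightarrow>\<^sub>0 ('v, 'k) polynomial)"
  show ?thesis
    unfolding tensor_residue_eq
    using *[of ?S f] *[of ?S "const_vec (reduce f)"] by simp
qed

text \<open>Functoriality of the tensor product with \<open>k\<close>. The composite is compared
  with \<open>\<theta>\<close> on \<open>free_module B\<close> only, since chain map identities are
  available only there.\<close>

lemma tensor_residue_comp:
  assumes "free_hom \<phi>" "\<And>f. f \<in> free_module B \<Longrightarrow> \<phi> (\<psi> f) = \<theta> f" "v \<in> free_module B"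
  shows "tensor_residue \<phi> (tensor_residue \<psi> v) = tensor_residue \<theta> v"
  unfolding tensor_residue_eq[of \<psi>] reduce_hom[OF assms(1), symmetric]
  by (simp add: assms(2) assms(3) const_vec_in_free_module tensor_residue_eq)

lemma free_hom_tensor_residue:
  assumes "free_hom \<phi>"
  shows "free_hom (tensor_residue \<phi>)"
proof -
  interpret \<phi>: module_hom scale scale \<phi> by fact
  show ?thesis
    by unfold_locales (simp_all add: tensor_residue_eq const_vec_simps \<phi>.add \<phi>.scale)
qed

lemma constant_coeff_homogeneous: "homogeneous d p \<Longrightarrow> d \<noteq> 0 \<Longrightarrow> constant_coeff p = 0"
  unfolding homogeneous_def constant_coeff_def by (rule ccontr) (auto dest: bspec[of _ _ 0] simp: in_keys_iff)

text \<open>The matrix entry from a basis element of degree \<open>j\<close> to \<open>c\<close> is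
  homogeneous of degree \<open>j + D - e' c\<close>, and its constant coefficient can survive only
  if that degree is 0.\<close>

lemma tensor_residue_graded:
  fixes \<phi> :: "(nat \<Rightarrow>\<^sub>0 ('v, 'k::comm_ring_1) polynomial) \<Rightarrow> (nat \<Rightarrow>\<^sub>0 ('v, 'k) polynomial)"
  assumes "graded_hom D B e B' e' \<phi>" "v \<in> free_module {c \<in> B. e c = j}"
  shows "tensor_residue \<phi> v \<in> free_module {c \<in> B'. e' c = j + D}"
proof -
  have hom: "free_hom \<phi>" using assms(1) by (simp add: graded_hom_def)
  have "tensor_residue \<phi> (unit_vec c) \<in> free_module {c \<in> B'. e' c = j + D}"
    if "c \<in> {c \<in> B. e c = j}" for c
  proof -
    have "unit_vec c = reduce (unit_vec c :: nat \<Rightarrow>\<^sub>0 ('v, 'k) polynomial)"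
      by (rule poly_mapping_eqI) (auto simp: lookup_single when_def)
    then have "tensor_residue \<phi> (unit_vec c) = reduce (\<phi> (unit_vec c))"
      by (simp add: reduce_hom[OF hom])
    moreover have "\<phi> (unit_vec c) \<in> free_module B'" "homogeneous_vec e' (j + D) (\<phi> (unit_vec c))"
      using that assms(1) by (auto simp: graded_hom_def)
    moreover have "reduce f \<in> free_module {c \<in> B'. e' c = j + D}"
      if f: "f \<in> free_module B'" "homogeneous_vec e' (j + D) f" for f :: "nat \<Rightarrow>\<^sub>0 ('v, 'k) polynomial"
      unfolding free_module_def
    proof (intro CollectI subsetI)
      fix c assume "c \<in> Poly_Mapping.keys (reduce f)"
      then have c: "constant_coeff (Poly_Mapping.lookup f c) \<noteq> 0" by (simp add: in_keys_iff)
      then have "c \<in> Poly_Mapping.keys f" by (metis constant_coeff_simps(1) in_keys_iff)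
      with f have "c \<in> B'" "homogeneous (j + D - e' c) (Poly_Mapping.lookup f c)"
        by (auto simp: free_module_def homogeneous_vec_def)
      from this(2) c constant_coeff_homogeneous[of "j + D - e' c" "Poly_Mapping.lookup f c"]
      have "j + D - e' c = 0" by blast
      with \<open>c \<in> B'\<close> show "c \<in> B' \<and> e' c = j + D" by auto
    qed
    ultimately show ?thesis by simp
  qed
  from hom_maps_free_module[OF free_hom_tensor_residue[OF hom] this assms(2)] show ?thesis .
qed

section \<open>Dimensions of subquotients\<close>

context vector_space
begin

lemma independent_Un_disjoint_spans:
  assumes "independent S" "independent T" "span S \<inter> span T = {0}" "finite T"
  shows "independent (S \<union> T) \<and> S \<inter> T = {}"
  using assms(4,2,3)
proof (induction T rule: finite_induct)
  case empty
  then show ?case using assms(1) by simp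
next
  case (insert t T)
  have "span S \<inter> span T = {0}"
    using insert.prems(2) span_mono[of T "insert t T"] span_zero by blast
  moreover have "independent T" by (rule independent_mono[OF insert.prems(1)]) auto
  ultimately have IH: "independent (S \<union> T)" "S \<inter> T = {}" using insert.IH by auto
  have tT: "t \<notin> span T" using insert.prems(1) insert.hyps(2) by (simp add: independent_insert)
  have "t \<notin> span (S \<union> T)"
  proof
    assume "t \<in> span (S \<union> T)"
    then obtain x y where xy: "t = x + y" "x \<in> span S" "y \<in> span T"
      unfolding span_Un by auto
    have "x = t - y" using xy(1) by simp
    also have "\<dots> \<in> span (insert t T)"
      by (rule span_diff) (use xy(3) span_mono[of T "insert t T"] span_superset[of "insert t T"] in blast)+
    finally have "x = 0" using xy(2) insert.prems(2) by blast
    with xy tT show False by simp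
  qed
  moreover from this have "t \<notin> S" using span_superset[of "S \<union> T"] by blast
  ultimately show ?case using IH by (simp add: independent_insertI)
qed

text \<open>The span of \<open>W\<close> is a complement of \<open>A\<close> in \<open>Z\<close>, so
  \<open>card W\<close> is the dimension of \<open>Z/A\<close>; no quotient space has to be formed.
  The finite set \<open>T\<close> keeps all bases finite.\<close>

lemma extend_basis:
  assumes "subspace A" "subspace Z" "A \<subseteq> Z" "Z \<subseteq> span T" "finite T"
  obtains S W where "finite S" "finite W" "independent S" "independent W" "span S = A"
    "span W \<subseteq> Z" "span W \<inter> A = {0}" "card S = dim A" "card S + card W = dim Z"
proof -
  obtain S where S: "S \<subseteq> A" "independent S" "A \<subseteq> span S" "card S = dim A"
    using basis_exists by blast
  obtain U where U: "S \<subseteq> U" "U \<subseteq> Z" "independent U" "Z \<subseteq> span U"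
    using maximal_independent_subset_extend[of S Z] S assms(3) by blast
  have fin: "finite U"
    using independent_span_bound[OF assms(5) U(3)] U(2) assms(4) by blast
  have spanS: "span S = A" using S assms(1) span_subspace by blast
  have indW: "independent (U - S)" by (rule independent_mono[OF U(3)]) auto
  have "span (U - S) \<inter> A \<subseteq> {0}"
  proof
    fix x assume x: "x \<in> span (U - S) \<inter> A"
    then have xS: "x \<in> span S" by (simp add: spanS)
    have xU: "x \<in> span U" using x span_mono[of "U - S" U] by auto
    \<comment> \<open>A vector in both spans has coordinates supported in \<open>S\<close> and also
      in \<open>U - S\<close>, so all its coordinates vanish.\<close>
    have 1: "representation U x = representation S x"
      by (rule representation_extend[OF U(3) xS U(1)])
    have 2: "representation U x = representation (U - S) x"
      by (rule representation_extend[OF U(3)]) (use x in auto)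
    have "{b. representation U x b \<noteq> 0} = {}"
      using representation_ne_zero[of S x] representation_ne_zero[of "U - S" x]
      unfolding 1[symmetric] 2[symmetric] by blast
    then have "x = 0"
      using sum_nonzero_representation_eq[OF U(3) xU] by simp
    then show "x \<in> {0}" by simp
  qed
  moreover have "0 \<in> span (U - S) \<inter> A" using assms(1) subspace_0 span_zero by blast
  moreover have "span (U - S) \<subseteq> Z" using U(2) assms(2) by (intro span_minimal) auto
  moreover have "card S + card (U - S) = dim Z"
    using basis_card_eq_dim[OF U(2,4,3)] card_Diff_subset[of S U] card_mono[OF fin U(1)] fin U(1)
    by (simp add: finite_subset)
  ultimately show thesis
    using S(2,4) spanS indW fin U(1) by (intro that[of S "U - S"]) (auto intro: finite_subset)
qed

lemma card_le_dim_of_independent: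
  assumes "independent S" "S \<subseteq> Z" "Z \<subseteq> span T" "finite T"
  shows "finite S \<and> card S \<le> dim Z"
proof -
  obtain U where U: "U \<subseteq> Z" "independent U" "Z \<subseteq> span U" "card U = dim Z"
    using basis_exists by blast
  have "finite U" using independent_span_bound[OF assms(4) U(2)] U(1) assms(3) by blast
  from independent_span_bound[OF this assms(1)] U assms(2) show ?thesis by auto
qed

lemma dim_subspace_mono:
  assumes "A \<subseteq> Z" "Z \<subseteq> span T" "finite T"
  shows "dim A \<le> dim Z"
proof -
  obtain S where S: "S \<subseteq> A" "independent S" "A \<subseteq> span S" "card S = dim A"
    using basis_exists by blast
  then show ?thesis using card_le_dim_of_independent[OF S(2) _ assms(2,3)] assms(1) by auto
qed

end

text \<open>The second part of \<open>maps\<close> says that \<open>f\<close> induces an injection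
  from \<open>Z/A\<close> to \<open>Z'/A'\<close>. Concretely, the image of a basis of a complement
  of \<open>A\<close> stays independent when joined with a basis of \<open>A'\<close>.\<close>

lemma (in vector_space) dim_quotient_le:
  assumes f: "Vector_Spaces.linear scale scale f"
    and sub: "subspace A" "subspace Z" "subspace A'" "subspace Z'" "A \<subseteq> Z" "A' \<subseteq> Z'"
    and fin: "Z \<subseteq> span T" "finite T" "Z' \<subseteq> span T'" "finite T'"
    and maps: "f ` Z \<subseteq> Z'" "\<And>z. z \<in> Z \<Longrightarrow> f z \<in> A' \<Longrightarrow> z \<in> A"
  shows "dim Z - dim A \<le> dim Z' - dim A'"
proof -
  interpret f: Vector_Spaces.linear scale scale f by (rule f)
  obtain S W where W: "finite S" "finite W" "independent S" "independent W" "span S = A"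
      "span W \<subseteq> Z" "span W \<inter> A = {0}" "card S = dim A" "card S + card W = dim Z"
    by (rule extend_basis[OF sub(1,2,5) fin(1,2)])
  obtain S' W' where S': "finite S'" "finite W'" "independent S'" "independent W'" "span S' = A'"
      "span W' \<subseteq> Z'" "span W' \<inter> A' = {0}" "card S' = dim A'" "card S' + card W' = dim Z'"
    by (rule extend_basis[OF sub(3,4,6) fin(3,4)])
  have inj: "inj_on f (span W)"
  proof (subst f.inj_on_iff_eq_0, simp, intro ballI impI)
    fix x assume "x \<in> span W" "f x = 0"
    then have "x \<in> A" using W(6) maps(2)[of x] subspace_0[OF sub(3)] by auto
    with \<open>x \<in> span W\<close> W(7) show "x = 0" by blast
  qed
  have ind: "independent (f ` W)" by (rule f.independent_injective_image[OF W(4) inj])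
  have "span (f ` W) \<inter> span S' \<subseteq> {0}"
  proof
    fix y assume y: "y \<in> span (f ` W) \<inter> span S'"
    then obtain z where z: "z \<in> span W" "y = f z" by (auto simp: f.span_image)
    then have "z \<in> A" using y maps(2) W(6) S'(5) by auto
    then have "z = 0" using z W(7) by blast
    then show "y \<in> {0}" using z by simp
  qed
  then have "span (f ` W) \<inter> span S' = {0}" using span_zero by auto
  from independent_Un_disjoint_spans[OF ind S'(3) this S'(1)]
  have *: "independent (f ` W \<union> S')" "f ` W \<inter> S' = {}" by auto
  have "f ` W \<union> S' \<subseteq> Z'" using maps(1) W(6) S'(5) sub(6) span_superset by blast
  from card_le_dim_of_independent[OF *(1) this fin(3,4)]
  have "card (f ` W) + card S' \<le> dim Z'"
    using *(2) W(2) S'(1) by (simp add: card_Un_disjoint)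
  moreover have "card (f ` W) = card W"
    by (rule card_image) (rule inj_on_subset[OF inj span_superset])
  ultimately show ?thesis using W(8,9) S'(8) by simp
qed

lemma free_module_subset_span:
  fixes B :: "nat set"
  assumes "finite B"
  shows "(free_module B :: (nat \<Rightarrow>\<^sub>0 'a::comm_ring_1) set) \<subseteq> free.span (unit_vec ` B)"
proof
  fix f :: "nat \<Rightarrow>\<^sub>0 'a" assume "f \<in> free_module B"
  with assms have "f = (\<Sum>c\<in>B. scale (Poly_Mapping.lookup f c) (unit_vec c))"
    by (intro vec_expand) (simp_all add: free_module_def)
  also have "\<dots> \<in> free.span (unit_vec ` B)"
    by (intro free.span_sum free.span_scale free.span_base) simp
  finally show "f \<in> free.span (unit_vec ` B)" .
qed

section \<open>Comparison of resolutions\<close>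

interpretation free_pair: module_pair "scale :: 'a::comm_ring_1 \<Rightarrow> (nat \<Rightarrow>\<^sub>0 'a) \<Rightarrow> _" "scale :: 'a \<Rightarrow> (nat \<Rightarrow>\<^sub>0 'a) \<Rightarrow> _"
  by (intro module_pair.intro free.module_axioms)

lemma graded_hom_free_hom: "graded_hom D B e B' e' \<phi> \<Longrightarrow> free_hom \<phi>"
  by (simp add: graded_hom_def)

lemma graded_hom_homogeneous:
  assumes "graded_hom D B e B' e' \<phi>" "f \<in> free_module B" "homogeneous_vec e j f"
  shows "homogeneous_vec e' (j + D) (\<phi> f)"
  using graded_hom_vec_degrees_in[OF assms(1,2), of "{j}"] assms(3)
  by (simp add: homogeneous_vec_iff add.commute)

lemma graded_hom_comp:
  assumes "graded_hom D B e B' e' \<phi>" "graded_hom D' B' e' B'' e'' \<psi>"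
  shows "graded_hom (D + D') B e B'' e'' (\<lambda>f. \<psi> (\<phi> f))"
  unfolding graded_hom_def
proof (intro conjI ballI)
  show "free_hom (\<lambda>f. \<psi> (\<phi> f))"
    using module_hom_compose[OF assms(1,2)[THEN graded_hom_free_hom]] by (simp add: comp_def)
  fix c assume "c \<in> B"
  then have c: "\<phi> (unit_vec c) \<in> free_module B'" "homogeneous_vec e' (e c + D) (\<phi> (unit_vec c))"
    using assms(1) by (auto simp: graded_hom_def)
  show "\<psi> (\<phi> (unit_vec c)) \<in> free_module B''"
    by (rule graded_hom_in_free_module[OF assms(2) c(1)])
  show "homogeneous_vec e'' (e c + (D + D')) (\<psi> (\<phi> (unit_vec c)))"
    using graded_hom_homogeneous[OF assms(2) c] by (simp add: add.assoc)
qed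

lemma graded_hom_diff:
  assumes "graded_hom D B e B' e' \<phi>" "graded_hom D B e B' e' \<psi>"
  shows "graded_hom D B e B' e' (\<lambda>f. \<phi> f - \<psi> f)"
  using assms unfolding graded_hom_def
  by (auto intro!: free_pair.module_hom_sub free.subspace_diff subspace_free_module
      simp: homogeneous_vec_iff intro: vec_degrees_in_diff)

lemma homogeneous_vec_unit_vec: "homogeneous_vec e (e c) (unit_vec c)"
  by (simp add: homogeneous_vec_def homogeneous_def)

lemma graded_hom_ident: "graded_hom 0 B e B e (\<lambda>f. f)"
  unfolding graded_hom_def using homogeneous_vec_unit_vec
  by (auto intro: free.module_hom_ident)

lemma graded_hom_zero: "graded_hom D B e B' e' (\<lambda>f. 0)"
  unfolding graded_hom_def
  by (auto intro!: free_pair.module_hom_zero free.subspace_0 subspace_free_module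
      simp: homogeneous_vec_iff)

text \<open>Projectivity of graded free modules: each basis vector receives a homogeneous preimage,
  and these choices extend linearly.\<close>

lemma graded_lift:
  fixes \<psi> :: "(nat \<Rightarrow>\<^sub>0 ('v, 'k::comm_ring_1) polynomial) \<Rightarrow> (nat \<Rightarrow>\<^sub>0 ('v, 'k) polynomial)"
  assumes \<delta>: "graded_hom 0 B1 e1 B0 e0 \<delta>" and \<psi>: "graded_hom D B e B0 e0 \<psi>"
    and im: "\<And>f. f \<in> free_module B \<Longrightarrow> \<psi> f \<in> \<delta> ` free_module B1"
  obtains \<eta> where "graded_hom D B e B1 e1 \<eta>" "\<And>f. f \<in> free_module B \<Longrightarrow> \<delta> (\<eta> f) = \<psi> f"
proof -
  have "\<exists>g\<in>free_module B1. homogeneous_vec e1 (e c + D) g \<and> \<delta> g = \<psi> (unit_vec c)" if "c \<in> B" for c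
  proof -
    obtain g where g: "g \<in> free_module B1" "\<psi> (unit_vec c) = \<delta> g"
      using im[of "unit_vec c"] \<open>c \<in> B\<close> by auto
    have "homogeneous_vec e0 (e c + D) (\<delta> g)"
      using \<psi> \<open>c \<in> B\<close> unfolding g(2)[symmetric] by (simp add: graded_hom_def)
    from homogeneous_preimage[OF \<delta> g(1) this] show ?thesis using g(2) by auto
  qed
  then obtain u where u: "\<And>c. c \<in> B \<Longrightarrow> u c \<in> free_module B1"
      "\<And>c. c \<in> B \<Longrightarrow> homogeneous_vec e1 (e c + D) (u c)"
      "\<And>c. c \<in> B \<Longrightarrow> \<delta> (u c) = \<psi> (unit_vec c)"
    by metis
  have hom: "free_hom (\<lambda>f. \<delta> (hom_extend u f))"
    using module_hom_compose[OF free_hom_hom_extend graded_hom_free_hom[OF \<delta>], of u]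
    by (simp add: comp_def)
  show thesis
  proof
    show "graded_hom D B e B1 e1 (hom_extend u)"
      using u by (auto simp: graded_hom_def free_hom_hom_extend)
    show "\<delta> (hom_extend u f) = \<psi> f" if "f \<in> free_module B" for f
      using hom_eq_on_free_module[OF hom graded_hom_free_hom[OF \<psi>] _ that] u(3) by simp
  qed
qed

text \<open>Exactness is demanded in every positive homological degree; the homology in degree 0 is
  the module being resolved.\<close>

definition graded_complex where
  "graded_complex B e \<delta> \<longleftrightarrow> (\<forall>n. finite (B n)) \<and>
     (\<forall>n. graded_hom 0 (B (Suc n)) (e (Suc n)) (B n) (e n) (\<delta> n)) \<and>
     (\<forall>n. \<delta> (Suc n) ` free_module (B (Suc (Suc n))) = {f \<in> free_module (B (Suc n)). \<delta> n f = 0})"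

text \<open>
  A resolution \<open>\<dots> \<rightarrow> F\<^sub>1 \<rightarrow> F\<^sub>0 = R \<rightarrow> R/I \<rightarrow> 0\<close>, where \<open>\<delta> n\<close> is the differential \<open>F\<^sub>n\<^sub>+\<^sub>1 \<rightarrow> F\<^sub>n\<close>.
  Compared with a resolution of \<open>I\<close>, the augmentation has become the differential \<open>\<delta> 0\<close>, and
  homological degrees go up by one.
\<close>

definition quotient_resolution where
  "quotient_resolution I B e \<delta> \<longleftrightarrow> graded_complex B e \<delta> \<and> B 0 = {0} \<and> e 0 0 = 0 \<and>
     \<delta> 0 ` free_module (B 1) = Poly_Mapping.single 0 ` I"

lemma graded_complexD:
  assumes "graded_complex B e \<delta>"
  shows "finite (B n)" "graded_hom 0 (B (Suc n)) (e (Suc n)) (B n) (e n) (\<delta> n)"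
    "f \<in> free_module (B (Suc (Suc n))) \<Longrightarrow> \<delta> (Suc n) f \<in> free_module (B (Suc n))"
    "f \<in> free_module (B (Suc (Suc n))) \<Longrightarrow> \<delta> n (\<delta> (Suc n) f) = 0"
    "g \<in> free_module (B (Suc n)) \<Longrightarrow> \<delta> n g = 0 \<Longrightarrow> g \<in> \<delta> (Suc n) ` free_module (B (Suc (Suc n)))"
    "free_hom (\<delta> n)"
  using assms unfolding graded_complex_def by (blast dest: graded_hom_free_hom)+

text \<open>The existence half of the comparison theorem. Exactness of the target makes each lift
  possible once the previous one is known; the degree \<open>D\<close> allows lifting multiplication
  by a monomial.\<close>

lemma lift_chain_map:
  fixes \<phi>0 :: "(nat \<Rightarrow>\<^sub>0 ('v, 'k::comm_ring_1) polynomial) \<Rightarrow> (nat \<Rightarrow>\<^sub>0 ('v, 'k) polynomial)"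
  assumes C: "graded_complex B e \<delta>" and C': "graded_complex B' e' \<delta>'"
    and \<phi>0: "graded_hom D (B 0) (e 0) (B' 0) (e' 0) \<phi>0"
    and im: "\<And>f. f \<in> free_module (B 1) \<Longrightarrow> \<phi>0 (\<delta> 0 f) \<in> \<delta>' 0 ` free_module (B' 1)"
  obtains \<phi> where "\<phi> 0 = \<phi>0" "\<And>n. graded_hom D (B n) (e n) (B' n) (e' n) (\<phi> n)"
    "\<And>n f. f \<in> free_module (B (Suc n)) \<Longrightarrow> \<delta>' n (\<phi> (Suc n) f) = \<phi> n (\<delta> n f)"
proof -
  \<comment> \<open>The middle clause is what the next lift consumes: \<open>im\<close> provides it
    at 0, exactness afterwards. The last clause pins the start of the sequence to
    \<open>\<phi>0\<close>.\<close>
  define P where "P n \<phi> \<longleftrightarrow> graded_hom D (B n) (e n) (B' n) (e' n) \<phi> \<and>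
      (\<forall>f\<in>free_module (B (Suc n)). \<phi> (\<delta> n f) \<in> \<delta>' n ` free_module (B' (Suc n))) \<and>
      (n = 0 \<longrightarrow> \<phi> = \<phi>0)" for n \<phi>
  define Q where "Q n \<phi> \<phi>' \<longleftrightarrow> (\<forall>f\<in>free_module (B (Suc n)). \<delta>' n (\<phi>' f) = \<phi> (\<delta> n f))"
    for n and \<phi> \<phi>' :: "(nat \<Rightarrow>\<^sub>0 ('v, 'k) polynomial) \<Rightarrow> (nat \<Rightarrow>\<^sub>0 ('v, 'k) polynomial)"
  have "\<exists>\<phi>. \<forall>n. P n (\<phi> n) \<and> Q n (\<phi> n) (\<phi> (Suc n))"
  proof (rule dependent_nat_choice)
    show "\<exists>x. P 0 x" using \<phi>0 im by (auto simp: P_def)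
  next
    fix \<phi> n assume "P n \<phi>"
    then have \<phi>: "graded_hom D (B n) (e n) (B' n) (e' n) \<phi>"
        "\<And>f. f \<in> free_module (B (Suc n)) \<Longrightarrow> \<phi> (\<delta> n f) \<in> \<delta>' n ` free_module (B' (Suc n))"
      by (auto simp: P_def)
    interpret \<phi>: module_hom scale scale \<phi> by (rule graded_hom_free_hom[OF \<phi>(1)])
    have "graded_hom (0 + D) (B (Suc n)) (e (Suc n)) (B' n) (e' n) (\<lambda>f. \<phi> (\<delta> n f))"
      by (rule graded_hom_comp[OF graded_complexD(2)[OF C] \<phi>(1)])
    then have comp: "graded_hom D (B (Suc n)) (e (Suc n)) (B' n) (e' n) (\<lambda>f. \<phi> (\<delta> n f))" by simp
    obtain \<eta> where \<eta>: "graded_hom D (B (Suc n)) (e (Suc n)) (B' (Suc n)) (e' (Suc n)) \<eta>"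
      "\<And>f. f \<in> free_module (B (Suc n)) \<Longrightarrow> \<delta>' n (\<eta> f) = \<phi> (\<delta> n f)"
      using graded_lift[OF graded_complexD(2)[OF C'] comp \<phi>(2)] by blast
    have "\<eta> (\<delta> (Suc n) f) \<in> \<delta>' (Suc n) ` free_module (B' (Suc (Suc n)))"
      if f: "f \<in> free_module (B (Suc (Suc n)))" for f
    proof (rule graded_complexD(5)[OF C'])
      have df: "\<delta> (Suc n) f \<in> free_module (B (Suc n))" by (rule graded_complexD(3)[OF C f])
      then show "\<eta> (\<delta> (Suc n) f) \<in> free_module (B' (Suc n))"
        by (rule graded_hom_in_free_module[OF \<eta>(1)])
      show "\<delta>' n (\<eta> (\<delta> (Suc n) f)) = 0"
        using \<eta>(2)[OF df] graded_complexD(4)[OF C f] by simp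
    qed
    then show "\<exists>\<phi>'. P (Suc n) \<phi>' \<and> Q n \<phi> \<phi>'"
      using \<eta> by (auto simp: P_def Q_def)
  qed
  then obtain \<phi> where \<phi>: "\<And>n. P n (\<phi> n)" "\<And>n. Q n (\<phi> n) (\<phi> (Suc n))" by blast
  show thesis by (rule that[of \<phi>]) (use \<phi> in \<open>auto simp: P_def Q_def\<close>)
qed

text \<open>The defect \<open>\<theta> - h \<delta>\<close> of the homotopy built so far is a cycle,
  hence a boundary by exactness, and a graded lift of it is the next \<open>h\<close>.\<close>

lemma null_homotopy:
  fixes \<theta> :: "nat \<Rightarrow> (nat \<Rightarrow>\<^sub>0 ('v, 'k::comm_ring_1) polynomial) \<Rightarrow> (nat \<Rightarrow>\<^sub>0 ('v, 'k) polynomial)"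
  assumes C: "graded_complex B e \<delta>" and C': "graded_complex B' e' \<delta>'"
    and \<theta>: "\<And>n. graded_hom D (B n) (e n) (B' n) (e' n) (\<theta> n)"
    and chain: "\<And>n f. f \<in> free_module (B (Suc n)) \<Longrightarrow> \<delta>' n (\<theta> (Suc n) f) = \<theta> n (\<delta> n f)"
    and zero: "\<And>f. f \<in> free_module (B 0) \<Longrightarrow> \<theta> 0 f = 0"
  obtains h where "\<And>n. graded_hom D (B n) (e n) (B' (Suc n)) (e' (Suc n)) (h n)"
    "\<And>n f. f \<in> free_module (B (Suc n)) \<Longrightarrow>
       \<theta> (Suc n) f = \<delta>' (Suc n) (h (Suc n) f) + h n (\<delta> n f)"
proof -
  define P where "P n h \<longleftrightarrow> graded_hom D (B n) (e n) (B' (Suc n)) (e' (Suc n)) h \<and>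
      (\<forall>f\<in>free_module (B (Suc n)). \<delta>' n (\<theta> (Suc n) f - h (\<delta> n f)) = 0)" for n h
  define Q where "Q n h h' \<longleftrightarrow>
      (\<forall>f\<in>free_module (B (Suc n)). \<delta>' (Suc n) (h' f) = \<theta> (Suc n) f - h (\<delta> n f))"
    for n and h h' :: "(nat \<Rightarrow>\<^sub>0 ('v, 'k) polynomial) \<Rightarrow> (nat \<Rightarrow>\<^sub>0 ('v, 'k) polynomial)"
  have "\<exists>h. \<forall>n. P n (h n) \<and> Q n (h n) (h (Suc n))"
  proof (rule dependent_nat_choice)
    have "\<delta> 0 f \<in> free_module (B 0)" if "f \<in> free_module (B (Suc 0))" for f
      by (rule graded_hom_in_free_module[OF graded_complexD(2)[OF C] that])
    \<comment> \<open>The zero homotopy is a legitimate start: \<open>\<theta> 0\<close> vanishes,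
      so \<open>\<theta> 1\<close> already takes values in the cycles.\<close>
    then show "\<exists>h. P 0 h"
      by (intro exI[of _ "\<lambda>_. 0"]) (simp add: P_def graded_hom_zero chain zero)
  next
    fix h n assume "P n h"
    then have h: "graded_hom D (B n) (e n) (B' (Suc n)) (e' (Suc n)) h"
        "\<And>f. f \<in> free_module (B (Suc n)) \<Longrightarrow> \<delta>' n (\<theta> (Suc n) f - h (\<delta> n f)) = 0"
      by (auto simp: P_def)
    interpret h: module_hom scale scale h by (rule graded_hom_free_hom[OF h(1)])
    have \<psi>: "graded_hom D (B (Suc n)) (e (Suc n)) (B' (Suc n)) (e' (Suc n))
        (\<lambda>f. \<theta> (Suc n) f - h (\<delta> n f))"
      using graded_hom_diff[OF \<theta> graded_hom_comp[OF graded_complexD(2)[OF C] h(1), simplified]] .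
    have "\<theta> (Suc n) f - h (\<delta> n f) \<in> \<delta>' (Suc n) ` free_module (B' (Suc (Suc n)))"
      if "f \<in> free_module (B (Suc n))" for f
      using graded_complexD(5)[OF C' graded_hom_in_free_module[OF \<psi> that] h(2)[OF that]] .
    then obtain h' where h': "graded_hom D (B (Suc n)) (e (Suc n)) (B' (Suc (Suc n))) (e' (Suc (Suc n))) h'"
        "\<And>f. f \<in> free_module (B (Suc n)) \<Longrightarrow> \<delta>' (Suc n) (h' f) = \<theta> (Suc n) f - h (\<delta> n f)"
      using graded_lift[OF graded_complexD(2)[OF C'] \<psi>] by blast
    interpret \<delta>: module_hom scale scale "\<delta>' (Suc n)" by (rule graded_complexD(6)[OF C'])
    have "\<delta>' (Suc n) (\<theta> (Suc (Suc n)) f - h' (\<delta> (Suc n) f)) = 0"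
      if f: "f \<in> free_module (B (Suc (Suc n)))" for f
      by (simp add: \<delta>.diff chain[OF f] h'(2)[OF graded_complexD(3)[OF C f]] graded_complexD(4)[OF C f])
    then show "\<exists>h'. P (Suc n) h' \<and> Q n h h'"
      using h' by (auto simp: P_def Q_def)
  qed
  then obtain h where h: "\<And>n. P n (h n)" "\<And>n. Q n (h n) (h (Suc n))" by blast
  show thesis by (rule that[of h]) (use h in \<open>auto simp: P_def Q_def\<close>)
qed

text \<open>Degree \<open>n\<close> here is degree \<open>n - 1\<close> in
  \<open>tor_cycles\<close>, since the resolution is one of the quotient ring. In degree 0 there is
  no outgoing differential.\<close>

definition residue_cycles ::
  "(nat \<Rightarrow> nat set) \<Rightarrow> (nat \<Rightarrow> nat \<Rightarrow> int) \<Rightarrow>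
   (nat \<Rightarrow> (nat \<Rightarrow>\<^sub>0 ('v, 'k::comm_ring_1) polynomial) \<Rightarrow> (nat \<Rightarrow>\<^sub>0 ('v, 'k) polynomial)) \<Rightarrow>
   nat \<Rightarrow> int \<Rightarrow> (nat \<Rightarrow>\<^sub>0 'k) set" where
  "residue_cycles B e \<delta> n j =
     {v \<in> free_module {c \<in> B n. e n c = j}. \<forall>m. n = Suc m \<longrightarrow> tensor_residue (\<delta> m) v = 0}"

definition residue_boundaries ::
  "(nat \<Rightarrow> nat set) \<Rightarrow> (nat \<Rightarrow> nat \<Rightarrow> int) \<Rightarrow>
   (nat \<Rightarrow> (nat \<Rightarrow>\<^sub>0 ('v, 'k::comm_ring_1) polynomial) \<Rightarrow> (nat \<Rightarrow>\<^sub>0 ('v, 'k) polynomial)) \<Rightarrow>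
   nat \<Rightarrow> int \<Rightarrow> (nat \<Rightarrow>\<^sub>0 'k) set" where
  "residue_boundaries B e \<delta> n j = tensor_residue (\<delta> n) ` free_module {c \<in> B (Suc n). e (Suc n) c = j}"

text \<open>For a graded complex the subtraction of naturals does not truncate: the boundaries form
  a subspace of the finite-dimensional space of cycles.\<close>

definition residue_homology_dim ::
  "(nat \<Rightarrow> nat set) \<Rightarrow> (nat \<Rightarrow> nat \<Rightarrow> int) \<Rightarrow>
   (nat \<Rightarrow> (nat \<Rightarrow>\<^sub>0 ('v, 'k::field) polynomial) \<Rightarrow> (nat \<Rightarrow>\<^sub>0 ('v, 'k) polynomial)) \<Rightarrow>
   nat \<Rightarrow> int \<Rightarrow> nat" where
  "residue_homology_dim B e \<delta> n j =
     kvec.dim (residue_cycles B e \<delta> n j) - kvec.dim (residue_boundaries B e \<delta> n j)"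

lemma free_module_restrict: "v \<in> free_module {c \<in> B. P c} \<Longrightarrow> v \<in> free_module B"
  by (auto simp: free_module_def)

lemma residue_cycles_subspace:
  assumes "graded_complex B e \<delta>"
  shows "free.subspace (residue_cycles B e \<delta> n j)"
proof (cases n)
  case 0
  then show ?thesis by (simp add: residue_cycles_def subspace_free_module)
next
  case (Suc m)
  interpret t: module_hom scale scale "tensor_residue (\<delta> m)"
    by (rule free_hom_tensor_residue[OF graded_complexD(6)[OF assms]])
  have "residue_cycles B e \<delta> n j =
      free_module {c \<in> B n. e n c = j} \<inter> {v. tensor_residue (\<delta> m) v = 0}"
    by (auto simp: residue_cycles_def Suc)
  then show ?thesis
    using free.subspace_inter[OF subspace_free_module t.subspace_kernel] by simp
qed

lemma residue_boundaries_subspace: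
  assumes "graded_complex B e \<delta>"
  shows "free.subspace (residue_boundaries B e \<delta> n j)"
proof -
  interpret t: module_hom scale scale "tensor_residue (\<delta> n)"
    by (rule free_hom_tensor_residue[OF graded_complexD(6)[OF assms]])
  show ?thesis unfolding residue_boundaries_def by (rule t.subspace_image[OF subspace_free_module])
qed

lemma residue_boundaries_subset_cycles:
  fixes \<delta> :: "nat \<Rightarrow> (nat \<Rightarrow>\<^sub>0 ('v, 'k::comm_ring_1) polynomial) \<Rightarrow> (nat \<Rightarrow>\<^sub>0 ('v, 'k) polynomial)"
  assumes "graded_complex B e \<delta>"
  shows "residue_boundaries B e \<delta> n j \<subseteq> residue_cycles B e \<delta> n j"
proof
  fix w assume "w \<in> residue_boundaries B e \<delta> n j"
  then obtain v where v: "v \<in> free_module {c \<in> B (Suc n). e (Suc n) c = j}" "w = tensor_residue (\<delta> n) v"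
    by (auto simp: residue_boundaries_def)
  have "w \<in> free_module {c \<in> B n. e n c = j}"
    using tensor_residue_graded[OF graded_complexD(2)[OF assms] v(1)] v(2) by simp
  moreover have "tensor_residue (\<delta> m) w = 0" if "n = Suc m" for m
  proof -
    have "v \<in> free_module (B (Suc n))" using v(1) by (rule free_module_restrict)
    then have "tensor_residue (\<delta> m) w = tensor_residue (\<lambda>_. 0 :: nat \<Rightarrow>\<^sub>0 ('v, 'k) polynomial) v"
      unfolding v(2) that
      by (intro tensor_residue_comp[OF graded_complexD(6)[OF assms], where B = "B (Suc (Suc m))"])
        (auto intro: graded_complexD(4)[OF assms])
    then show ?thesis by (simp add: tensor_residue_eq)
  qed
  ultimately show "w \<in> residue_cycles B e \<delta> n j" by (simp add: residue_cycles_def)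
qed

lemma residue_cycles_subset: "residue_cycles B e \<delta> n j \<subseteq> free_module (B n)"
  by (auto simp: residue_cycles_def intro: free_module_restrict)

lemma residue_cycles_finite_span:
  assumes "graded_complex B e \<delta>"
  shows "\<exists>T. finite T \<and> residue_cycles B e \<delta> n j \<subseteq> free.span T"
  using free_module_subset_span[OF graded_complexD(1)[OF assms, of n]] graded_complexD(1)[OF assms, of n]
    residue_cycles_subset[of B e \<delta> n j]
  by (intro exI[of _ "unit_vec ` B n"] conjI finite_imageI subset_trans[OF residue_cycles_subset])

lemma chain_map_preserves:
  fixes \<phi> :: "nat \<Rightarrow> (nat \<Rightarrow>\<^sub>0 ('v, 'k::comm_ring_1) polynomial) \<Rightarrow> (nat \<Rightarrow>\<^sub>0 ('v, 'k) polynomial)"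
  assumes C: "graded_complex B e \<delta>" and C': "graded_complex B' e' \<delta>'"
    and \<phi>: "\<And>n. graded_hom 0 (B n) (e n) (B' n) (e' n) (\<phi> n)"
    and chain: "\<And>n f. f \<in> free_module (B (Suc n)) \<Longrightarrow> \<delta>' n (\<phi> (Suc n) f) = \<phi> n (\<delta> n f)"
  shows "v \<in> residue_cycles B e \<delta> n j \<Longrightarrow> tensor_residue (\<phi> n) v \<in> residue_cycles B' e' \<delta>' n j"
    and "w \<in> residue_boundaries B e \<delta> n j \<Longrightarrow> tensor_residue (\<phi> n) w \<in> residue_boundaries B' e' \<delta>' n j"
proof -
  have comm: "tensor_residue (\<delta>' m) (tensor_residue (\<phi> (Suc m)) v) =
      tensor_residue (\<phi> m) (tensor_residue (\<delta> m) v)" if "v \<in> free_module (B (Suc m))" for m v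
  proof -
    have "tensor_residue (\<delta>' m) (tensor_residue (\<phi> (Suc m)) v) = tensor_residue (\<lambda>f. \<phi> m (\<delta> m f)) v"
      by (rule tensor_residue_comp[OF graded_complexD(6)[OF C'] chain that])
    also have "\<dots> = tensor_residue (\<phi> m) (tensor_residue (\<delta> m) v)"
      by (rule tensor_residue_comp[OF graded_hom_free_hom[OF \<phi>] refl that, symmetric])
    finally show ?thesis .
  qed
  have gr: "tensor_residue (\<phi> n) v \<in> free_module {c \<in> B' n. e' n c = j}"
    if "v \<in> free_module {c \<in> B n. e n c = j}" for v n
    using tensor_residue_graded[OF \<phi> that] by simp
  {
    assume v: "v \<in> residue_cycles B e \<delta> n j"
    have "tensor_residue (\<delta>' m) (tensor_residue (\<phi> n) v) = 0" if "n = Suc m" for m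
    proof -
      interpret t: module_hom scale scale "tensor_residue (\<phi> m)"
        by (rule free_hom_tensor_residue[OF graded_hom_free_hom[OF \<phi>]])
      have "tensor_residue (\<delta> m) v = 0" using v that by (auto simp: residue_cycles_def)
      moreover have "v \<in> free_module (B (Suc m))"
        using subsetD[OF residue_cycles_subset v] by (simp only: that)
      ultimately show ?thesis using comm[of v m] by (simp add: that)
    qed
    then show "tensor_residue (\<phi> n) v \<in> residue_cycles B' e' \<delta>' n j"
      using v gr by (auto simp: residue_cycles_def)
  }
  assume "w \<in> residue_boundaries B e \<delta> n j"
  then obtain v where v: "v \<in> free_module {c \<in> B (Suc n). e (Suc n) c = j}" "w = tensor_residue (\<delta> n) v"
    by (auto simp: residue_boundaries_def)
  have "v \<in> free_module (B (Suc n))" using v(1) by (rule free_module_restrict)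
  from comm[OF this] show "tensor_residue (\<phi> n) w \<in> residue_boundaries B' e' \<delta>' n j"
    using gr[OF v(1)] by (auto simp: residue_boundaries_def v(2) intro!: image_eqI)
qed

text \<open>
  If \<open>\<phi>\<close> and \<open>\<psi>\<close> are lifts of the identity of \<open>R\<close>, then \<open>id - \<psi>\<phi>\<close> is null-homotopic, so \<open>\<phi>\<close> is
  injective on the homology of the reduced complexes.
\<close>

lemma residue_homology_dim_le:
  fixes \<delta> \<delta>' :: "nat \<Rightarrow> (nat \<Rightarrow>\<^sub>0 ('v, 'k::field) polynomial) \<Rightarrow> (nat \<Rightarrow>\<^sub>0 ('v, 'k) polynomial)"
  assumes R: "quotient_resolution I B e \<delta>" and R': "quotient_resolution I B' e' \<delta>'"
  shows "residue_homology_dim B e \<delta> n j \<le> residue_homology_dim B' e' \<delta>' n j"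
proof -
  have C: "graded_complex B e \<delta>" and C': "graded_complex B' e' \<delta>'"
    using R R' by (simp_all add: quotient_resolution_def)
  \<comment> \<open>Both resolutions begin with \<open>R\<close> generated in degree 0, so the
    identity is homogeneous of degree 0 in either direction and can be lifted.\<close>
  have id: "graded_hom 0 (B 0) (e 0) (B' 0) (e' 0) (\<lambda>f. f)"
    "graded_hom 0 (B' 0) (e' 0) (B 0) (e 0) (\<lambda>f. f)"
    using R R' graded_hom_ident[of "{0}" "e 0"] graded_hom_ident[of "{0}" "e' 0"]
    by (auto simp: quotient_resolution_def graded_hom_def)
  have im: "\<delta> 0 ` free_module (B 1) = \<delta>' 0 ` free_module (B' 1)"
    using R R' by (simp add: quotient_resolution_def)
  obtain \<phi> where \<phi>: "\<phi> 0 = (\<lambda>f. f)" "\<And>n. graded_hom 0 (B n) (e n) (B' n) (e' n) (\<phi> n)"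
      "\<And>n f. f \<in> free_module (B (Suc n)) \<Longrightarrow> \<delta>' n (\<phi> (Suc n) f) = \<phi> n (\<delta> n f)"
    using lift_chain_map[OF C C' id(1)] im by blast
  obtain \<psi> where \<psi>: "\<psi> 0 = (\<lambda>f. f)" "\<And>n. graded_hom 0 (B' n) (e' n) (B n) (e n) (\<psi> n)"
      "\<And>n f. f \<in> free_module (B' (Suc n)) \<Longrightarrow> \<delta> n (\<psi> (Suc n) f) = \<psi> n (\<delta>' n f)"
    using lift_chain_map[OF C' C id(2)] im by blast
  define \<theta> where "\<theta> n f = f - \<psi> n (\<phi> n f)" for n f
  have \<theta>: "graded_hom 0 (B n) (e n) (B n) (e n) (\<theta> n)" for n
    unfolding \<theta>_def using graded_hom_diff[OF graded_hom_ident graded_hom_comp[OF \<phi>(2) \<psi>(2), simplified]] .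
  have \<theta>chain: "\<delta> n (\<theta> (Suc n) f) = \<theta> n (\<delta> n f)" if f: "f \<in> free_module (B (Suc n))" for n f
  proof -
    interpret d: module_hom scale scale "\<delta> n" by (rule graded_complexD(6)[OF C])
    show ?thesis
      unfolding \<theta>_def
      by (simp add: d.diff \<psi>(3)[OF graded_hom_in_free_module[OF \<phi>(2) f]] \<phi>(3)[OF f])
  qed
  obtain h where h: "\<And>n. graded_hom 0 (B n) (e n) (B (Suc n)) (e (Suc n)) (h n)"
      "\<And>n f. f \<in> free_module (B (Suc n)) \<Longrightarrow> \<theta> (Suc n) f = \<delta> (Suc n) (h (Suc n) f) + h n (\<delta> n f)"
    using null_homotopy[OF C C \<theta> \<theta>chain] \<phi>(1) \<psi>(1) by (auto simp: \<theta>_def)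
  \<comment> \<open>On a cycle the homotopy equation leaves only the term \<open>\<delta> h\<close>,
    which is a boundary. In degree 0 no homotopy equation is available, but there
    \<open>\<theta>\<close> itself is 0.\<close>
  have bound: "tensor_residue (\<theta> n) z \<in> residue_boundaries B e \<delta> n j"
    if z: "z \<in> residue_cycles B e \<delta> n j" for z
  proof (cases n)
    case 0
    then show ?thesis
      using free.subspace_0[OF residue_boundaries_subspace[OF C]]
      by (simp add: \<theta>_def \<phi>(1) \<psi>(1) tensor_residue_eq)
  next
    case (Suc m)
    interpret t: module_hom scale scale "tensor_residue (h m)"
      by (rule free_hom_tensor_residue[OF graded_hom_free_hom[OF h(1)]])
    have zB: "z \<in> free_module (B (Suc m))"
      using subsetD[OF residue_cycles_subset z] by (simp only: Suc)
    have "tensor_residue (\<theta> n) z =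
        tensor_residue (\<lambda>f. \<delta> n (h n f)) z + tensor_residue (\<lambda>f. h m (\<delta> m f)) z"
      using h(2)[OF const_vec_in_free_module[OF zB]] by (simp add: tensor_residue_eq Suc)
    also have "tensor_residue (\<lambda>f. h m (\<delta> m f)) z = tensor_residue (h m) (tensor_residue (\<delta> m) z)"
      by (rule tensor_residue_comp[OF graded_hom_free_hom[OF h(1)] refl zB, symmetric])
    also have "tensor_residue (\<delta> m) z = 0" using z Suc by (auto simp: residue_cycles_def)
    also have "tensor_residue (\<lambda>f. \<delta> n (h n f)) z = tensor_residue (\<delta> n) (tensor_residue (h n) z)"
      by (rule tensor_residue_comp[OF graded_complexD(6)[OF C] refl zB, symmetric])
    finally have "tensor_residue (\<theta> n) z = tensor_residue (\<delta> n) (tensor_residue (h n) z)" by simp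
    moreover have "tensor_residue (h n) z \<in> free_module {c \<in> B (Suc n). e (Suc n) c = j}"
      using tensor_residue_graded[OF h(1), of z n j] z by (simp add: residue_cycles_def)
    ultimately show ?thesis by (auto simp: residue_boundaries_def)
  qed
  have inj: "z \<in> residue_boundaries B e \<delta> n j"
    if z: "z \<in> residue_cycles B e \<delta> n j"
      and \<phi>z: "tensor_residue (\<phi> n) z \<in> residue_boundaries B' e' \<delta>' n j" for z
  proof -
    have zB: "z \<in> free_module (B n)" by (rule subsetD[OF residue_cycles_subset z])
    have "tensor_residue (\<theta> n) z = z - tensor_residue (\<lambda>f. \<psi> n (\<phi> n f)) z"
      by (simp add: \<theta>_def tensor_residue_eq)
    also have "tensor_residue (\<lambda>f. \<psi> n (\<phi> n f)) z = tensor_residue (\<psi> n) (tensor_residue (\<phi> n) z)"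
      by (rule tensor_residue_comp[OF graded_hom_free_hom[OF \<psi>(2)] refl zB, symmetric])
    finally have "z = tensor_residue (\<theta> n) z + tensor_residue (\<psi> n) (tensor_residue (\<phi> n) z)" by simp
    also have "\<dots> \<in> residue_boundaries B e \<delta> n j"
      using bound[OF z] chain_map_preserves(2)[OF C' C \<psi>(2,3) \<phi>z]
      by (intro free.subspace_add[OF residue_boundaries_subspace[OF C]])
    finally show ?thesis .
  qed
  obtain T where T: "finite T" "residue_cycles B e \<delta> n j \<subseteq> free.span T"
    using residue_cycles_finite_span[OF C] by blast
  obtain T' where T': "finite T'" "residue_cycles B' e' \<delta>' n j \<subseteq> free.span T'"
    using residue_cycles_finite_span[OF C'] by blast
  show ?thesis
    unfolding residue_homology_dim_def
  proof (rule kvec.dim_quotient_le[where f = "tensor_residue (\<phi> n)", OF _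
        residue_boundaries_subspace[OF C] residue_cycles_subspace[OF C]
        residue_boundaries_subspace[OF C'] residue_cycles_subspace[OF C']
        residue_boundaries_subset_cycles[OF C] residue_boundaries_subset_cycles[OF C']
        T(2,1) T'(2,1) _ inj])
    show "Vector_Spaces.linear scale scale (tensor_residue (\<phi> n))"
      using free_hom_tensor_residue[OF graded_hom_free_hom[OF \<phi>(2)[of n]]]
      by (simp add: module_hom_iff_linear)
    show "tensor_residue (\<phi> n) ` residue_cycles B e \<delta> n j \<subseteq> residue_cycles B' e' \<delta>' n j"
      using chain_map_preserves(1)[OF C C' \<phi>(2,3)] by blast
  qed
qed

text \<open>Injections on homology in both directions force equal dimensions.\<close>

lemma residue_homology_dim_unique:
  fixes \<delta> \<delta>' :: "nat \<Rightarrow> (nat \<Rightarrow>\<^sub>0 ('v, 'k::field) polynomial) \<Rightarrow> (nat \<Rightarrow>\<^sub>0 ('v, 'k) polynomial)"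
  assumes "quotient_resolution I B e \<delta>" "quotient_resolution I B' e' \<delta>'"
  shows "residue_homology_dim B e \<delta> n j = residue_homology_dim B' e' \<delta>' n j"
  using residue_homology_dim_le[OF assms] residue_homology_dim_le[OF assms(2,1)] by (rule antisym)

section \<open>Betti numbers from resolutions of the quotient ring\<close>

lemma single_in_iff: "f \<in> free_module {c} \<longleftrightarrow> f = Poly_Mapping.single c (Poly_Mapping.lookup f c)"
proof
  assume "f \<in> free_module {c}"
  then have *: "Poly_Mapping.lookup f d = 0" if "d \<noteq> c" for d
    using that by (auto simp: free_module_def in_keys_iff)
  show "f = Poly_Mapping.single c (Poly_Mapping.lookup f c)"
    by (rule poly_mapping_eqI) (use * in \<open>auto simp: lookup_single when_def\<close>)
next
  assume "f = Poly_Mapping.single c (Poly_Mapping.lookup f c)"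
  then show "f \<in> free_module {c}" by (metis single_in_free_module singletonI)
qed

lemma single_0_eq_iff [simp]: "Poly_Mapping.single c p = 0 \<longleftrightarrow> p = (0 :: 'a::zero)"
  by (metis lookup_single_eq lookup_zero single_zero)

text \<open>\<open>R\<close> is identified with the free module on the basis element 0, which turns
  an augmentation into a map of free modules.\<close>

lemma module_hom_scale_mult_iff:
  "module_hom scale (*) a \<longleftrightarrow> free_hom (\<lambda>f. Poly_Mapping.single 0 (a f))"
proof -
  have "Poly_Mapping.single (0::nat) (a (f + g)) = Poly_Mapping.single 0 (a f) + Poly_Mapping.single 0 (a g)
      \<longleftrightarrow> a (f + g) = a f + a g" for f g
    by (simp add: single_add[symmetric] inj_eq[OF inj_single])
  moreover have "Poly_Mapping.single (0::nat) (a (scale r f)) = scale r (Poly_Mapping.single 0 (a f))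
      \<longleftrightarrow> a (scale r f) = r * a f" for r f
  proof -
    have "scale r (Poly_Mapping.single (0::nat) (a f)) = Poly_Mapping.single 0 (r * a f)"
      by (rule poly_mapping_eqI) (simp add: lookup_single when_def)
    then show ?thesis by (simp add: inj_eq[OF inj_single])
  qed
  ultimately show ?thesis
    by (simp add: module_hom_iff module_mult free.module_axioms)
qed

lemma quotient_resolution_of_graded_free_resolution:
  fixes I :: "('v, 'k::comm_ring_1) polynomial set"
  assumes res: "graded_free_resolution I B e d aug"
  shows "quotient_resolution I (case_nat {0} B) (case_nat (\<lambda>_. 0) e)
    (case_nat (\<lambda>f. Poly_Mapping.single 0 (aug f)) (\<lambda>n. d (Suc n)))"
    (is "quotient_resolution I ?B ?e ?d")
proof -
  have r: "\<And>i. finite (B i)" "\<And>i. free_hom (d (Suc i))"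
    "\<And>i c. c \<in> B (Suc i) \<Longrightarrow> homogeneous_vec (e i) (e (Suc i) c) (d (Suc i) (unit_vec c))"
    "module_hom scale (*) aug" "\<And>c. c \<in> B 0 \<Longrightarrow> homogeneous (e 0 c) (aug (unit_vec c))"
    "aug ` free_module (B 0) = I"
    "d (Suc 0) ` free_module (B (Suc 0)) = {f \<in> free_module (B 0). aug f = 0}"
    "\<And>i. d (Suc (Suc i)) ` free_module (B (Suc (Suc i))) = {f \<in> free_module (B (Suc i)). d (Suc i) f = 0}"
    using res unfolding graded_free_resolution_def by simp_all
  \<comment> \<open>That a differential maps into the preceding free module is read off from
    exactness, where the image equals a kernel taken inside that module.\<close>
  have maps: "d (Suc i) f \<in> free_module (B i)" if "f \<in> free_module (B (Suc i))" for i f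
    using r(7) r(8)[of "i - 1"] that by (cases i) auto
  have "graded_hom 0 (?B (Suc n)) (?e (Suc n)) (?B n) (?e n) (?d n)" for n
  proof (cases n)
    case 0
    have "homogeneous_vec (\<lambda>_. 0) (e 0 c) (Poly_Mapping.single 0 (aug (unit_vec c)))" if "c \<in> B 0" for c
      using r(5)[OF that] by (simp add: homogeneous_vec_def)
    then show ?thesis using 0 r(4) by (simp add: graded_hom_def module_hom_scale_mult_iff)
  next
    case (Suc m)
    then show ?thesis using r(2,3) maps by (simp add: graded_hom_def)
  qed
  moreover have "?d (Suc n) ` free_module (?B (Suc (Suc n))) = {f \<in> free_module (?B (Suc n)). ?d n f = 0}" for n
    using r(7,8) by (cases n) auto
  moreover have "finite (?B n)" for n using r(1) by (cases n) auto
  ultimately have "graded_complex ?B ?e ?d" by (simp add: graded_complex_def)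
  moreover have "?d 0 ` free_module (?B 1) = Poly_Mapping.single 0 ` I"
    using r(6) by (auto simp: image_image)
  ultimately show ?thesis by (simp add: quotient_resolution_def)
qed

text \<open>This direction produces the witness for the definite description in
  \<open>tor_dim\<close>.\<close>

lemma graded_free_resolution_of_quotient_resolution:
  fixes I :: "('v, 'k::comm_ring_1) polynomial set"
  assumes "quotient_resolution I B e \<delta>"
  shows "graded_free_resolution I (\<lambda>i. B (Suc i)) (\<lambda>i. e (Suc i)) \<delta> (\<lambda>f. Poly_Mapping.lookup (\<delta> 0 f) 0)"
proof -
  have C: "graded_complex B e \<delta>" and B0: "B 0 = {0}" "e 0 0 = 0"
    and im: "\<delta> 0 ` free_module (B (Suc 0)) = Poly_Mapping.single 0 ` I"
    using assms by (auto simp: quotient_resolution_def)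
  note gr = graded_complexD(2)[OF C]
  interpret d: module_hom scale scale "\<delta> 0" by (rule graded_complexD(6)[OF C])
  have aug: "module_hom scale (*) (\<lambda>f. Poly_Mapping.lookup (\<delta> 0 f) 0)"
    by (simp add: module_hom_iff free.module_axioms module_mult d.add d.scale lookup_add)
  have d0: "\<delta> 0 f = Poly_Mapping.single 0 (Poly_Mapping.lookup (\<delta> 0 f) 0)" if "f \<in> free_module (B (Suc 0))" for f
    using graded_hom_in_free_module[OF gr that] by (simp add: B0 flip: single_in_iff)
  have "homogeneous (e (Suc 0) c) (Poly_Mapping.lookup (\<delta> 0 (unit_vec c)) 0)" if "c \<in> B (Suc 0)" for c
  proof -
    have "homogeneous_vec (e 0) (e (Suc 0) c) (\<delta> 0 (unit_vec c))"
      using gr[of 0] that by (simp add: graded_hom_def)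
    then show ?thesis
      using B0(2) homogeneous_0 by (cases "0 \<in> Poly_Mapping.keys (\<delta> 0 (unit_vec c))")
        (force simp: homogeneous_vec_def, simp add: in_keys_iff homogeneous_0)
  qed
  moreover have "(\<lambda>f. Poly_Mapping.lookup (\<delta> 0 f) 0) ` free_module (B (Suc 0)) = I"
  proof -
    have "(\<lambda>f. Poly_Mapping.lookup (\<delta> 0 f) 0) ` free_module (B (Suc 0)) =
        (\<lambda>g. Poly_Mapping.lookup g 0) ` (\<delta> 0 ` free_module (B (Suc 0)))"
      by (simp add: image_image)
    then show ?thesis by (simp add: im image_image)
  qed
  moreover have "\<delta> 1 ` free_module (B (Suc 1)) =
      {f \<in> free_module (B (Suc 0)). Poly_Mapping.lookup (\<delta> 0 f) 0 = 0}"
  proof -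
    have "\<delta> (Suc 0) ` free_module (B (Suc (Suc 0))) = {f \<in> free_module (B (Suc 0)). \<delta> 0 f = 0}"
      using C by (simp add: graded_complex_def)
    moreover have "\<delta> 0 f = 0 \<longleftrightarrow> Poly_Mapping.lookup (\<delta> 0 f) 0 = 0" if "f \<in> free_module (B (Suc 0))" for f
      using d0[OF that] by (metis single_0_eq_iff)
    ultimately show ?thesis by auto
  qed
  ultimately show ?thesis
    using C aug gr unfolding graded_free_resolution_def graded_complex_def graded_hom_def by simp
qed

text \<open>For \<open>i = 0\<close> the left side imposes no cycle condition, while the right side
  asks the reduced augmentation to vanish. It does, because elements of \<open>I\<close> have no
  constant term.\<close>

lemma tor_cycles_eq:
  fixes I :: "('v, 'k::comm_ring_1) polynomial set"
  assumes res: "graded_free_resolution I B e d aug" and I: "\<And>p. p \<in> I \<Longrightarrow> constant_coeff p = 0"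
  shows "tor_cycles B e d i j = residue_cycles (case_nat {0} B) (case_nat (\<lambda>_. 0) e)
    (case_nat (\<lambda>f. Poly_Mapping.single 0 (aug f)) (\<lambda>n. d (Suc n))) (Suc i) j"
proof (cases i)
  case 0
  have "tensor_residue (\<lambda>f. Poly_Mapping.single 0 (aug f)) v = 0"
    if "v \<in> free_module {c \<in> B 0. e 0 c = j}" for v :: "nat \<Rightarrow>\<^sub>0 'k"
  proof -
    have "const_vec v \<in> free_module (B 0)"
      by (intro const_vec_in_free_module free_module_restrict[OF that])
    then have "aug (const_vec v) \<in> I" using res by (auto simp: graded_free_resolution_def)
    then show ?thesis
      by (intro poly_mapping_eqI) (simp add: tensor_residue_eq lookup_single when_def I)
  qed
  then show ?thesis by (auto simp: 0 tor_cycles_def residue_cycles_def)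
next
  case (Suc m)
  then show ?thesis by (simp add: tor_cycles_def residue_cycles_def)
qed

lemma tor_dim_eq:
  fixes I :: "('v, 'k::field) polynomial set"
  assumes res: "quotient_resolution I B e \<delta>" and I: "\<And>p. p \<in> I \<Longrightarrow> constant_coeff p = 0"
  shows "tor_dim I i j = residue_homology_dim B e \<delta> (Suc i) j"
proof -
  have *: "kvec.dim (tor_cycles B' e' d i j) - kvec.dim (tor_boundaries B' e' d i j) =
      residue_homology_dim B e \<delta> (Suc i) j"
    if "graded_free_resolution I B' e' d aug" for B' e' d aug
    using residue_homology_dim_unique[OF quotient_resolution_of_graded_free_resolution[OF that] res, of "Suc i" j]
    by (simp add: residue_homology_dim_def tor_cycles_eq[OF that I] tor_boundaries_def residue_boundaries_def)
  show ?thesis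
    unfolding tor_dim_def
  proof (rule the_equality)
    show "\<exists>B' e' d aug. graded_free_resolution I B' e' d aug \<and> residue_homology_dim B e \<delta> (Suc i) j =
        kvec.dim (tor_cycles B' e' d i j) - kvec.dim (tor_boundaries B' e' d i j)"
      using graded_free_resolution_of_quotient_resolution[OF res] * by metis
  qed (use * in auto)
qed

lemma kvec_dim_zero [simp]: "kvec.dim {0} = 0"
  using kvec.dim_span_eq_card_independent[OF free.independent_empty] by simp

text \<open>For \<open>n = 0\<close> the convention becomes a computation: the reduced complex is
  \<open>k\<close> in internal degree 0 there, and no boundaries arrive since elements of
  \<open>I\<close> have no constant term.\<close>

lemma betti_eq:
  fixes I :: "('v, 'k::field) polynomial set"
  assumes res: "quotient_resolution I B e \<delta>" and I: "\<And>p. p \<in> I \<Longrightarrow> constant_coeff p = 0"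
  shows "betti I (int n - 1) j = residue_homology_dim B e \<delta> n j"
proof (cases n)
  case (Suc m)
  then show ?thesis by (simp add: betti_def tor_dim_eq[OF assms])
next
  case 0
  have B0: "B 0 = {0}" "e 0 0 = 0" and im: "\<delta> 0 ` free_module (B (Suc 0)) = Poly_Mapping.single 0 ` I"
    and C: "graded_complex B e \<delta>"
    using res by (auto simp: quotient_resolution_def)
  have "tensor_residue (\<delta> 0) v = 0" if "v \<in> free_module {c \<in> B (Suc 0). e (Suc 0) c = j}" for v :: "nat \<Rightarrow>\<^sub>0 'k"
  proof -
    have "const_vec v \<in> free_module (B (Suc 0))"
      by (intro const_vec_in_free_module free_module_restrict[OF that])
    then have "\<delta> 0 (const_vec v) \<in> Poly_Mapping.single 0 ` I" using im by blast
    then show ?thesis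
      by (intro poly_mapping_eqI) (auto simp: tensor_residue_eq lookup_single when_def I)
  qed
  then have "residue_boundaries B e \<delta> 0 j \<subseteq> {0}" by (auto simp: residue_boundaries_def)
  then have b: "residue_boundaries B e \<delta> 0 j = {0}"
    using free.subspace_0[OF residue_boundaries_subspace[OF C]] by blast
  have fm0: "free_module {} = {0 :: nat \<Rightarrow>\<^sub>0 'k}" by (auto simp: free_module_def)
  have "free_module {0} = free.span {unit_vec 0 :: nat \<Rightarrow>\<^sub>0 'k}"
  proof
    show "free_module {0} \<subseteq> free.span {unit_vec 0 :: nat \<Rightarrow>\<^sub>0 'k}"
      using free_module_subset_span[of "{0}"] by simp
    show "free.span {unit_vec 0 :: nat \<Rightarrow>\<^sub>0 'k} \<subseteq> free_module {0}"
      by (rule free.span_minimal) (simp_all add: subspace_free_module del: single_one)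
  qed
  then have "kvec.dim (free_module {0} :: (nat \<Rightarrow>\<^sub>0 'k) set) = card {unit_vec 0 :: nat \<Rightarrow>\<^sub>0 'k}"
    by (simp only: kvec.dim_span_eq_card_independent kvec.dependent_single single_0_eq_iff one_neq_zero not_False_eq_True)
  moreover have "{c \<in> B 0. e 0 c = j} = (if j = 0 then {0} else {})" using B0 by auto
  then have "residue_cycles B e \<delta> 0 j = free_module (if j = 0 then {0} else {})"
    by (simp add: residue_cycles_def)
  ultimately show ?thesis
    using fm0 by (simp add: 0 betti_def residue_homology_dim_def b)
qed

section \<open>Mapping cones\<close>

text \<open>Bases are sets of natural numbers, so a direct sum of free modules is encoded by
  interleaving: even indices carry the first summand, odd indices the second.\<close>

lift_definition evens :: "(nat \<Rightarrow>\<^sub>0 'a::zero) \<Rightarrow> (nat \<Rightarrow>\<^sub>0 'a)" is "\<lambda>f n. f (2 * n)"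
proof -
  fix f :: "nat \<Rightarrow> 'a" assume "finite {n. f n \<noteq> 0}"
  then have "finite ((\<lambda>n. 2 * n) -` {n. f n \<noteq> 0})" by (intro finite_vimageI) (auto simp: inj_on_def)
  then show "finite {n. f (2 * n) \<noteq> 0}" by (simp add: vimage_def)
qed

lift_definition odds :: "(nat \<Rightarrow>\<^sub>0 'a::zero) \<Rightarrow> (nat \<Rightarrow>\<^sub>0 'a)" is "\<lambda>f n. f (2 * n + 1)"
proof -
  fix f :: "nat \<Rightarrow> 'a" assume "finite {n. f n \<noteq> 0}"
  then have "finite ((\<lambda>n. 2 * n + 1) -` {n. f n \<noteq> 0})" by (intro finite_vimageI) (auto simp: inj_on_def)
  then show "finite {n. f (2 * n + 1) \<noteq> 0}" by (simp add: vimage_def)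
qed

lift_definition join :: "(nat \<Rightarrow>\<^sub>0 'a::zero) \<Rightarrow> (nat \<Rightarrow>\<^sub>0 'a) \<Rightarrow> (nat \<Rightarrow>\<^sub>0 'a)"
  is "\<lambda>g f n. if even n then g (n div 2) else f (n div 2)"
proof -
  fix g f :: "nat \<Rightarrow> 'a" assume "finite {n. g n \<noteq> 0}" "finite {n. f n \<noteq> 0}"
  then have "finite ((\<lambda>n. 2 * n) ` {n. g n \<noteq> 0} \<union> (\<lambda>n. 2 * n + 1) ` {n. f n \<noteq> 0})" by simp
  moreover have "{n. (if even n then g (n div 2) else f (n div 2)) \<noteq> 0} \<subseteq>
      (\<lambda>n. 2 * n) ` {n. g n \<noteq> 0} \<union> (\<lambda>n. 2 * n + 1) ` {n. f n \<noteq> 0}"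
  proof
    fix n assume n: "n \<in> {n. (if even n then g (n div 2) else f (n div 2)) \<noteq> 0}"
    show "n \<in> (\<lambda>n. 2 * n) ` {n. g n \<noteq> 0} \<union> (\<lambda>n. 2 * n + 1) ` {n. f n \<noteq> 0}"
    proof (cases "even n")
      case True
      then have "n = 2 * (n div 2)" "g (n div 2) \<noteq> 0" using n by auto
      then show ?thesis by blast
    next
      case False
      then have "n = 2 * (n div 2) + 1" "f (n div 2) \<noteq> 0" using n by auto
      then show ?thesis by blast
    qed
  qed
  ultimately show "finite {n. (if even n then g (n div 2) else f (n div 2)) \<noteq> 0}"
    by (rule finite_subset[rotated])
qed

lemma evens_join [simp]: "evens (join g f) = g" by transfer auto
lemma odds_join [simp]: "odds (join g f) = f" by transfer auto

lemma join_evens_odds [simp]: "join (evens h) (odds h) = h"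
  by transfer (auto simp: fun_eq_iff elim!: evenE oddE)

lemma join_eq_iff [simp]: "join g f = join g' f' \<longleftrightarrow> g = g' \<and> f = f'"
  by (metis evens_join odds_join)

lemma join_0 [simp]: "join 0 0 = 0"
  by transfer auto

lemma join_eq_0_iff [simp]: "join g f = 0 \<longleftrightarrow> g = 0 \<and> f = 0"
  by (metis join_eq_iff join_0)

lemma evens_odds_linear [simp]:
  "evens (h + h') = evens h + evens h'" "odds (h + h') = odds h + odds h'"
  "evens 0 = 0" "odds 0 = 0"
  "evens (scale r h) = scale r (evens h)" "odds (scale r h) = scale r (odds h)"
  by (rule poly_mapping_eqI, simp add: evens.rep_eq odds.rep_eq lookup_add)+

lemma join_add: "join g f + join g' f' = join (g + g') (f + f')"
  by (rule poly_mapping_eqI) (simp add: join.rep_eq lookup_add)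

lemma join_scale: "scale r (join g f) = join (scale r g) (scale r f)"
  by (rule poly_mapping_eqI) (simp add: join.rep_eq)

lemma double_neq_Suc_double [simp]: "2 * c \<noteq> Suc (2 * c')" "Suc (2 * c) \<noteq> 2 * c'" for c c' :: nat
  by presburger+

lemma evens_odds_unit_vec [simp]:
  "evens (Poly_Mapping.single (2 * c) a) = Poly_Mapping.single c a"
  "odds (Poly_Mapping.single (2 * c) a) = 0"
  "evens (Poly_Mapping.single (Suc (2 * c)) a) = 0"
  "odds (Poly_Mapping.single (Suc (2 * c)) a) = Poly_Mapping.single c a"
  by (rule poly_mapping_eqI, auto simp: evens.rep_eq odds.rep_eq lookup_single when_def)+

definition join_basis :: "nat set \<Rightarrow> nat set \<Rightarrow> nat set" where
  "join_basis B B' = (\<lambda>c. 2 * c) ` B \<union> (\<lambda>c. Suc (2 * c)) ` B'"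

definition join_degree :: "(nat \<Rightarrow> int) \<Rightarrow> (nat \<Rightarrow> int) \<Rightarrow> nat \<Rightarrow> int" where
  "join_degree e e' n = (if even n then e (n div 2) else e' (n div 2))"

lemma join_degree_simps [simp]:
  "join_degree e e' (2 * c) = e c" "join_degree e e' (Suc (2 * c)) = e' c"
  by (simp_all add: join_degree_def)

lemma free_module_iff: "f \<in> free_module B \<longleftrightarrow> (\<forall>c. c \<notin> B \<longrightarrow> Poly_Mapping.lookup f c = 0)"
  by (auto simp: free_module_def in_keys_iff subset_iff)

lemma all_nat_even_odd: "(\<forall>n::nat. P n) \<longleftrightarrow> (\<forall>n. P (2 * n)) \<and> (\<forall>n. P (Suc (2 * n)))"
  by (metis Suc_eq_plus1 evenE oddE)

lemma in_join_basis_iff [simp]: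
  "2 * c \<in> join_basis B B' \<longleftrightarrow> c \<in> B" "Suc (2 * c) \<in> join_basis B B' \<longleftrightarrow> c \<in> B'"
  by (auto simp: join_basis_def)

lemma free_module_join_basis:
  "h \<in> free_module (join_basis B B') \<longleftrightarrow> evens h \<in> free_module B \<and> odds h \<in> free_module B'"
  unfolding free_module_iff by (subst all_nat_even_odd) (simp add: evens.rep_eq odds.rep_eq)

lemma join_basis_restrict:
  "{c \<in> join_basis B B'. join_degree e e' c = j} = join_basis {c \<in> B. e c = j} {c \<in> B'. e' c = j}"
  by (auto simp: join_basis_def)

lemma homogeneous_vec_join:
  "homogeneous_vec (join_degree e e') j h \<longleftrightarrow> homogeneous_vec e j (evens h) \<and> homogeneous_vec e' j (odds h)"
  unfolding homogeneous_vec_iff vec_degrees_in_def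
  by (subst all_nat_even_odd) (simp add: evens.rep_eq odds.rep_eq)

definition cone_basis where
  "cone_basis B1 B2 = (\<lambda>n. case n of 0 \<Rightarrow> {0} | Suc m \<Rightarrow> join_basis (B1 (Suc m)) (B2 m))"

definition cone_degree where
  "cone_degree D e1 e2 = (\<lambda>n. case n of 0 \<Rightarrow> (\<lambda>_. 0) | Suc m \<Rightarrow> join_degree (e1 (Suc m)) (\<lambda>c. e2 m c + D))"

text \<open>With both signs negative on the second summand, the terms
  \<open>\<delta>1 \<phi>\<close> and \<open>\<phi> \<delta>2\<close> cancel in the square of the
  differential. In degree 0 the target is \<open>R\<close> alone and the second component is
  absent.\<close>

definition cone_diff where
  "cone_diff \<delta>1 \<delta>2 \<phi> = (\<lambda>n h. case n of
     0 \<Rightarrow> \<delta>1 0 (evens h) - \<phi> 0 (odds h)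
   | Suc m \<Rightarrow> join (\<delta>1 n (evens h) - \<phi> n (odds h)) (- \<delta>2 m (odds h)))"

lemma cone_simps [simp]:
  "cone_basis B1 B2 0 = {0}" "cone_basis B1 B2 (Suc m) = join_basis (B1 (Suc m)) (B2 m)"
  "cone_degree D e1 e2 0 = (\<lambda>_. 0)"
  "cone_degree D e1 e2 (Suc m) = join_degree (e1 (Suc m)) (\<lambda>c. e2 m c + D)"
  "cone_diff \<delta>1 \<delta>2 \<phi> 0 = (\<lambda>h. \<delta>1 0 (evens h) - \<phi> 0 (odds h))"
  "cone_diff \<delta>1 \<delta>2 \<phi> (Suc m) = (\<lambda>h. join (\<delta>1 (Suc m) (evens h) - \<phi> (Suc m) (odds h)) (- \<delta>2 m (odds h)))"
  by (simp_all add: cone_basis_def cone_degree_def cone_diff_def)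

lemma free_hom_evens: "free_hom \<phi> \<Longrightarrow> free_hom (\<lambda>h. \<phi> (evens h))"
  by (simp add: module_hom_iff)

lemma free_hom_odds: "free_hom \<phi> \<Longrightarrow> free_hom (\<lambda>h. \<phi> (odds h))"
  by (simp add: module_hom_iff)

lemma free_hom_join: "free_hom \<phi> \<Longrightarrow> free_hom \<psi> \<Longrightarrow> free_hom (\<lambda>h. join (\<phi> h) (\<psi> h))"
  by (simp add: module_hom_iff join_add join_scale)

lemma free_hom_cone_diff:
  assumes "\<And>n. free_hom (\<delta>1 n)" "\<And>n. free_hom (\<delta>2 n)" "\<And>n. free_hom (\<phi> n)"
  shows "free_hom (cone_diff \<delta>1 \<delta>2 \<phi> n)"
  using assms
  by (cases n) (auto intro!: free_hom_join free_pair.module_hom_sub free_pair.module_hom_neg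
      free_hom_evens free_hom_odds)

lemma homogeneous_vec_shift: "homogeneous_vec (\<lambda>c. e c + D) (j + D) f \<longleftrightarrow> homogeneous_vec e j f"
  by (simp add: homogeneous_vec_def)

lemma homogeneous_vec_simps:
  "homogeneous_vec e j 0" "homogeneous_vec e j f \<Longrightarrow> homogeneous_vec e j (- f)"
  by (simp_all add: homogeneous_vec_iff vec_degrees_in_uminus)

text \<open>\<open>colon\<close> says that multiplication by \<open>m\<close> induces an injection
  of \<open>R/J\<close> into \<open>R/I\<close>. This is the information about homology in degree 0
  that the diagram chase uses; in positive degrees both given complexes are exact.\<close>

lemma quotient_resolution_cone:
  fixes \<delta>1 :: "nat \<Rightarrow> (nat \<Rightarrow>\<^sub>0 ('v, 'k::comm_ring_1) polynomial) \<Rightarrow> (nat \<Rightarrow>\<^sub>0 ('v, 'k) polynomial)"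
  assumes R1: "quotient_resolution I B1 e1 \<delta>1" and R2: "quotient_resolution J B2 e2 \<delta>2"
    and \<phi>0: "\<And>f. \<phi> 0 f = scale m f" and colon: "\<And>r. m * r \<in> I \<longleftrightarrow> r \<in> J"
    and \<phi>: "\<And>n. graded_hom D (B2 n) (e2 n) (B1 n) (e1 n) (\<phi> n)"
    and chain: "\<And>n f. f \<in> free_module (B2 (Suc n)) \<Longrightarrow> \<delta>1 n (\<phi> (Suc n) f) = \<phi> n (\<delta>2 n f)"
  shows "quotient_resolution {p + r * m |p r. p \<in> I} (cone_basis B1 B2) (cone_degree D e1 e2)
    (cone_diff \<delta>1 \<delta>2 \<phi>)"
proof -
  let ?B = "cone_basis B1 B2" and ?e = "cone_degree D e1 e2" and ?d = "cone_diff \<delta>1 \<delta>2 \<phi>"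
  have C1: "graded_complex B1 e1 \<delta>1" and C2: "graded_complex B2 e2 \<delta>2"
    and B0: "B1 0 = {0}" "B2 0 = {0}" "e1 0 0 = 0" "e2 0 0 = 0"
    and im1: "\<delta>1 0 ` free_module (B1 (Suc 0)) = Poly_Mapping.single 0 ` I"
    and im2: "\<delta>2 0 ` free_module (B2 (Suc 0)) = Poly_Mapping.single 0 ` J"
    using R1 R2 by (auto simp: quotient_resolution_def)
  note hom = graded_complexD(6)[OF C1] graded_complexD(6)[OF C2] graded_hom_free_hom[OF \<phi>]
  note simps1 = module_hom.add[OF hom(1)] module_hom.diff[OF hom(1)] module_hom.neg[OF hom(1)]
  note simps2 = module_hom.add[OF hom(2)] module_hom.diff[OF hom(2)] module_hom.neg[OF hom(2)]
  note simps\<phi> = module_hom.add[OF hom(3)] module_hom.diff[OF hom(3)] module_hom.neg[OF hom(3)]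
    module_hom.zero[OF hom(3)]
  have in1: "\<delta>1 n f \<in> free_module (B1 n)" if "f \<in> free_module (B1 (Suc n))" for n f
    by (rule graded_hom_in_free_module[OF graded_complexD(2)[OF C1] that])
  have in2: "\<delta>2 n f \<in> free_module (B2 n)" if "f \<in> free_module (B2 (Suc n))" for n f
    by (rule graded_hom_in_free_module[OF graded_complexD(2)[OF C2] that])
  have in\<phi>: "\<phi> n f \<in> free_module (B1 n)" if "f \<in> free_module (B2 n)" for n f
    by (rule graded_hom_in_free_module[OF \<phi> that])
  note diff_in = free.subspace_diff[OF subspace_free_module]
  note neg_in = free.subspace_neg[OF subspace_free_module]
  have fin: "finite (?B n)" for n
    using graded_complexD(1)[OF C1] graded_complexD(1)[OF C2] by (cases n) (auto simp: join_basis_def)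
  have gr: "graded_hom 0 (?B (Suc n)) (?e (Suc n)) (?B n) (?e n) (?d n)" for n
  proof -
    have g1: "\<delta>1 n (unit_vec c) \<in> free_module (B1 n)" "homogeneous_vec (e1 n) (e1 (Suc n) c) (\<delta>1 n (unit_vec c))"
      if "c \<in> B1 (Suc n)" for n c
      using graded_complexD(2)[OF C1, of n] that by (auto simp: graded_hom_def)
    have g2: "\<delta>2 n (unit_vec c) \<in> free_module (B2 n)" "homogeneous_vec (e2 n) (e2 (Suc n) c) (\<delta>2 n (unit_vec c))"
      if "c \<in> B2 (Suc n)" for n c
      using graded_complexD(2)[OF C2, of n] that by (auto simp: graded_hom_def)
    have g\<phi>: "\<phi> n (unit_vec c) \<in> free_module (B1 n)" "homogeneous_vec (e1 n) (e2 n c + D) (\<phi> n (unit_vec c))"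
      if "c \<in> B2 n" for n c
      using \<phi>[of n] that by (auto simp: graded_hom_def)
    \<comment> \<open>\<open>cone_degree\<close> at 0 is constantly 0, and \<open>e1 0\<close>
      agrees with it on 0, the sole basis element of \<open>R\<close>.\<close>
    have deg0: "homogeneous_vec (\<lambda>_. 0) j f" if "f \<in> free_module (B1 0)" "homogeneous_vec (e1 0) j f" for j
      and f :: "nat \<Rightarrow>\<^sub>0 ('v, 'k) polynomial"
      using that B0 by (force simp: homogeneous_vec_def free_module_def)
    have "free_hom (?d n)" by (rule free_hom_cone_diff) (rule hom)+
    moreover have "?d n (unit_vec c) \<in> free_module (?B n) \<and>
        homogeneous_vec (?e n) (?e (Suc n) c + 0) (?d n (unit_vec c))" if c: "c \<in> ?B (Suc n)" for c
    proof -
      consider b where "c = 2 * b" "b \<in> B1 (Suc n)" | b where "c = Suc (2 * b)" "b \<in> B2 n"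
        using c by (auto simp: join_basis_def)
      then show ?thesis
      proof cases
        case 1
        have "?d n (unit_vec c) = (case n of 0 \<Rightarrow> \<delta>1 0 (unit_vec b) | Suc k \<Rightarrow> join (\<delta>1 n (unit_vec b)) 0)"
          using 1 by (cases n) (simp_all add: simps\<phi> module_hom.zero[OF hom(2)])
        then show ?thesis
          using 1 g1[of b n] deg0 B0(1)
          by (cases n) (simp_all add: free_module_join_basis homogeneous_vec_join homogeneous_vec_simps
              free.subspace_0[OF subspace_free_module])
      next
        case 2
        have "?d n (unit_vec c) = (case n of 0 \<Rightarrow> - \<phi> 0 (unit_vec b)
            | Suc k \<Rightarrow> join (- \<phi> n (unit_vec b)) (- \<delta>2 k (unit_vec b)))"
          using 2 by (cases n) (simp_all add: module_hom.zero[OF hom(1)])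
        then show ?thesis
          using 2 g\<phi>[of b n] g2[of b "n - 1"] deg0 B0(1)
          by (cases n) (simp_all add: free_module_join_basis homogeneous_vec_join homogeneous_vec_simps
              neg_in homogeneous_vec_shift)
      qed
    qed
    ultimately show ?thesis by (simp add: graded_hom_def)
  qed
  \<comment> \<open>A cycle whose image under \<open>\<phi>\<close> is a boundary is itself a
    boundary. In degree 0, where \<open>\<phi>\<close> is multiplication by \<open>m\<close> on
    \<open>R\<close>, this is the colon condition; above it, exactness of the second
    resolution.\<close>
  have exact2: "f \<in> \<delta>2 n ` free_module (B2 (Suc n))"
    if f: "f \<in> free_module (B2 n)" and g: "g \<in> free_module (B1 (Suc n))"
      and eq: "\<delta>1 n g = \<phi> n f" and z: "\<And>k. n = Suc k \<Longrightarrow> \<delta>2 k f = 0" for n f g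
  proof (cases n)
    case 0
    have "\<delta>1 0 g \<in> Poly_Mapping.single 0 ` I" using g 0 im1 by auto
    moreover have "f = Poly_Mapping.single 0 (Poly_Mapping.lookup f 0)"
      using f 0 B0(2) by (simp add: single_in_iff)
    then have "\<phi> 0 f = Poly_Mapping.single 0 (m * Poly_Mapping.lookup f 0)"
      unfolding \<phi>0 by (metis free.scale_scale scale_unit_vec)
    ultimately have "m * Poly_Mapping.lookup f 0 \<in> I" using eq 0 by (auto simp: inj_eq[OF inj_single])
    then have "Poly_Mapping.lookup f 0 \<in> J" by (simp add: colon)
    then show ?thesis
      unfolding 0 im2 using \<open>f = _\<close> by (rule rev_image_eqI)
  next
    case (Suc k)
    then show ?thesis using graded_complexD(5)[OF C2, of f k] f z by simp
  qed
  have exact: "?d (Suc n) ` free_module (?B (Suc (Suc n))) = {h \<in> free_module (?B (Suc n)). ?d n h = 0}" for n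
  proof (intro equalityI subsetI)
    fix w assume "w \<in> ?d (Suc n) ` free_module (?B (Suc (Suc n)))"
    then obtain h where h: "w = ?d (Suc n) h" "h \<in> free_module (?B (Suc (Suc n)))" by blast
    define g f where "g = evens h" and "f = odds h"
    have gf: "g \<in> free_module (B1 (Suc (Suc n)))" "f \<in> free_module (B2 (Suc n))"
      using h(2) by (simp_all add: g_def f_def free_module_join_basis)
    have w: "w = join (\<delta>1 (Suc n) g - \<phi> (Suc n) f) (- \<delta>2 n f)"
      by (simp add: h(1) g_def f_def)
    have "w \<in> free_module (?B (Suc n))"
      using gf by (simp add: w free_module_join_basis diff_in neg_in in1 in2 in\<phi>)
    moreover have "\<delta>1 n (\<delta>1 (Suc n) g - \<phi> (Suc n) f) = - \<phi> n (\<delta>2 n f)"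
      by (simp add: simps1 graded_complexD(4)[OF C1 gf(1)] chain[OF gf(2)])
    then have "?d n w = 0"
      using graded_complexD(4)[OF C2] gf(2)
      by (cases n) (simp_all add: w simps\<phi> simps2)
    ultimately show "w \<in> {h \<in> free_module (?B (Suc n)). ?d n h = 0}" by simp
  next
    fix w assume "w \<in> {h \<in> free_module (?B (Suc n)). ?d n h = 0}"
    then have w: "w \<in> free_module (?B (Suc n))" "?d n w = 0" by auto
    define g f where "g = evens w" and "f = odds w"
    have gf: "g \<in> free_module (B1 (Suc n))" "f \<in> free_module (B2 n)"
      using w(1) by (simp_all add: g_def f_def free_module_join_basis)
    have eq: "\<delta>1 n g = \<phi> n f" using w(2) by (cases n) (simp_all add: g_def f_def)
    have z: "\<delta>2 k f = 0" if "n = Suc k" for k using w(2) that by (simp add: f_def)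
    obtain f' where f': "f' \<in> free_module (B2 (Suc n))" "f = \<delta>2 n f'"
      using exact2[OF gf(2,1) eq z] by blast
    have "\<delta>1 n (g - \<phi> (Suc n) f') = 0"
      by (simp add: simps1 chain[OF f'(1)] eq f'(2))
    moreover have "g - \<phi> (Suc n) f' \<in> free_module (B1 (Suc n))"
      by (intro diff_in gf(1) in\<phi> f'(1))
    ultimately obtain g' where g': "g' \<in> free_module (B1 (Suc (Suc n)))" "g - \<phi> (Suc n) f' = \<delta>1 (Suc n) g'"
      using graded_complexD(5)[OF C1] by blast
    \<comment> \<open>The odd part of the preimage is \<open>- f'\<close>, to undo the sign in front
      of \<open>\<delta>2\<close> in the cone.\<close>
    have "g = \<delta>1 (Suc n) g' - \<phi> (Suc n) (- f')" using g'(2) by (simp add: simps\<phi> algebra_simps)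
    then have "w = ?d (Suc n) (join g' (- f'))"
      using join_evens_odds[of w] f'(2) by (simp add: simps2 flip: g_def f_def)
    moreover have "join g' (- f') \<in> free_module (?B (Suc (Suc n)))"
      using g' f' by (simp add: free_module_join_basis neg_in)
    ultimately show "w \<in> ?d (Suc n) ` free_module (?B (Suc (Suc n)))" by blast
  qed
  have image: "?d 0 ` free_module (?B 1) = Poly_Mapping.single 0 ` {p + r * m |p r. p \<in> I}"
  proof (intro equalityI subsetI)
    fix w assume "w \<in> ?d 0 ` free_module (?B 1)"
    then obtain h where h: "w = ?d 0 h" "h \<in> free_module (join_basis (B1 (Suc 0)) (B2 0))" by auto
    have "\<delta>1 0 (evens h) \<in> Poly_Mapping.single 0 ` I"
      using h(2) im1 by (auto simp: free_module_join_basis)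
    then obtain p where p: "p \<in> I" "\<delta>1 0 (evens h) = Poly_Mapping.single 0 p" by blast
    have "odds h = Poly_Mapping.single 0 (Poly_Mapping.lookup (odds h) 0)"
      using h(2) B0(2) by (simp add: free_module_join_basis flip: single_in_iff)
    then have "\<phi> 0 (odds h) = Poly_Mapping.single 0 (m * Poly_Mapping.lookup (odds h) 0)"
      unfolding \<phi>0 by (metis free.scale_scale scale_unit_vec)
    then have "w = Poly_Mapping.single 0 (p + (- Poly_Mapping.lookup (odds h) 0) * m)"
      by (simp add: h(1) p(2) single_diff mult.commute)
    then show "w \<in> Poly_Mapping.single 0 ` {p + r * m |p r. p \<in> I}" using p(1) by blast
  next
    fix w assume "w \<in> Poly_Mapping.single (0::nat) ` {p + r * m |p r. p \<in> I}"
    then obtain p r where pr: "p \<in> I" "w = Poly_Mapping.single 0 (p + r * m)" by blast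
    then obtain g where g: "g \<in> free_module (B1 (Suc 0))" "\<delta>1 0 g = Poly_Mapping.single 0 p"
      using im1 by (metis image_iff imageI)
    have "scale m (Poly_Mapping.single 0 (- r)) = (Poly_Mapping.single 0 (- (r * m)) :: nat \<Rightarrow>\<^sub>0 ('v, 'k) polynomial)"
      by (rule poly_mapping_eqI) (simp add: lookup_single when_def mult.commute)
    then have "w = ?d 0 (join g (Poly_Mapping.single 0 (- r)))"
      by (simp add: pr(2) g(2) \<phi>0 single_add single_uminus)
    moreover have "join g (Poly_Mapping.single 0 (- r)) \<in> free_module (?B 1)"
      using g(1) B0(2) by (simp add: free_module_join_basis)
    ultimately show "w \<in> ?d 0 ` free_module (?B 1)" by blast
  qed
  show ?thesis
    using fin gr exact image by (simp add: quotient_resolution_def graded_complex_def)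
qed

section \<open>Splitting of the reduced cone\<close>

lemma kvec_dim_join:
  fixes A A' :: "(nat \<Rightarrow>\<^sub>0 'k::field) set"
  assumes "free.subspace A" "free.subspace A'" "A \<subseteq> free.span T" "finite T" "A' \<subseteq> free.span T'" "finite T'"
  shows "kvec.dim {h. evens h \<in> A \<and> odds h \<in> A'} = kvec.dim A + kvec.dim A'"
proof -
  have basis: "\<exists>S. finite S \<and> free.independent S \<and> free.span S = A \<and> card S = kvec.dim A"
    if "free.subspace A" "A \<subseteq> free.span T" "finite T" for A T :: "(nat \<Rightarrow>\<^sub>0 'k) set"
  proof -
    obtain S where S: "S \<subseteq> A" "free.independent S" "A \<subseteq> free.span S" "card S = kvec.dim A"
      using kvec.basis_exists by blast
    then show ?thesis
      using kvec.card_le_dim_of_independent[OF S(2,1) that(2,3)] free.span_subspace[OF S(1,3) that(1)] by blast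
  qed
  obtain S where S: "finite S" "free.independent S" "free.span S = A" "card S = kvec.dim A"
    using basis[OF assms(1,3,4)] by blast
  obtain S' where S': "finite S'" "free.independent S'" "free.span S' = A'" "card S' = kvec.dim A'"
    using basis[OF assms(2,5,6)] by blast
  define l r where "l = (\<lambda>g. join g (0 :: nat \<Rightarrow>\<^sub>0 'k))" and "r = (\<lambda>f. join (0 :: nat \<Rightarrow>\<^sub>0 'k) f)"
  have homs: "free_hom l" "free_hom r"
    by (simp_all add: l_def r_def module_hom_iff free.module_axioms join_add join_scale)
  interpret l: module_hom scale scale l by (rule homs)
  interpret r: module_hom scale scale r by (rule homs)
  have inj: "inj l" "inj r" by (auto simp: inj_def l_def r_def)
  have spans: "free.span (l ` S) = l ` A" "free.span (r ` S') = r ` A'"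
    using l.span_image[of S] r.span_image[of S'] S(3) S'(3) by auto
  have "l 0 = 0" "r 0 = 0" by (rule l.zero, rule r.zero)
  then have "0 \<in> l ` A" "0 \<in> r ` A'"
    using free.subspace_0[OF assms(1)] free.subspace_0[OF assms(2)] by (metis imageI)+
  moreover have "x = 0" if "x \<in> l ` A" "x \<in> r ` A'" for x
    using that by (auto simp: l_def r_def)
  ultimately have "free.span (l ` S) \<inter> free.span (r ` S') = {0}"
    unfolding spans by blast
  from kvec.independent_Un_disjoint_spans[OF
      l.independent_injective_image[OF S(2)] r.independent_injective_image[OF S'(2)] this finite_imageI[OF S'(1)]]
  have ind: "free.independent (l ` S \<union> r ` S')" "l ` S \<inter> r ` S' = {}"
    using inj by (auto intro: inj_on_subset)
  have "free.span (l ` S \<union> r ` S') = {x + y |x y. x \<in> l ` A \<and> y \<in> r ` A'}"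
    by (simp add: free.span_Un spans)
  also have "\<dots> = {h. evens h \<in> A \<and> odds h \<in> A'}"
  proof (intro equalityI subsetI)
    fix h assume "h \<in> {h. evens h \<in> A \<and> odds h \<in> A'}"
    moreover have "h = l (evens h) + r (odds h)" by (simp add: l_def r_def join_add)
    ultimately show "h \<in> {x + y |x y. x \<in> l ` A \<and> y \<in> r ` A'}" by blast
  qed (auto simp: l_def r_def join_add)
  finally have "kvec.dim {h. evens h \<in> A \<and> odds h \<in> A'} = card (l ` S \<union> r ` S')"
    using kvec.dim_span_eq_card_independent[OF ind(1)] by simp
  also have "\<dots> = card S + card S'"
    using S(1) S'(1) ind(2) inj by (simp add: card_Un_disjoint card_image inj_on_subset)
  finally show ?thesis using S(4) S'(4) by simp
qed

text \<open>Once \<open>\<phi>\<close> reduces to 0, the reduced differential of the cone is block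
  diagonal, so cycles and boundaries are direct sums of those of the two complexes.\<close>

lemma residue_homology_dim_cone:
  fixes \<delta>1 \<delta>2 :: "nat \<Rightarrow> (nat \<Rightarrow>\<^sub>0 ('v, 'k::field) polynomial) \<Rightarrow> (nat \<Rightarrow>\<^sub>0 ('v, 'k) polynomial)"
  assumes C1: "graded_complex B1 e1 \<delta>1" and C2: "graded_complex B2 e2 \<delta>2"
    and minimal: "\<And>n f. reduce (\<phi> n f) = 0"
  shows "residue_homology_dim (cone_basis B1 B2) (cone_degree D e1 e2) (cone_diff \<delta>1 \<delta>2 \<phi>) (Suc n) j =
    residue_homology_dim B1 e1 \<delta>1 (Suc n) j + residue_homology_dim B2 e2 \<delta>2 n (j - D)"
proof -
  let ?B = "cone_basis B1 B2" and ?e = "cone_degree D e1 e2" and ?d = "cone_diff \<delta>1 \<delta>2 \<phi>"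
  have ev: "evens (const_vec v) = const_vec (evens v)" and od: "odds (const_vec v) = const_vec (odds v)"
    for v :: "nat \<Rightarrow>\<^sub>0 'k"
    by (rule poly_mapping_eqI, simp add: evens.rep_eq odds.rep_eq)+
  have red: "reduce (join g f) = join (reduce g) (reduce f)" for g f :: "nat \<Rightarrow>\<^sub>0 ('v, 'k) polynomial"
    by (rule poly_mapping_eqI) (simp add: join.rep_eq)
  have d0: "tensor_residue (?d 0) v = tensor_residue (\<delta>1 0) (evens v)" for v
    by (simp add: tensor_residue_eq ev minimal)
  have dSuc: "tensor_residue (?d (Suc k)) v =
      join (tensor_residue (\<delta>1 (Suc k)) (evens v)) (- tensor_residue (\<delta>2 k) (odds v))" for k v
    by (simp add: tensor_residue_eq ev od red minimal)
  have free: "v \<in> free_module {c \<in> ?B (Suc k). ?e (Suc k) c = j} \<longleftrightarrow>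
      evens v \<in> free_module {c \<in> B1 (Suc k). e1 (Suc k) c = j} \<and>
      odds v \<in> free_module {c \<in> B2 k. e2 k c = j - D}" for k and v :: "nat \<Rightarrow>\<^sub>0 'k"
    by (simp add: join_basis_restrict free_module_join_basis eq_diff_eq)
  have cyc: "residue_cycles ?B ?e ?d (Suc n) j =
      {v. evens v \<in> residue_cycles B1 e1 \<delta>1 (Suc n) j \<and> odds v \<in> residue_cycles B2 e2 \<delta>2 n (j - D)}"
    using free[of _ n] d0 dSuc by (cases n) (auto simp: residue_cycles_def simp del: cone_simps)
  have bnd: "residue_boundaries ?B ?e ?d (Suc n) j =
      {v. evens v \<in> residue_boundaries B1 e1 \<delta>1 (Suc n) j \<and> odds v \<in> residue_boundaries B2 e2 \<delta>2 n (j - D)}"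
  proof (intro equalityI subsetI)
    fix w assume "w \<in> residue_boundaries ?B ?e ?d (Suc n) j"
    then obtain v where v: "v \<in> free_module {c \<in> ?B (Suc (Suc n)). ?e (Suc (Suc n)) c = j}"
        "w = tensor_residue (?d (Suc n)) v" by (auto simp: residue_boundaries_def)
    have "odds w \<in> residue_boundaries B2 e2 \<delta>2 n (j - D)"
      unfolding v(2) dSuc odds_join
      by (rule free.subspace_neg[OF residue_boundaries_subspace[OF C2]])
        (use v(1) free in \<open>auto simp: residue_boundaries_def\<close>)
    moreover have "evens w \<in> residue_boundaries B1 e1 \<delta>1 (Suc n) j"
      unfolding v(2) dSuc evens_join using v(1) free by (auto simp: residue_boundaries_def)
    ultimately show "w \<in> {v. evens v \<in> residue_boundaries B1 e1 \<delta>1 (Suc n) j \<and>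
        odds v \<in> residue_boundaries B2 e2 \<delta>2 n (j - D)}" by simp
  next
    fix w assume "w \<in> {v. evens v \<in> residue_boundaries B1 e1 \<delta>1 (Suc n) j \<and>
        odds v \<in> residue_boundaries B2 e2 \<delta>2 n (j - D)}"
    then obtain g f where g: "g \<in> free_module {c \<in> B1 (Suc (Suc n)). e1 (Suc (Suc n)) c = j}"
        "evens w = tensor_residue (\<delta>1 (Suc n)) g"
      and f: "f \<in> free_module {c \<in> B2 (Suc n). e2 (Suc n) c = j - D}" "odds w = tensor_residue (\<delta>2 n) f"
      by (auto simp: residue_boundaries_def)
    interpret t: module_hom scale scale "tensor_residue (\<delta>2 n)"
      by (rule free_hom_tensor_residue[OF graded_complexD(6)[OF C2]])
    have "w = tensor_residue (?d (Suc n)) (join g (- f))"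
      using join_evens_odds[of w] g(2) f(2) by (simp add: dSuc t.neg del: cone_simps)
    moreover have "join g (- f) \<in> free_module {c \<in> ?B (Suc (Suc n)). ?e (Suc (Suc n)) c = j}"
      using free g(1) f(1) free.subspace_neg[OF subspace_free_module] by simp
    ultimately show "w \<in> residue_boundaries ?B ?e ?d (Suc n) j"
      by (auto simp: residue_boundaries_def simp del: cone_simps)
  qed
  obtain T1 where T1: "finite T1" "residue_cycles B1 e1 \<delta>1 (Suc n) j \<subseteq> free.span T1"
    using residue_cycles_finite_span[OF C1] by blast
  obtain T2 where T2: "finite T2" "residue_cycles B2 e2 \<delta>2 n (j - D) \<subseteq> free.span T2"
    using residue_cycles_finite_span[OF C2] by blast
  note b1 = residue_boundaries_subset_cycles[OF C1, of "Suc n" j]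
    and b2 = residue_boundaries_subset_cycles[OF C2, of n "j - D"]
  have "kvec.dim (residue_cycles ?B ?e ?d (Suc n) j) =
      kvec.dim (residue_cycles B1 e1 \<delta>1 (Suc n) j) + kvec.dim (residue_cycles B2 e2 \<delta>2 n (j - D))"
    unfolding cyc
    by (rule kvec_dim_join[OF residue_cycles_subspace[OF C1] residue_cycles_subspace[OF C2] T1(2,1) T2(2,1)])
  moreover have "kvec.dim (residue_boundaries ?B ?e ?d (Suc n) j) =
      kvec.dim (residue_boundaries B1 e1 \<delta>1 (Suc n) j) + kvec.dim (residue_boundaries B2 e2 \<delta>2 n (j - D))"
    unfolding bnd
    by (rule kvec_dim_join[OF residue_boundaries_subspace[OF C1] residue_boundaries_subspace[OF C2]
          subset_trans[OF b1 T1(2)] T1(1) subset_trans[OF b2 T2(2)] T2(1)])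
  \<comment> \<open>Each summand has at most as many dimensions of boundaries as of cycles, so the
    natural differences add up.\<close>
  ultimately show ?thesis
    using kvec.dim_subspace_mono[OF b1 T1(2,1)] kvec.dim_subspace_mono[OF b2 T2(2,1)]
    by (simp add: residue_homology_dim_def)
qed

section \<open>Squarefree monomial ideals\<close>

definition monomial_ideal :: "'v set set \<Rightarrow> ('v, 'k::comm_ring_1) polynomial set" where
  "monomial_ideal \<G> = module.span (*) (face_monomial ` \<G>)"

definition face_exponent :: "'v set \<Rightarrow> ('v \<Rightarrow>\<^sub>0 nat)" where
  "face_exponent F = (\<Sum>x\<in>F. Poly_Mapping.single x 1)"

lemma face_monomial_eq: "face_monomial F = Poly_Mapping.single (face_exponent F) 1"
  unfolding face_monomial_def face_exponent_def
  by (induction F rule: infinite_finite_induct) (auto simp: variable_def mult_single)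

lemma lookup_face_exponent:
  "Poly_Mapping.lookup (face_exponent (F :: 'v::finite set)) x = (if x \<in> F then 1 else 0)"
proof -
  have "Poly_Mapping.lookup (face_exponent F) x = (\<Sum>y\<in>F. if y = x then 1 else 0)"
    by (simp add: face_exponent_def lookup_sum lookup_single when_def)
  then show ?thesis by simp
qed

lemma keys_exp_add: "Poly_Mapping.keys (m + m' :: 'v \<Rightarrow>\<^sub>0 nat) = Poly_Mapping.keys m \<union> Poly_Mapping.keys m'"
  by (auto simp: in_keys_iff lookup_add)

lemma keys_face_exponent [simp]: "Poly_Mapping.keys (face_exponent (F :: 'v::finite set)) = F"
  by (auto simp: in_keys_iff lookup_face_exponent split: if_splits)

lemma exp_degree_face_exponent: "exp_degree (face_exponent (F :: 'v::finite set)) = int (card F)"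
  by (simp add: exp_degree_def lookup_face_exponent)

lemma homogeneous_face_monomial: "homogeneous (int (card F)) (face_monomial (F :: 'v::finite set))"
  by (auto simp: homogeneous_iff poly_degrees_in_def face_monomial_eq exp_degree_face_exponent)

lemma lookup_single_mult:
  fixes r :: "('v, 'k::comm_ring_1) polynomial"
  shows "Poly_Mapping.lookup (Poly_Mapping.single s a * r) (s + t) = a * Poly_Mapping.lookup r t"
proof -
  have "Poly_Mapping.lookup (Poly_Mapping.single s a * r) (s + t) =
      (\<Sum>l. (a * (\<Sum>q. Poly_Mapping.lookup r q when s + t = l + q)) when s = l)"
    by (simp only: lookup_mult lookup_single when_mult)
  also have "\<dots> = a * (\<Sum>q. Poly_Mapping.lookup r q when s + t = s + q)" by (simp only: Sum_any_when_equal')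
  also have "\<dots> = a * (\<Sum>q. Poly_Mapping.lookup r q when t = q)" by simp
  finally show ?thesis by (simp only: Sum_any_when_equal')
qed

text \<open>A squarefree monomial divides another monomial as soon as its variables occur there.
  Membership can therefore be tested term by term on supports alone.\<close>

lemma monomial_ideal_iff:
  fixes p :: "('v::finite, 'k::comm_ring_1) polynomial"
  shows "p \<in> monomial_ideal \<G> \<longleftrightarrow> (\<forall>t\<in>Poly_Mapping.keys p. \<exists>G\<in>\<G>. G \<subseteq> Poly_Mapping.keys t)"
proof
  assume "p \<in> monomial_ideal \<G>"
  then show "\<forall>t\<in>Poly_Mapping.keys p. \<exists>G\<in>\<G>. G \<subseteq> Poly_Mapping.keys t"
    unfolding monomial_ideal_def
  proof (induction rule: module.span_induct_alt[OF module_mult, consumes 1])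
    case 1
    show ?case by simp
  next
    case (2 c x y)
    show ?case
    proof
      fix t assume "t \<in> Poly_Mapping.keys (c * x + y)"
      then consider "t \<in> Poly_Mapping.keys (c * x)" | "t \<in> Poly_Mapping.keys y"
        using keys_add[of "c * x" y] by blast
      then show "\<exists>G\<in>\<G>. G \<subseteq> Poly_Mapping.keys t"
      proof cases
        case 1
        obtain G where G: "G \<in> \<G>" "x = face_monomial G" using 2 by blast
        obtain a b where "t = a + b" "b \<in> Poly_Mapping.keys x" using 1 keys_mult[of c x] by blast
        then have "t = a + face_exponent G" by (auto simp: G face_monomial_eq split: if_splits)
        then have "G \<subseteq> Poly_Mapping.keys t" by (simp add: keys_exp_add)
        then show ?thesis using G(1) by blast
      next
        case 2
        then show ?thesis using \<open>\<forall>t\<in>Poly_Mapping.keys y. _ t\<close> by blast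
      qed
    qed
  qed
next
  assume *: "\<forall>t\<in>Poly_Mapping.keys p. \<exists>G\<in>\<G>. G \<subseteq> Poly_Mapping.keys t"
  have p: "p = (\<Sum>t\<in>Poly_Mapping.keys p. Poly_Mapping.single t (Poly_Mapping.lookup p t))"
  proof (rule poly_mapping_eqI)
    fix s
    have "(\<Sum>t\<in>Poly_Mapping.keys p. Poly_Mapping.lookup (Poly_Mapping.single t (Poly_Mapping.lookup p t)) s) =
        (\<Sum>t\<in>Poly_Mapping.keys p. if t = s then Poly_Mapping.lookup p t else 0)"
      by (intro sum.cong) (auto simp: lookup_single)
    then show "Poly_Mapping.lookup p s =
        Poly_Mapping.lookup (\<Sum>t\<in>Poly_Mapping.keys p. Poly_Mapping.single t (Poly_Mapping.lookup p t)) s"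
      by (simp add: lookup_sum in_keys_iff)
  qed
  have "Poly_Mapping.single t a \<in> monomial_ideal \<G>" if "t \<in> Poly_Mapping.keys p" for t and a :: 'k
  proof -
    obtain G where G: "G \<in> \<G>" "G \<subseteq> Poly_Mapping.keys t" using * \<open>t \<in> _\<close> by blast
    \<comment> \<open>The subtraction of exponents is truncated in general; here every vertex of
      \<open>G\<close> has exponent at least 1 in \<open>t\<close>.\<close>
    have "t = (t - face_exponent G) + face_exponent G"
    proof (rule poly_mapping_eqI)
      fix x
      have "x \<in> G \<Longrightarrow> Poly_Mapping.lookup t x \<noteq> 0" using G(2) by (auto simp: in_keys_iff)
      then show "Poly_Mapping.lookup t x = Poly_Mapping.lookup ((t - face_exponent G) + face_exponent G) x"
        by (auto simp: lookup_add lookup_minus lookup_face_exponent)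
    qed
    then have "Poly_Mapping.single t a = Poly_Mapping.single (t - face_exponent G) a * face_monomial G"
      by (simp add: face_monomial_eq mult_single)
    then show ?thesis
      unfolding monomial_ideal_def using G(1)
      by (simp add: module.span_scale[OF module_mult] module.span_base[OF module_mult])
  qed
  then have "(\<Sum>t\<in>Poly_Mapping.keys p. Poly_Mapping.single t (Poly_Mapping.lookup p t)) \<in> monomial_ideal \<G>"
    unfolding monomial_ideal_def by (rule module.span_sum[OF module_mult])
  then show "p \<in> monomial_ideal \<G>" using p by simp
qed

text \<open>Multiplication by the monomial of \<open>L\<close> enlarges each support by
  \<open>L\<close>, and \<open>G\<close> fits into \<open>L\<close> together with a support exactly
  if \<open>G - L\<close> fits into that support.\<close>

lemma monomial_ideal_colon:
  fixes r :: "('v::finite, 'k::comm_ring_1) polynomial"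
  shows "face_monomial L * r \<in> monomial_ideal \<G> \<longleftrightarrow> r \<in> monomial_ideal ((\<lambda>G. G - L) ` \<G>)"
proof
  assume L: "face_monomial L * r \<in> monomial_ideal \<G>"
  show "r \<in> monomial_ideal ((\<lambda>G. G - L) ` \<G>)"
    unfolding monomial_ideal_iff
  proof
    fix t assume "t \<in> Poly_Mapping.keys r"
    then have "Poly_Mapping.lookup (face_monomial L * r) (face_exponent L + t) \<noteq> 0"
      by (simp only: face_monomial_eq lookup_single_mult mult_1 in_keys_iff not_False_eq_True)
    then have "face_exponent L + t \<in> Poly_Mapping.keys (face_monomial L * r)" by (rule in_keys_iff[THEN iffD2])
    from L[unfolded monomial_ideal_iff, rule_format, OF this]
    obtain G where G: "G \<in> \<G>" "G \<subseteq> L \<union> Poly_Mapping.keys t"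
      unfolding keys_exp_add keys_face_exponent by (rule bexE)
    have "G - L \<subseteq> Poly_Mapping.keys t" using G(2) by blast
    then show "\<exists>G\<in>(\<lambda>G. G - L) ` \<G>. G \<subseteq> Poly_Mapping.keys t"
      using G(1) by (intro bexI[of _ "G - L"] imageI)
  qed
next
  assume r: "r \<in> monomial_ideal ((\<lambda>G. G - L) ` \<G>)"
  show "face_monomial L * r \<in> monomial_ideal \<G>"
    unfolding monomial_ideal_iff
  proof
    fix s assume "s \<in> Poly_Mapping.keys (face_monomial L * r)"
    from subsetD[OF keys_mult this] obtain a t where t: "s = a + t"
        "a \<in> Poly_Mapping.keys (face_monomial L :: ('v, 'k) polynomial)" "t \<in> Poly_Mapping.keys r"
      by (elim CollectE exE conjE)
    have a: "Poly_Mapping.keys a = L" using t(2) by (simp add: face_monomial_eq)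
    obtain G where G: "G \<in> \<G>" "G - L \<subseteq> Poly_Mapping.keys t"
      using r[unfolded monomial_ideal_iff, rule_format, OF t(3)] by blast
    have "G \<subseteq> Poly_Mapping.keys s"
      unfolding t(1) keys_exp_add a using G(2) by blast
    then show "\<exists>G\<in>\<G>. G \<subseteq> Poly_Mapping.keys s" using G(1) by blast
  qed
qed

lemma constant_coeff_monomial_ideal:
  fixes p :: "('v::finite, 'k::comm_ring_1) polynomial"
  assumes "{} \<notin> \<G>" "p \<in> monomial_ideal \<G>"
  shows "constant_coeff p = 0"
proof (rule ccontr)
  assume "constant_coeff p \<noteq> 0"
  then have "0 \<in> Poly_Mapping.keys p" by (simp add: constant_coeff_def in_keys_iff)
  then obtain G where "G \<in> \<G>" "G \<subseteq> Poly_Mapping.keys (0 :: 'v \<Rightarrow>\<^sub>0 nat)"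
    using assms(2) unfolding monomial_ideal_iff by blast
  then show False using assms(1) by simp
qed

section \<open>Passing to minimal generators\<close>

lemma minimal_sets_below:
  fixes \<S> :: "'v::finite set set"
  assumes "G \<in> \<S>"
  obtains H where "H \<in> minimal_sets \<S>" "H \<subseteq> G"
proof -
  obtain H where H: "H \<in> \<S>" "H \<subseteq> G" "\<And>K. K \<in> \<S> \<Longrightarrow> K \<subseteq> H \<Longrightarrow> H = K"
    using finite_has_minimal2[of \<S> G] assms by auto
  show thesis by (rule that[of H]) (use H in \<open>auto simp: minimal_sets_def\<close>)
qed

text \<open>Only the collection of supports containing some generator matters, and every generator
  contains a minimal one. The part \<open>\<C>\<close> stays untouched while the other part is
  minimised.\<close>

lemma monomial_ideal_minimal_sets:
  "monomial_ideal (\<C> \<union> minimal_sets \<S> :: 'v::finite set set) =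
     (monomial_ideal (\<C> \<union> \<S>) :: ('v, 'k::comm_ring_1) polynomial set)"
proof -
  have "(\<exists>G\<in>\<C> \<union> minimal_sets \<S>. G \<subseteq> K) \<longleftrightarrow> (\<exists>G\<in>\<C> \<union> \<S>. G \<subseteq> K)" for K
  proof
    assume "\<exists>G\<in>\<C> \<union> \<S>. G \<subseteq> K"
    then show "\<exists>G\<in>\<C> \<union> minimal_sets \<S>. G \<subseteq> K"
    proof
      fix G assume G: "G \<in> \<C> \<union> \<S>" "G \<subseteq> K"
      show ?thesis
      proof (cases "G \<in> \<S>")
        case True
        then obtain H where "H \<in> minimal_sets \<S>" "H \<subseteq> G" by (rule minimal_sets_below)
        with G(2) show ?thesis by blast
      qed (use G in blast)
    qed
  qed (auto simp: minimal_sets_def)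
  then show ?thesis by (intro set_eqI) (simp only: monomial_ideal_iff)
qed

section \<open>Existence of resolutions and the Betti numbers of one added generator\<close>

definition has_resolution :: "('v, 'k::comm_ring_1) polynomial set \<Rightarrow> bool" where
  "has_resolution I \<longleftrightarrow> (\<exists>B e \<delta>. quotient_resolution I B e \<delta>)"

lemma monomial_ideal_empty [simp]: "monomial_ideal {} = {0}"
  by (simp add: monomial_ideal_def module.span_empty[OF module_mult])

lemma quotient_resolution_zero:
  "quotient_resolution {0 :: ('v, 'k::comm_ring_1) polynomial} (\<lambda>n. if n = 0 then {0} else {}) (\<lambda>_ _. 0) (\<lambda>_ _. 0)"
proof -
  have "free_module {} = {0 :: nat \<Rightarrow>\<^sub>0 ('v, 'k) polynomial}" by (auto simp: free_module_def)
  then show ?thesis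
    by (auto simp: quotient_resolution_def graded_complex_def graded_hom_zero)
qed

lemma betti_zero_ideal:
  "betti {0 :: ('v, 'k::field) polynomial} i j = (if i = -1 \<and> j = 0 then 1 else 0)"
proof (cases "i \<ge> 0")
  case True
  define n where "n = Suc (nat i)"
  have fm0: "free_module {} = {0 :: nat \<Rightarrow>\<^sub>0 'k}" by (auto simp: free_module_def)
  have C: "graded_complex (\<lambda>n. if n = 0 then {0} else {}) (\<lambda>_ _. 0)
      (\<lambda>_ _. 0 :: nat \<Rightarrow>\<^sub>0 ('v, 'k) polynomial)"
    using quotient_resolution_zero unfolding quotient_resolution_def by (rule conjunct1)
  have "residue_cycles (\<lambda>n. if n = 0 then {0} else {}) (\<lambda>_ _. 0)
      (\<lambda>_ _. 0 :: nat \<Rightarrow>\<^sub>0 ('v, 'k) polynomial) n j \<subseteq> {0}"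
    using residue_cycles_subset[of "\<lambda>n. if n = 0 then {0} else {}" _ _ n j] fm0 by (auto simp: n_def)
  moreover have "0 \<in> residue_cycles (\<lambda>n. if n = 0 then {0} else {}) (\<lambda>_ _. 0)
      (\<lambda>_ _. 0 :: nat \<Rightarrow>\<^sub>0 ('v, 'k) polynomial) n j"
    by (intro free.subspace_0 residue_cycles_subspace C)
  ultimately have "residue_cycles (\<lambda>n. if n = 0 then {0} else {}) (\<lambda>_ _. 0)
      (\<lambda>_ _. 0 :: nat \<Rightarrow>\<^sub>0 ('v, 'k) polynomial) n j = {0}" by blast
  then have "betti {0 :: ('v, 'k) polynomial} (int n - 1) j = 0"
    by (subst betti_eq[OF quotient_resolution_zero]) (simp_all add: residue_homology_dim_def)
  then show ?thesis using True by (simp add: n_def)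
qed (simp add: betti_def)

lemma graded_hom_scale:
  assumes "homogeneous D p"
  shows "graded_hom D B e B e (scale p)"
  unfolding graded_hom_def
proof (intro conjI ballI)
  show "free_hom (scale p)"
    by (rule free.module_hom_scale_self)
  fix c assume c: "c \<in> B"
  show "scale p (unit_vec c) \<in> free_module B"
    unfolding scale_unit_vec using c by (rule single_in_free_module)
  have "homogeneous_vec e (e c + D) (Poly_Mapping.single c p)"
    unfolding homogeneous_vec_def
  proof
    fix c' assume "c' \<in> Poly_Mapping.keys (Poly_Mapping.single c p)"
    then have "c' = c" by (simp split: if_splits)
    then show "homogeneous (e c + D - e c') (Poly_Mapping.lookup (Poly_Mapping.single c p) c')"
      using assms by simp
  qed
  then show "homogeneous_vec e (e c + D) (scale p (unit_vec c))" by (simp only: scale_unit_vec)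
qed

text \<open>
  The generator \<open>m = x m'\<close> of a face \<open>L\<close> with a free vertex \<open>x\<close>: multiplication by \<open>m'\<close> already maps
  \<open>(I : m)\<close> into \<open>I\<close>, so the chain map of the mapping cone may be taken divisible by \<open>x\<close>.  It vanishes
  modulo the variables, and the cone splits after tensoring with the residue field.
\<close>

lemma betti_insert_free_vertex:
  fixes \<G> :: "'v::finite set set"
  assumes res: "has_resolution (monomial_ideal \<G> :: ('v, 'k::field) polynomial set)"
    "has_resolution (monomial_ideal ((\<lambda>G. G - L) ` \<G>) :: ('v, 'k) polynomial set)"
    and x: "x \<in> L" "\<And>G. G \<in> \<G> \<Longrightarrow> x \<notin> G" and sub: "\<And>G. G \<in> \<G> \<Longrightarrow> \<not> G \<subseteq> L"
  shows "has_resolution (monomial_ideal (insert L \<G>) :: ('v, 'k) polynomial set)"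
    and "betti (monomial_ideal (insert L \<G>) :: ('v, 'k) polynomial set) i j =
      betti (monomial_ideal \<G> :: ('v, 'k) polynomial set) i j +
      betti (monomial_ideal ((\<lambda>G. G - L) ` \<G>) :: ('v, 'k) polynomial set) (i - 1) (j - int (card L))"
proof -
  let ?I = "monomial_ideal \<G> :: ('v, 'k) polynomial set"
  let ?J = "monomial_ideal ((\<lambda>G. G - L) ` \<G>) :: ('v, 'k) polynomial set"
  let ?K = "monomial_ideal (insert L \<G>) :: ('v, 'k) polynomial set"
  obtain B1 e1 \<delta>1 where R1: "quotient_resolution ?I B1 e1 \<delta>1" using res(1) by (auto simp: has_resolution_def)
  obtain B2 e2 \<delta>2 where R2: "quotient_resolution ?J B2 e2 \<delta>2" using res(2) by (auto simp: has_resolution_def)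
  have C1: "graded_complex B1 e1 \<delta>1" and C2: "graded_complex B2 e2 \<delta>2"
    and B0: "B1 0 = {0}" "B2 0 = {0}" "e1 0 0 = 0" "e2 0 0 = 0"
    and im1: "\<delta>1 0 ` free_module (B1 1) = Poly_Mapping.single 0 ` ?I"
    and im2: "\<delta>2 0 ` free_module (B2 1) = Poly_Mapping.single 0 ` ?J"
    using R1 R2 by (auto simp: quotient_resolution_def)
  let ?m' = "face_monomial (L - {x}) :: ('v, 'k) polynomial"
  let ?x = "variable x :: ('v, 'k) polynomial"
  let ?D' = "int (card (L - {x}))"
  have m: "face_monomial L = ?x * ?m'"
    unfolding face_monomial_def by (rule prod.remove) (use x in auto)
  have D: "?D' + 1 = int (card L)"
    using card.remove[OF finite x(1)] by linarith
  have J: "?J = monomial_ideal ((\<lambda>G. G - (L - {x})) ` \<G>)"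
    using x(2) by (intro arg_cong[where f = monomial_ideal] image_cong) auto
  have gr0: "graded_hom ?D' (B2 0) (e2 0) (B1 0) (e1 0) (scale ?m')"
    using graded_hom_scale[OF homogeneous_face_monomial[of "L - {x}"], of "{0}" "e1 0"] B0
    by (simp add: graded_hom_def del: single_one scale_unit_vec)
  have im: "scale ?m' (\<delta>2 0 f) \<in> \<delta>1 0 ` free_module (B1 1)" if f: "f \<in> free_module (B2 1)" for f
  proof -
    obtain r where r: "r \<in> ?J" "\<delta>2 0 f = Poly_Mapping.single 0 r" 
      using im2 f by blast
    have "scale ?m' (\<delta>2 0 f) = Poly_Mapping.single 0 (?m' * r)"
      unfolding r(2) by (metis free.scale_scale scale_unit_vec)
    moreover have "?m' * r \<in> ?I" using r(1) unfolding J monomial_ideal_colon .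
    ultimately show ?thesis unfolding im1 by blast
  qed
  obtain \<phi>' where \<phi>': "\<phi>' 0 = scale ?m'" "\<And>n. graded_hom ?D' (B2 n) (e2 n) (B1 n) (e1 n) (\<phi>' n)"
      "\<And>n f. f \<in> free_module (B2 (Suc n)) \<Longrightarrow> \<delta>1 n (\<phi>' (Suc n) f) = \<phi>' n (\<delta>2 n f)"
    using lift_chain_map[OF C2 C1 gr0 im] by blast
  define \<phi> where "\<phi> n f = scale ?x (\<phi>' n f)" for n f
  have "homogeneous 1 ?x"
    using homogeneous_face_monomial[of "{x}"] by (simp add: face_monomial_def)
  from graded_hom_comp[OF \<phi>'(2) graded_hom_scale[OF this]]
  have \<phi>: "graded_hom (int (card L)) (B2 n) (e2 n) (B1 n) (e1 n) (\<phi> n)" for n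
    unfolding \<phi>_def D .
  have \<phi>0: "\<phi> 0 f = scale (face_monomial L) f" for f
    by (simp add: \<phi>_def \<phi>'(1) m)
  have chain: "\<delta>1 n (\<phi> (Suc n) f) = \<phi> n (\<delta>2 n f)" if "f \<in> free_module (B2 (Suc n))" for n f
    using \<phi>'(3)[OF that] by (simp add: \<phi>_def module_hom.scale[OF graded_complexD(6)[OF C1]])
  have "constant_coeff ?x = 0"
    using constant_coeff_homogeneous[OF \<open>homogeneous 1 ?x\<close>] by simp
  then have minimal: "reduce (\<phi> n f) = 0" for n f by (simp add: \<phi>_def)
  have K: "{p + r * face_monomial L |p r. p \<in> ?I} = ?K"
  proof -
    have "?K = {p. \<exists>r. p - r * face_monomial L \<in> ?I}"
      by (simp add: monomial_ideal_def module.span_insert[OF module_mult])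
    also have "\<dots> = {p + r * face_monomial L |p r. p \<in> ?I}"
    proof (intro equalityI subsetI)
      fix p assume "p \<in> {p. \<exists>r. p - r * face_monomial L \<in> ?I}"
      then obtain r where "p - r * face_monomial L \<in> ?I" by blast
      moreover have "p = (p - r * face_monomial L) + r * face_monomial L" by simp
      ultimately show "p \<in> {p + r * face_monomial L |p r. p \<in> ?I}" by blast
    next
      fix p assume "p \<in> {p + r * face_monomial L |p r. p \<in> ?I}"
      then obtain q r where "q \<in> ?I" "p = q + r * face_monomial L" by blast
      then have "p - r * face_monomial L \<in> ?I" by simp
      then show "p \<in> {p. \<exists>r. p - r * face_monomial L \<in> ?I}" by blast
    qed
    finally show ?thesis ..
  qed
  have RK: "quotient_resolution ?K (cone_basis B1 B2) (cone_degree (int (card L)) e1 e2) (cone_diff \<delta>1 \<delta>2 \<phi>)"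
    using quotient_resolution_cone[of ?I B1 e1 \<delta>1 ?J B2 e2 \<delta>2 \<phi> "face_monomial L",
        OF R1 R2 \<phi>0 monomial_ideal_colon \<phi> chain] unfolding K .
  then show "has_resolution ?K" by (auto simp: has_resolution_def)
  \<comment> \<open>All three ideals are thus without constant terms, as \<open>betti_eq\<close>
    requires.\<close>
  have "{} \<notin> \<G>" "{} \<notin> (\<lambda>G. G - L) ` \<G>" "{} \<notin> insert L \<G>"
    using sub x(1) by auto
  note cc = this[THEN constant_coeff_monomial_ideal]
  \<comment> \<open>Below index 0 only the convention is involved: at -1 both \<open>?K\<close> and
    \<open>?I\<close> follow it, and the index \<open>i - 1\<close> of the last term is too small to
    contribute.\<close>
  consider "i \<ge> 0" | "i = -1" | "i < -1" by linarith
  then show "betti ?K i j = betti ?I i j + betti ?J (i - 1) (j - int (card L))"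
  proof cases
    case 1
    define n where "n = nat i"
    have i: "i = int n" using 1 by (simp add: n_def)
    have "betti ?K (int (Suc n) - 1) j =
        residue_homology_dim (cone_basis B1 B2) (cone_degree (int (card L)) e1 e2) (cone_diff \<delta>1 \<delta>2 \<phi>) (Suc n) j"
      by (rule betti_eq[OF RK cc(3)])
    also have "\<dots> = residue_homology_dim B1 e1 \<delta>1 (Suc n) j + residue_homology_dim B2 e2 \<delta>2 n (j - int (card L))"
      by (rule residue_homology_dim_cone[OF C1 C2 minimal])
    also have "residue_homology_dim B1 e1 \<delta>1 (Suc n) j = betti ?I (int (Suc n) - 1) j"
      by (rule betti_eq[OF R1 cc(1), symmetric])
    also have "residue_homology_dim B2 e2 \<delta>2 n (j - int (card L)) = betti ?J (int n - 1) (j - int (card L))"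
      by (rule betti_eq[OF R2 cc(2), symmetric])
    finally show ?thesis by (simp add: i)
  qed (simp_all add: betti_def)
qed

section \<open>Families in which every subfamily has a leaf\<close>

definition family_leaf :: "'v set set \<Rightarrow> 'v set \<Rightarrow> bool" where
  "family_leaf \<S> L \<longleftrightarrow> L \<in> \<S> \<and>
     (\<S> = {L} \<or> (\<exists>G\<in>\<S>. G \<noteq> L \<and> (\<forall>H\<in>\<S>. H \<noteq> L \<longrightarrow> L \<inter> H \<subseteq> L \<inter> G)))"

text \<open>Quantifying over all nonempty subfamilies, connected or not, makes the property
  hereditary. The translation to and from complexes is done by \<open>forest_family_facets\<close>
  and \<open>simplicial_forest_generated\<close>.\<close>

definition forest_family :: "'v set set \<Rightarrow> bool" where
  "forest_family \<G> \<longleftrightarrow> (\<forall>\<S>\<subseteq>\<G>. \<S> \<noteq> {} \<longrightarrow> (\<exists>L. family_leaf \<S> L))"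

definition incomparable :: "'v set set \<Rightarrow> bool" where
  "incomparable \<G> \<longleftrightarrow> (\<forall>F\<in>\<G>. \<forall>G\<in>\<G>. F \<subseteq> G \<longrightarrow> F = G)"

lemma forest_family_mono: "forest_family \<G> \<Longrightarrow> \<H> \<subseteq> \<G> \<Longrightarrow> forest_family \<H>"
  unfolding forest_family_def by blast

lemma incomparable_mono: "incomparable \<G> \<Longrightarrow> \<H> \<subseteq> \<G> \<Longrightarrow> incomparable \<H>"
  unfolding incomparable_def by blast

lemma incomparable_minimal_sets: "incomparable (minimal_sets \<S>)"
  unfolding incomparable_def minimal_sets_def by blast

lemma minimal_sets_subset: "minimal_sets \<S> \<subseteq> \<S>"
  by (auto simp: minimal_sets_def)

text \<open>By incomparability \<open>L\<close> is not contained in the member \<open>G\<close> that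
  absorbs all its intersections; a vertex of \<open>L\<close> outside \<open>G\<close> then lies in
  no other member.\<close>

lemma family_leaf_free_vertex:
  assumes "family_leaf \<S> L" "incomparable \<S>" "{} \<notin> \<S>"
  obtains x where "x \<in> L" "\<And>G. G \<in> \<S> \<Longrightarrow> G \<noteq> L \<Longrightarrow> x \<notin> G"
proof (cases "\<S> = {L}")
  case True
  then have "L \<noteq> {}" using assms(3) by auto
  then obtain x where "x \<in> L" by blast
  then show thesis using True by (intro that[of x]) auto
next
  case False
  then obtain G where G: "L \<in> \<S>" "G \<in> \<S>" "G \<noteq> L" "\<And>H. H \<in> \<S> \<Longrightarrow> H \<noteq> L \<Longrightarrow> L \<inter> H \<subseteq> L \<inter> G"
    using assms(1) unfolding family_leaf_def by auto
  have "\<not> L \<subseteq> G" using assms(2) G(1-3) unfolding incomparable_def by auto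
  then obtain x where x: "x \<in> L" "x \<notin> G" by blast
  show thesis
  proof (rule that[OF x(1)])
    fix H assume "H \<in> \<S>" "H \<noteq> L"
    from G(4)[OF this] x show "x \<notin> H" by blast
  qed
qed

text \<open>Members may coincide after removal of \<open>A\<close>, so one preimage is chosen for
  each. A leaf among these representatives stays a leaf: inclusions of intersections survive the
  removal, and injectivity keeps \<open>G - A\<close> and \<open>L - A\<close> distinct.\<close>

lemma forest_family_image_Diff:
  assumes "forest_family \<G>" "\<H> \<subseteq> (\<lambda>G. G - A) ` \<G>"
  shows "forest_family \<H>"
  unfolding forest_family_def
proof (intro allI impI)
  fix \<S> assume \<S>: "\<S> \<subseteq> \<H>" "\<S> \<noteq> {}"
  then have "\<S> \<subseteq> (\<lambda>G. G - A) ` \<G>" using assms(2) by blast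
  then obtain \<T>' where \<T>': "\<T>' \<subseteq> \<G>" "inj_on (\<lambda>G. G - A) \<T>'" "\<S> = (\<lambda>G. G - A) ` \<T>'"
    unfolding subset_image_inj by blast
  have "\<T>' \<noteq> {}" using \<T>'(3) \<S>(2) by auto
  then obtain L where L: "family_leaf \<T>' L"
    using assms(1) \<T>'(1) unfolding forest_family_def by auto
  have "family_leaf \<S> (L - A)"
  proof (cases "\<T>' = {L}")
    case True
    then show ?thesis by (simp add: family_leaf_def \<T>'(3))
  next
    case False
    then obtain G where G: "L \<in> \<T>'" "G \<in> \<T>'" "G \<noteq> L" "\<And>H. H \<in> \<T>' \<Longrightarrow> H \<noteq> L \<Longrightarrow> L \<inter> H \<subseteq> L \<inter> G"
      using L unfolding family_leaf_def by auto
    have GA: "G - A \<noteq> L - A"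
    proof
      assume "G - A = L - A"
      from inj_onD[OF \<T>'(2) this G(2,1)] G(3) show False by contradiction
    qed
    have H: "(L - A) \<inter> H \<subseteq> (L - A) \<inter> (G - A)" if HS: "H \<in> \<S>" "H \<noteq> L - A" for H
    proof -
      obtain K where K: "K \<in> \<T>'" "H = K - A" using HS(1) unfolding \<T>'(3) by blast
      then have "K \<noteq> L" using HS(2) by auto
      from G(4)[OF K(1) this] show ?thesis unfolding K(2) by fast
    qed
    have "G - A \<in> \<S>" "L - A \<in> \<S>" unfolding \<T>'(3) using G(1,2) by simp_all
    then show ?thesis
      unfolding family_leaf_def using GA H by (intro conjI disjI2 bexI[of _ "G - A"] ballI impI)
  qed
  then show "\<exists>L. family_leaf \<S> L" by blast
qed

text \<open>The induction is on the number of members. Both smaller families are covered because a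
  colon never has more generators than the family without \<open>L\<close>. Taking minimal sets
  restores incomparability, and the empty set does not arise since no other member lies inside
  \<open>L\<close>.\<close>

lemma forest_family_leaf_induct [consumes 3, case_names empty leaf]:
  fixes \<G> :: "'v::finite set set"
  assumes "forest_family \<G>" "incomparable \<G>" "{} \<notin> \<G>"
    and empty: "P {}"
    and leaf: "\<And>\<G> L x. L \<notin> \<G> \<Longrightarrow> x \<in> L \<Longrightarrow> forest_family (insert L \<G>) \<Longrightarrow> incomparable (insert L \<G>) \<Longrightarrow>
        {} \<notin> \<G> \<Longrightarrow> (\<And>G. G \<in> \<G> \<Longrightarrow> x \<notin> G) \<Longrightarrow> (\<And>G. G \<in> \<G> \<Longrightarrow> \<not> G \<subseteq> L) \<Longrightarrow> P \<G> \<Longrightarrow>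
        P (minimal_sets ((\<lambda>G. G - L) ` \<G>)) \<Longrightarrow> P (insert L \<G>)"
  shows "P \<G>"
  using assms(1-3)
proof (induction "card \<G>" arbitrary: \<G> rule: less_induct)
  case less
  show ?case
  proof (cases "\<G> = {}")
    case True
    then show ?thesis using empty by simp
  next
    case False
    then obtain L where L: "family_leaf \<G> L" using less.prems(1) unfolding forest_family_def by blast
    then have LG: "L \<in> \<G>" by (simp add: family_leaf_def)
    obtain x where x: "x \<in> L" "\<And>G. G \<in> \<G> \<Longrightarrow> G \<noteq> L \<Longrightarrow> x \<notin> G"
      using family_leaf_free_vertex[OF L less.prems(2,3)] by blast
    let ?H = "\<G> - {L}" and ?M = "minimal_sets ((\<lambda>G. G - L) ` (\<G> - {L}))"
    have card: "card ?H < card \<G>" by (rule card_Diff1_less[OF finite LG])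
    have "card ?M \<le> card ((\<lambda>G. G - L) ` ?H)" by (rule card_mono[OF _ minimal_sets_subset]) simp
    also have "\<dots> \<le> card ?H" by (rule card_image_le) simp
    finally have cardM: "card ?M < card \<G>" using card by simp
    have sub: "\<not> G \<subseteq> L" if "G \<in> ?H" for G
      using less.prems(2) LG that unfolding incomparable_def by blast
    have ins: "insert L ?H = \<G>" using LG by blast
    have H: "forest_family ?H" "incomparable ?H" "{} \<notin> ?H"
      using forest_family_mono[OF less.prems(1), of ?H] incomparable_mono[OF less.prems(2), of ?H]
        less.prems(3) by simp_all
    have M: "forest_family ?M" "{} \<notin> ?M"
      using forest_family_image_Diff[OF H(1) minimal_sets_subset] sub
        minimal_sets_subset[of "(\<lambda>G. G - L) ` ?H"] by fast+
    have "P (insert L ?H)"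
    proof (rule leaf[of L ?H x, OF _ x(1) _ _ H(3) _ sub])
      show "P ?H" by (rule less.hyps[OF card H])
      show "P ?M" by (rule less.hyps[OF cardM M(1) incomparable_minimal_sets M(2)])
      show "forest_family (insert L ?H)" "incomparable (insert L ?H)"
        unfolding ins by (rule less.prems)+
      show "x \<notin> G" if "G \<in> ?H" for G using x(2)[of G] that by blast
    qed simp_all
    then show ?thesis by (simp only: ins)
  qed
qed

text \<open>Being disjoint from \<open>L\<close>, the family \<open>\<C>\<close> is unchanged by the
  colon, so it is a mere spectator of the induction. Vanishing in negative degrees persists since
  the new contribution comes from the degree lowered by \<open>card L\<close>. It later ensures that
  sums starting at 0 miss nothing.\<close>

lemma forest_family_resolution:
  fixes \<G> \<C> :: "'v::finite set set"
  assumes "forest_family \<G>" "incomparable \<G>" "{} \<notin> \<G>" "{} \<notin> \<C>" "\<Union>\<C> \<inter> \<Union>\<G> = {}"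
    and "has_resolution (monomial_ideal \<C> :: ('v, 'k::field) polynomial set)"
    and "\<And>i j. j < 0 \<Longrightarrow> betti (monomial_ideal \<C> :: ('v, 'k) polynomial set) i j = 0"
  shows "has_resolution (monomial_ideal (\<C> \<union> \<G>) :: ('v, 'k) polynomial set) \<and>
    (\<forall>i j. j < 0 \<longrightarrow> betti (monomial_ideal (\<C> \<union> \<G>) :: ('v, 'k) polynomial set) i j = 0)"
  using assms(1-3,5)
proof (induction rule: forest_family_leaf_induct)
  case empty
  then show ?case using assms(6,7) by simp
next
  case (leaf \<G> L x)
  let ?M = "minimal_sets ((\<lambda>G. G - L) ` \<G>)"
  have dis: "\<Union>\<C> \<inter> \<Union>\<G> = {}" "\<Union>\<C> \<inter> \<Union>?M = {}"
    using leaf.prems minimal_sets_subset[of "(\<lambda>G. G - L) ` \<G>"] by blast+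
  have CL: "C \<inter> L = {}" if "C \<in> \<C>" for C using leaf.prems that by blast
  have eq: "(\<lambda>G. G - L) ` (\<C> \<union> \<G>) = \<C> \<union> (\<lambda>G. G - L) ` \<G>"
  proof -
    have "(\<lambda>G. G - L) ` \<C> = \<C>" using CL by (auto simp: Diff_triv image_iff)
    then show ?thesis by (simp add: image_Un)
  qed
  have ideal: "monomial_ideal ((\<lambda>G. G - L) ` (\<C> \<union> \<G>)) = (monomial_ideal (\<C> \<union> ?M) :: ('v, 'k) polynomial set)"
    unfolding eq monomial_ideal_minimal_sets ..
  have free: "x \<notin> G" "\<not> G \<subseteq> L" if "G \<in> \<C> \<union> \<G>" for G
  proof -
    have "x \<notin> G \<and> \<not> G \<subseteq> L"
    proof (cases "G \<in> \<C>")
      case True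
      then have "G \<inter> L = {}" "G \<noteq> {}" using CL assms(4) by auto
      then show ?thesis using leaf.hyps(2) by blast
    next
      case False
      then show ?thesis using leaf.hyps(6,7)[of G] that by simp
    qed
    then show "x \<notin> G" "\<not> G \<subseteq> L" by auto
  qed
  note * = leaf.IH(1)[OF dis(1)] leaf.IH(2)[OF dis(2)]
  note ins = betti_insert_free_vertex[of "\<C> \<union> \<G>" L x, where 'k = 'k, unfolded ideal,
      OF conjunct1[OF *(1)] conjunct1[OF *(2)] leaf.hyps(2) free]
  show ?case
    unfolding Un_insert_right
  proof (intro conjI allI impI)
    fix i j :: int assume j: "j < 0"
    then have "j - int (card L) < 0" by simp
    with j * have "betti (monomial_ideal (\<C> \<union> \<G>) :: ('v, 'k) polynomial set) i j = 0"
      "betti (monomial_ideal (\<C> \<union> ?M) :: ('v, 'k) polynomial set) (i - 1) (j - int (card L)) = 0" by blast+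
    then show "betti (monomial_ideal (insert L (\<C> \<union> \<G>)) :: ('v, 'k) polynomial set) i j = 0"
      using ins(2)[of i j] by (simp only: add_0)
  qed (rule ins(1))
qed

section \<open>The product formula\<close>

text \<open>The Kuenneth convolution, indexed as for quotient rings: index \<open>l1 - 1\<close> of
  an ideal is index \<open>l1\<close> of its quotient. Total index \<open>i\<close> therefore
  belongs to index \<open>i - 1\<close> of a sum of ideals.\<close>

definition betti_product :: "(int \<Rightarrow> int \<Rightarrow> nat) \<Rightarrow> (int \<Rightarrow> int \<Rightarrow> nat) \<Rightarrow> int \<Rightarrow> int \<Rightarrow> nat" where
  "betti_product a b i j = (\<Sum>l1 = 0..i. \<Sum>l2 = 0..j. a (l1 - 1) l2 * b (i - l1 - 1) (j - l2))"

text \<open>Terms of \<open>b''\<close> outside its range vanish, which lets the two summation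
  ranges shrink to those of the shifted product.\<close>

lemma betti_product_add_shift:
  assumes "\<And>i j. i < -1 \<or> j < 0 \<Longrightarrow> b'' i j = 0" "D \<ge> 0"
  shows "betti_product a (\<lambda>i j. b' i j + b'' (i - 1) (j - D)) i j =
    betti_product a b' i j + betti_product a b'' (i - 1) (j - D)"
proof -
  have inner: "(\<Sum>l2 = 0..j. a (l1 - 1) l2 * b'' k (j - l2 - D)) =
      (\<Sum>l2 = 0..j - D. a (l1 - 1) l2 * b'' k (j - D - l2))" for l1 k
  proof -
    have "(\<Sum>l2 = 0..j. a (l1 - 1) l2 * b'' k (j - l2 - D)) =
        (\<Sum>l2 = 0..j - D. a (l1 - 1) l2 * b'' k (j - l2 - D))"
      by (rule sum.mono_neutral_right) (use assms in auto)
    then show ?thesis by (simp add: algebra_simps)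
  qed
  have "(\<Sum>l1 = 0..i. \<Sum>l2 = 0..j - D. a (l1 - 1) l2 * b'' (i - l1 - 1 - 1) (j - D - l2)) =
      (\<Sum>l1 = 0..i - 1. \<Sum>l2 = 0..j - D. a (l1 - 1) l2 * b'' (i - l1 - 1 - 1) (j - D - l2))"
  proof (rule sum.mono_neutral_right)
    show "\<forall>l1\<in>{0..i} - {0..i - 1}. (\<Sum>l2 = 0..j - D. a (l1 - 1) l2 * b'' (i - l1 - 1 - 1) (j - D - l2)) = 0"
    proof
      fix l1 assume "l1 \<in> {0..i} - {0..i - 1}"
      \<comment> \<open>The only candidate is \<open>l1 = i\<close>, where the homological index is
        -2.\<close>
      then have "i - l1 - 1 - 1 < -1" by auto
      then show "(\<Sum>l2 = 0..j - D. a (l1 - 1) l2 * b'' (i - l1 - 1 - 1) (j - D - l2)) = 0"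
        using assms(1) by simp
    qed
  qed auto
  then show ?thesis
    by (simp add: betti_product_def distrib_left sum.distrib inner)
qed

text \<open>The value 1 at index -1 and degree 0 is what makes the Betti numbers of the zero ideal a
  unit: only the term \<open>l1 = i\<close>, \<open>l2 = j\<close> survives.\<close>

lemma betti_product_unit:
  assumes "\<And>i j. i < -1 \<or> j < 0 \<Longrightarrow> a i j = 0"
  shows "betti_product a (\<lambda>i j. if i = -1 \<and> j = 0 then 1 else 0) i j = a (i - 1) j"
proof (cases "i < 0 \<or> j < 0")
  case True
  then show ?thesis using assms by (auto simp: betti_product_def)
next
  case False
  have "(\<Sum>l2 = 0..j. a (l1 - 1) l2 * (if i - l1 - 1 = -1 \<and> j - l2 = 0 then 1 else 0)) =
      (if l1 = i then a (i - 1) j else 0)" for l1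
  proof -
    have "(\<Sum>l2 = 0..j. a (l1 - 1) l2 * (if i - l1 - 1 = -1 \<and> j - l2 = 0 then 1 else 0)) =
        (\<Sum>l2 = 0..j. if l2 = j then (if l1 = i then a (i - 1) j else 0) else 0)"
      by (rule sum.cong) auto
    also have "\<dots> = (if l1 = i then a (i - 1) j else 0)" using False by (subst sum.delta) auto
    finally show ?thesis .
  qed
  then show ?thesis using False by (simp add: betti_product_def)
qed

lemma betti_union_forest_family:
  fixes \<G> \<C> :: "'v::finite set set"
  assumes "forest_family \<G>" "incomparable \<G>" "{} \<notin> \<G>" "{} \<notin> \<C>" "\<Union>\<C> \<inter> \<Union>\<G> = {}"
    and "has_resolution (monomial_ideal \<C> :: ('v, 'k::field) polynomial set)"
    and "\<And>i j. j < 0 \<Longrightarrow> betti (monomial_ideal \<C> :: ('v, 'k) polynomial set) i j = 0"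
  shows "betti (monomial_ideal (\<C> \<union> \<G>) :: ('v, 'k) polynomial set) (i - 1) j =
    betti_product (betti (monomial_ideal \<C> :: ('v, 'k) polynomial set))
      (betti (monomial_ideal \<G> :: ('v, 'k) polynomial set)) i j"
  using assms(1-3,5)
proof (induction arbitrary: i j rule: forest_family_leaf_induct)
  case empty
  have "betti (monomial_ideal {} :: ('v, 'k) polynomial set) = (\<lambda>i j. if i = -1 \<and> j = 0 then 1 else 0)"
    by (simp add: fun_eq_iff betti_zero_ideal)
  moreover have "betti (monomial_ideal \<C> :: ('v, 'k) polynomial set) i j = 0" if "i < -1 \<or> j < 0" for i j
    using that assms(7) by (cases "j < 0") (simp_all, simp add: betti_def)
  ultimately show ?case by (simp only: Un_empty_right betti_product_unit)
next
  case (leaf \<G> L x)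
  let ?M = "minimal_sets ((\<lambda>G. G - L) ` \<G>)"
  let ?b = "\<lambda>\<S>. betti (monomial_ideal \<S> :: ('v, 'k) polynomial set)"
  have dis: "\<Union>\<C> \<inter> \<Union>\<G> = {}" "\<Union>\<C> \<inter> \<Union>?M = {}"
    using leaf.prems minimal_sets_subset[of "(\<lambda>G. G - L) ` \<G>"] by blast+
  have CL: "C \<inter> L = {}" if "C \<in> \<C>" for C using leaf.prems that by blast
  have eq: "(\<lambda>G. G - L) ` (\<C> \<union> \<G>) = \<C> \<union> (\<lambda>G. G - L) ` \<G>"
  proof -
    have "(\<lambda>G. G - L) ` \<C> = \<C>" using CL by (auto simp: Diff_triv image_iff)
    then show ?thesis by (simp add: image_Un)
  qed
  have ideal: "monomial_ideal ((\<lambda>G. G - L) ` (\<C> \<union> \<G>)) = (monomial_ideal (\<C> \<union> ?M) :: ('v, 'k) polynomial set)"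
    unfolding eq monomial_ideal_minimal_sets ..
  have ideal0: "monomial_ideal ((\<lambda>G. G - L) ` \<G>) = (monomial_ideal ?M :: ('v, 'k) polynomial set)"
    using monomial_ideal_minimal_sets[of "{}" "(\<lambda>G. G - L) ` \<G>", where 'k = 'k] by simp
  have free: "x \<notin> G" "\<not> G \<subseteq> L" if "G \<in> \<C> \<union> \<G>" for G
  proof -
    have "x \<notin> G \<and> \<not> G \<subseteq> L"
    proof (cases "G \<in> \<C>")
      case True
      then have "G \<inter> L = {}" "G \<noteq> {}" using CL assms(4) by auto
      then show ?thesis using leaf.hyps(2) by blast
    next
      case False
      then show ?thesis using leaf.hyps(6,7)[of G] that by simp
    qed
    then show "x \<notin> G" "\<not> G \<subseteq> L" by auto
  qed
  have forests: "forest_family \<G>" "incomparable \<G>" "{} \<notin> \<G>"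
    using forest_family_mono[OF leaf.hyps(3), of \<G>] incomparable_mono[OF leaf.hyps(4), of \<G>] leaf.hyps(5)
    by auto
  have forestsM: "forest_family ?M" "incomparable ?M" "{} \<notin> ?M"
    using forest_family_image_Diff[OF forests(1) minimal_sets_subset] incomparable_minimal_sets
      leaf.hyps(7) minimal_sets_subset[of "(\<lambda>G. G - L) ` \<G>"] by fast+
  have empty: "has_resolution (monomial_ideal {} :: ('v, 'k) polynomial set)"
    "\<And>i j. j < 0 \<Longrightarrow> ?b {} i j = 0"
    using quotient_resolution_zero by (auto simp: has_resolution_def betti_zero_ideal)
  note res1 = forest_family_resolution[OF forests(1-3) assms(4) dis(1) assms(6,7)]
    and res2 = forest_family_resolution[OF forestsM assms(4) dis(2) assms(6,7)]
    and res3 = forest_family_resolution[OF forests(1-3), of "{}", OF _ _ empty, simplified]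
    and res4 = forest_family_resolution[OF forestsM, of "{}", OF _ _ empty, simplified]
  \<comment> \<open>The same leaf \<open>L\<close> and free vertex \<open>x\<close> serve twice:
    here for the union with \<open>\<C>\<close>, below for the family alone. The first recursion
    governs the left side of the claim, the second the right.\<close>
  have split1: "?b (\<C> \<union> insert L \<G>) i j = ?b (\<C> \<union> \<G>) i j + ?b (\<C> \<union> ?M) (i - 1) (j - int (card L))" for i j
    unfolding Un_insert_right
    by (rule betti_insert_free_vertex(2)[of "\<C> \<union> \<G>" L x, where 'k = 'k, unfolded ideal,
          OF conjunct1[OF res1] conjunct1[OF res2] leaf.hyps(2) free])
  have "?b (insert L \<G>) i j = ?b \<G> i j + ?b ?M (i - 1) (j - int (card L))" for i j
    by (rule betti_insert_free_vertex(2)[of \<G> L x, where 'k = 'k, unfolded ideal0,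
          OF conjunct1[OF res3] conjunct1[OF res4] leaf.hyps(2,6,7)])
  then have split2: "?b (insert L \<G>) = (\<lambda>i j. ?b \<G> i j + ?b ?M (i - 1) (j - int (card L)))"
    by (simp add: fun_eq_iff)
  have van: "?b ?M i j = 0" if "i < -1 \<or> j < 0" for i j
  proof (cases "j < 0")
    case False
    then show ?thesis using that by (simp add: betti_def)
  qed (use res4 in blast)
  show ?case
    unfolding split1 split2 leaf.IH(1)[OF dis(1)] leaf.IH(2)[OF dis(2)]
    by (rule betti_product_add_shift[OF van, symmetric]) simp_all
qed

section \<open>Simplicial forests\<close>

definition reachable :: "'v set set \<Rightarrow> 'v set \<Rightarrow> 'v set \<Rightarrow> bool" where
  "reachable \<S> = (\<lambda>A B. A \<in> \<S> \<and> B \<in> \<S> \<and> A \<inter> B \<noteq> {})\<^sup>*\<^sup>*"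

definition component :: "'v set set \<Rightarrow> 'v set \<Rightarrow> 'v set set" where
  "component \<S> F = {G \<in> \<S>. reachable \<S> F G}"

lemma connected_facets_iff:
  "connected_facets \<Delta> F G \<longleftrightarrow> F \<in> facets \<Delta> \<and> G \<in> facets \<Delta> \<and> reachable (facets \<Delta>) F G"
  by (simp add: connected_facets_def reachable_def)

lemma leaf_iff: "leaf \<Delta> F \<longleftrightarrow> family_leaf (facets \<Delta>) F"
  by (simp add: leaf_def family_leaf_def)

lemma facet_ideal_eq: "facet_ideal \<Delta> = monomial_ideal (facets \<Delta>)"
  by (simp add: facet_ideal_def monomial_ideal_def)

lemma incomparable_facets: "incomparable (facets \<Delta>)"
  unfolding incomparable_def facets_def by blast

lemma facets_generated_complex:
  assumes "incomparable \<G>"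
  shows "facets (generated_complex \<G>) = \<G>"
proof (intro equalityI subsetI)
  fix F assume F: "F \<in> facets (generated_complex \<G>)"
  then obtain G where G: "G \<in> \<G>" "F \<subseteq> G" by (auto simp: facets_def generated_complex_def)
  then have "G \<in> generated_complex \<G>" by (auto simp: generated_complex_def)
  then have "G = F" using F G(2) by (auto simp: facets_def)
  then show "F \<in> \<G>" using G(1) by simp
next
  fix F assume F: "F \<in> \<G>"
  have "G = F" if "G \<in> generated_complex \<G>" "F \<subseteq> G" for G
  proof -
    obtain H where H: "H \<in> \<G>" "G \<subseteq> H" using \<open>G \<in> generated_complex \<G>\<close> by (auto simp: generated_complex_def)
    then have "F = H" using assms F \<open>F \<subseteq> G\<close> unfolding incomparable_def by (meson order_trans)
    then show ?thesis using H(2) \<open>F \<subseteq> G\<close> by simp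
  qed
  moreover have "F \<in> generated_complex \<G>" using F by (auto simp: generated_complex_def)
  ultimately show "F \<in> facets (generated_complex \<G>)" by (auto simp: facets_def)
qed

lemma simplicial_complex_generated:
  "simplicial_complex (\<Union>(generated_complex \<G>)) (generated_complex \<G>)"
  unfolding simplicial_complex_def generated_complex_def by blast

lemma component_subset: "component \<S> F \<subseteq> \<S>"
  by (auto simp: component_def)

lemma component_self: "F \<in> \<S> \<Longrightarrow> F \<in> component \<S> F"
  by (simp add: component_def reachable_def)

lemma component_closed:
  assumes "G \<in> component \<S> F" "H \<in> \<S>" "G \<inter> H \<noteq> {}"
  shows "H \<in> component \<S> F"
  using assms unfolding component_def reachable_def
  by (auto intro: rtranclp.rtrancl_into_rtrancl)

lemma reachable_mono:
  assumes "\<S> \<subseteq> \<T>" "reachable \<S> F G"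
  shows "reachable \<T> F G"
  using assms(2) unfolding reachable_def
  by (rule rtranclp_mono[THEN predicate2D, rotated]) (use assms(1) in blast)

lemma reachable_sym: "reachable \<S> F G \<Longrightarrow> reachable \<S> G F"
  unfolding reachable_def
  by (rule sympD[OF symp_rtranclp]) (auto simp: symp_def)

text \<open>A chain starting at \<open>F\<close> never leaves the component of \<open>F\<close>, so
  the component is connected through its own members.\<close>

lemma reachable_component:
  assumes "F \<in> \<S>" "reachable \<S> F G"
  shows "reachable (component \<S> F) F G"
  using assms(2) unfolding reachable_def
proof (induction rule: rtranclp_induct)
  case base
  then show ?case by simp
next
  case (step G H)
  have "G \<in> component \<S> F" using step.hyps by (simp add: component_def reachable_def)
  moreover from this have "H \<in> component \<S> F" using step.hyps(2) component_closed by blast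
  ultimately show ?case using step.IH step.hyps(2) by (auto intro: rtranclp.rtrancl_into_rtrancl)
qed

lemma connected_component:
  assumes "incomparable \<S>" "F \<in> \<S>"
  shows "connected_complex (generated_complex (component \<S> F))"
proof -
  have fac: "facets (generated_complex (component \<S> F)) = component \<S> F"
    by (rule facets_generated_complex[OF incomparable_mono[OF assms(1) component_subset]])
  have "reachable (component \<S> F) A B" if "A \<in> component \<S> F" "B \<in> component \<S> F" for A B
  proof -
    have "reachable (component \<S> F) F A" "reachable (component \<S> F) F B"
      using that reachable_component[OF assms(2)] by (simp_all add: component_def)
    from reachable_sym[OF this(1)] this(2) show ?thesis
      unfolding reachable_def by (rule rtranclp_trans)
  qed
  then show ?thesis by (simp add: connected_complex_def connected_facets_iff fac)
qed

lemma conn_eq: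
  assumes "F \<in> facets \<Delta>"
  shows "conn \<Delta> F = generated_complex (component (facets \<Delta>) F)"
    and "facets (conn \<Delta> F) = component (facets \<Delta>) F"
proof -
  show c: "conn \<Delta> F = generated_complex (component (facets \<Delta>) F)"
    using assms by (simp add: conn_def connected_facets_iff component_def)
  show "facets (conn \<Delta> F) = component (facets \<Delta>) F"
    unfolding c by (rule facets_generated_complex[OF incomparable_mono[OF incomparable_facets component_subset]])
qed

lemma facets_nonempty:
  fixes \<Delta> :: "'v::finite set set"
  assumes "\<Delta> \<noteq> {}"
  shows "facets \<Delta> \<noteq> {}"
proof -
  obtain F where F: "F \<in> \<Delta>" "\<And>G. G \<in> \<Delta> \<Longrightarrow> F \<subseteq> G \<Longrightarrow> F = G"
    using finite_has_maximal[of \<Delta>] assms by auto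
  have "F \<in> facets \<Delta>" unfolding facets_def using F by (simp add: eq_commute[of _ F])
  then show ?thesis by blast
qed

text \<open>The facets of a nonempty subcomplex of a component form a nonempty subfamily of
  \<open>\<G>\<close>, to which the hereditary leaf property applies directly.\<close>

lemma simplicial_forest_generated:
  fixes \<G> :: "'v::finite set set"
  assumes "forest_family \<G>" "incomparable \<G>"
  shows "simplicial_forest (\<Union>(generated_complex \<G>)) (generated_complex \<G>)"
proof -
  let ?\<Delta> = "generated_complex \<G>"
  have fac: "facets ?\<Delta> = \<G>" by (rule facets_generated_complex[OF assms(2)])
  have "tree (conn ?\<Delta> F)" if F: "F \<in> \<G>" for F
  proof -
    have F': "F \<in> facets ?\<Delta>" using F fac by simp
    have "connected_complex (conn ?\<Delta> F)"
      unfolding conn_eq(1)[OF F'] fac by (rule connected_component[OF assms(2) F])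
    moreover have "\<exists>L. leaf \<Gamma> L" if \<Gamma>: "subcomplex \<Gamma> (conn ?\<Delta> F)" "\<Gamma> \<noteq> {}" for \<Gamma>
    proof -
      have "facets \<Gamma> \<subseteq> \<G>"
        using \<Gamma>(1) component_subset[of \<G> F] conn_eq(2)[OF F'] fac by (auto simp: subcomplex_def)
      moreover have "facets \<Gamma> \<noteq> {}" by (rule facets_nonempty[OF \<Gamma>(2)])
      ultimately show ?thesis using assms(1) unfolding forest_family_def leaf_iff by simp
    qed
    ultimately show ?thesis unfolding tree_def by blast
  qed
  then show ?thesis
    unfolding simplicial_forest_def fac using simplicial_complex_generated[of \<G>] by simp
qed

text \<open>
  A leaf of the component of \<open>F\<close> in \<open>\<S>\<close> is a leaf of \<open>\<S>\<close>, because it is disjoint from the members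
  outside the component.
\<close>

lemma forest_family_facets:
  assumes "simplicial_forest V \<Delta>"
  shows "forest_family (facets \<Delta>)"
  unfolding forest_family_def
proof (intro allI impI)
  fix \<S> assume \<S>: "\<S> \<subseteq> facets \<Delta>" "\<S> \<noteq> {}"
  then obtain F where F: "F \<in> \<S>" by blast
  then have F': "F \<in> facets \<Delta>" using \<S>(1) by blast
  have inc: "incomparable \<S>" by (rule incomparable_mono[OF incomparable_facets \<S>(1)])
  \<comment> \<open>The component is taken inside \<open>\<S>\<close>: it is connected, unlike
    \<open>\<S>\<close> in general, and generates a subcomplex of the tree
    \<open>conn \<Delta> F\<close>.\<close>
  let ?K = "component \<S> F" and ?\<Gamma> = "generated_complex (component \<S> F)"
  have fac: "facets ?\<Gamma> = ?K"
    by (rule facets_generated_complex[OF incomparable_mono[OF inc component_subset]])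
  have "?K \<subseteq> component (facets \<Delta>) F"
    using \<S>(1) reachable_mono[OF \<S>(1)] by (auto simp: component_def)
  then have "subcomplex ?\<Gamma> (conn \<Delta> F)"
    unfolding subcomplex_def fac conn_eq(2)[OF F'] using simplicial_complex_generated[of ?K] by simp
  moreover have "?\<Gamma> \<noteq> {}" using component_self[OF F] by (auto simp: generated_complex_def)
  moreover have "connected_complex ?\<Gamma>" by (rule connected_component[OF inc F])
  moreover have "tree (conn \<Delta> F)" using assms F' by (simp add: simplicial_forest_def)
  ultimately have "\<exists>L. leaf ?\<Gamma> L" unfolding tree_def by blast
  then obtain L where L: "family_leaf ?K L" unfolding leaf_iff fac by blast
  then have LK: "L \<in> ?K" by (simp add: family_leaf_def)
  then have LS: "L \<in> \<S>" using component_subset by (rule subsetD[rotated])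
  have outside: "L \<inter> H = {}" if "H \<in> \<S>" "H \<notin> ?K" for H
    using component_closed[OF LK \<open>H \<in> \<S>\<close>] that by blast
  have "family_leaf \<S> L"
  proof (cases "?K = {L}")
    case True
    show ?thesis
    proof (cases "\<S> = {L}")
      case True
      then show ?thesis by (simp add: family_leaf_def)
    next
      case False
      \<comment> \<open>\<open>L\<close> meets no other member of \<open>\<S>\<close>, so any of
        them can play the part of \<open>G\<close> in the definition of a leaf.\<close>
      then obtain G where G: "G \<in> \<S>" "G \<noteq> L" using LS by blast
      have "L \<inter> H \<subseteq> L \<inter> G" if "H \<in> \<S>" "H \<noteq> L" for H
        using outside[of H] that True by simp
      then show ?thesis unfolding family_leaf_def using LS G by blast
    qed
  next
    case False
    then obtain G where G: "G \<in> ?K" "G \<noteq> L" "\<And>H. H \<in> ?K \<Longrightarrow> H \<noteq> L \<Longrightarrow> L \<inter> H \<subseteq> L \<inter> G"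
      using L unfolding family_leaf_def by auto
    have "L \<inter> H \<subseteq> L \<inter> G" if "H \<in> \<S>" "H \<noteq> L" for H
      using outside[of H] G(3)[of H] that by (cases "H \<in> ?K") simp_all
    moreover have "G \<in> \<S>" using G(1) component_subset by (rule subsetD[rotated])
    ultimately show ?thesis unfolding family_leaf_def using LS G(2) by blast
  qed
  then show "\<exists>L. family_leaf \<S> L" by blast
qed

theorem theorem5p8:
  fixes \<Delta> :: "'v::finite set set" and F :: "'v set"
  assumes "simplicial_forest UNIV \<Delta>"
    and "leaf \<Delta> F"
  shows "simplicial_forest (\<Union>(remove_facet \<Delta> F)) (remove_facet \<Delta> F) \<and>
    simplicial_forest (\<Union>(remove_subcomplex \<Delta> (conn \<Delta> F))) (remove_subcomplex \<Delta> (conn \<Delta> F)) \<and>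
    simplicial_forest (\<Union>(conn_bar \<Delta> F)) (conn_bar \<Delta> F) \<and>
    (\<forall>i j :: int. i \<ge> 1 \<longrightarrow> j \<ge> 0 \<longrightarrow>
      betti (facet_ideal \<Delta> :: ('v, 'k::field) polynomial set) i j =
      betti (facet_ideal (remove_facet \<Delta> F) :: ('v, 'k) polynomial set) i j +
      (\<Sum>l1 = 0..i. \<Sum>l2 = 0..j - int (card F).
         betti (facet_ideal (conn_bar \<Delta> F) :: ('v, 'k) polynomial set) (l1 - 1) l2 *
         betti (facet_ideal (remove_subcomplex \<Delta> (conn \<Delta> F)) :: ('v, 'k) polynomial set)
           (i - l1 - 1) (j - int (card F) - l2)))"
proof -
  \<comment> \<open>\<open>K\<close> will be the facet set of \<open>conn \<Delta> F\<close> and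
    \<open>M\<close> that of \<open>conn_bar \<Delta> F\<close>.\<close>
  define \<G> K where "\<G> = facets \<Delta>" and "K = component \<G> F"
  define M where "M = minimal_sets ((\<lambda>G. G - F) ` (K - {F}))"
  let ?b = "\<lambda>\<S>. betti (monomial_ideal \<S> :: ('v, 'k) polynomial set)"
  have leaf: "family_leaf \<G> F" using assms(2) by (simp add: leaf_iff \<G>_def)
  then have F: "F \<in> \<G>" by (simp add: family_leaf_def)
  have KG: "K \<subseteq> \<G>" unfolding K_def by (rule component_subset)
  have forest: "forest_family \<G>" unfolding \<G>_def by (rule forest_family_facets[OF assms(1)])
  have inc: "incomparable \<G>" unfolding \<G>_def by (rule incomparable_facets)
  have nonempty: "{} \<notin> \<G>"
  proof
    assume "{} \<in> \<G>"
    \<comment> \<open>The vertex type is inhabited, so a singleton face prevents the empty set from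
      being maximal.\<close>
    moreover have "{undefined} \<in> \<Delta>"
      using assms(1) by (simp add: simplicial_forest_def simplicial_complex_def)
    ultimately have "{undefined} = ({} :: 'v set)" unfolding \<G>_def facets_def by blast
    then show False by simp
  qed
  have sub: "forest_family \<S>" "incomparable \<S>" "{} \<notin> \<S>" if "\<S> \<subseteq> \<G>" for \<S>
    using forest_family_mono[OF forest that] incomparable_mono[OF inc that] nonempty that by auto
  have notsub: "\<not> G \<subseteq> F" if "G \<in> \<G>" "G \<noteq> F" for G
    using inc F that unfolding incomparable_def by auto
  have M: "forest_family M" "incomparable M" "{} \<notin> M"
  proof -
    show "forest_family M"
      unfolding M_def
      by (rule forest_family_image_Diff[OF sub(1)[OF KG], where A = F],
          rule subset_trans[OF minimal_sets_subset image_mono[OF Diff_subset]])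
    show "incomparable M" unfolding M_def by (rule incomparable_minimal_sets)
    show "{} \<notin> M"
    proof
      assume "{} \<in> M"
      then have "{} \<in> (\<lambda>G. G - F) ` (K - {F})" unfolding M_def by (rule subsetD[OF minimal_sets_subset])
      then obtain G where "G \<in> K" "G \<noteq> F" "G \<subseteq> F" by auto
      then show False using notsub[of G] KG by auto
    qed
  qed
  have conn: "facets (conn \<Delta> F) = K"
    using conn_eq(2) F by (simp add: \<G>_def K_def)
  have defs: "remove_facet \<Delta> F = generated_complex (\<G> - {F})"
    "remove_subcomplex \<Delta> (conn \<Delta> F) = generated_complex (\<G> - K)"
    by (simp_all add: remove_facet_def remove_subcomplex_def conn \<G>_def)
  have "facets (remove_facet (conn \<Delta> F) F) = K - {F}"
    unfolding remove_facet_def conn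
    by (rule facets_generated_complex) (rule sub(2), use KG in auto)
  then have defM: "conn_bar \<Delta> F = generated_complex M"
    by (simp add: conn_bar_def M_def)
  have facets: "facets (generated_complex (\<G> - {F})) = \<G> - {F}"
    "facets (generated_complex (\<G> - K)) = \<G> - K" "facets (generated_complex M) = M"
    by (intro facets_generated_complex sub(2) M(2) Diff_subset)+
  have forests: "simplicial_forest (\<Union>(generated_complex \<S>)) (generated_complex \<S>)" if "\<S> \<subseteq> \<G>" for \<S>
    by (rule simplicial_forest_generated[OF sub(1,2)[OF that]])
  obtain x where x: "x \<in> F" "\<And>G. G \<in> \<G> \<Longrightarrow> G \<noteq> F \<Longrightarrow> x \<notin> G"
    using family_leaf_free_vertex[OF leaf inc nonempty] by blast
  have disj: "G \<inter> H = {}" if "G \<in> K" "H \<in> \<G> - K" for G H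
    using that component_closed[of G \<G> F H] unfolding K_def by auto
  have empty: "has_resolution (monomial_ideal {} :: ('v, 'k) polynomial set)"
    "\<And>i j. j < 0 \<Longrightarrow> ?b {} i j = 0"
    using quotient_resolution_zero by (auto simp: has_resolution_def betti_zero_ideal)
  have resolution: "has_resolution (monomial_ideal \<S> :: ('v, 'k) polynomial set) \<and>
      (\<forall>i j. j < 0 \<longrightarrow> ?b \<S> i j = 0)" if "forest_family \<S>" "incomparable \<S>" "{} \<notin> \<S>" for \<S>
    using forest_family_resolution[OF that, of "{}", OF _ _ empty] by simp
  \<comment> \<open>The sets in \<open>M\<close> lie inside members of the component of
    \<open>F\<close>, which meet no facet outside it.\<close>
  have MK: "\<Union>M \<inter> \<Union>(\<G> - K) = {}"
  proof -
    have "\<Union>M \<subseteq> \<Union>K" unfolding M_def using minimal_sets_subset[of "(\<lambda>G. G - F) ` (K - {F})"] by auto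
    then show ?thesis using disj by blast
  qed
  have "has_resolution (monomial_ideal M :: ('v, 'k) polynomial set)"
    "\<And>i j. j < 0 \<Longrightarrow> ?b M i j = 0"
    using resolution[OF M] by auto
  note * = sub[OF Diff_subset, of K] M(3) MK this
  have product: "?b (M \<union> (\<G> - K)) (i - 1) j = betti_product (?b M) (?b (\<G> - K)) i j" for i j
    by (rule betti_union_forest_family[OF *])
  have union: "has_resolution (monomial_ideal (M \<union> (\<G> - K)) :: ('v, 'k) polynomial set)"
    using forest_family_resolution[OF *] by blast
  \<comment> \<open>Facets outside the component do not meet \<open>F\<close> and stay as they are;
    those inside yield \<open>conn_bar\<close> before minimisation. This identifies the colon
    ideal.\<close>
  have "(\<lambda>G. G - F) ` (\<G> - {F}) = (\<G> - K) \<union> (\<lambda>G. G - F) ` (K - {F})"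
  proof -
    have FK: "F \<in> K" unfolding K_def by (rule component_self[OF F])
    have "\<G> - {F} = (\<G> - K) \<union> (K - {F})" using FK KG by blast
    moreover have "(\<lambda>G. G - F) ` (\<G> - K) = (\<lambda>G. G) ` (\<G> - K)"
      by (rule image_cong) (use disj[OF FK] in auto)
    ultimately show ?thesis by (simp add: image_Un)
  qed
  then have ideal: "monomial_ideal ((\<lambda>G. G - F) ` (\<G> - {F})) =
      (monomial_ideal (M \<union> (\<G> - K)) :: ('v, 'k) polynomial set)"
    unfolding M_def Un_commute[of "minimal_sets _"] monomial_ideal_minimal_sets by (rule arg_cong)
  have "?b (insert F (\<G> - {F})) i j =
      ?b (\<G> - {F}) i j + ?b ((\<lambda>G. G - F) ` (\<G> - {F})) (i - 1) (j - int (card F))" for i j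
  proof (rule betti_insert_free_vertex(2))
    show "has_resolution (monomial_ideal (\<G> - {F}) :: ('v, 'k) polynomial set)"
      using resolution[OF sub[OF Diff_subset]] by blast
    show "has_resolution (monomial_ideal ((\<lambda>G. G - F) ` (\<G> - {F})) :: ('v, 'k) polynomial set)"
      unfolding ideal by (rule union)
  qed (use x notsub in auto)
  moreover have "insert F (\<G> - {F}) = \<G>" using F by auto
  \<comment> \<open>The cone contributes the colon ideal at index \<open>i - 1\<close>, which is the
    index at which \<open>product\<close> evaluates the convolution with parameter
    \<open>i\<close>.\<close>
  ultimately have rec: "?b \<G> i j = ?b (\<G> - {F}) i j + betti_product (?b M) (?b (\<G> - K)) i (j - int (card F))" for i j
    by (simp only: ideal product)
  show ?thesis
    unfolding defs defM facet_ideal_eq facets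
    using forests[OF Diff_subset] simplicial_forest_generated[OF M(1,2)] rec
    by (simp add: betti_product_def flip: \<G>_def)
qed

end
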